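(* Let $d\ge 1$ and let $A$ be a $d\times d$ integer matrix with eigenvalues $\lambda_1,\dots,\lambda_d\in\mathbb{C}$ (counted with algebraic multiplicity) satisfying $1<|\lambda_1|\le|\lambda_2|\le\dots\le|\lambda_d|$. Let $T\colon\mathbb{T}^d\to\mathbb{T}^d$ be $Tx=Ax \pmod 1$. Let $\psi\colon\mathbb{N}\to(0,\infty)$ be a decreasing function with $\psi(n)\to0$ as $n\to\infty$, and let $\alpha=\liminf_{n\to\infty}\frac{-\log\psi(n)}{n}\in[0,\infty]$. If $\alpha\ge\log|\lambda_d/\lambda_1|$, then $$\dim_{\rm H}R(\psi)=\min_{1\le j\le d}\left\{\frac{j\log|\lambda_j|+\sum_{i=j+1}^d\log|\lambda_i|}{\alpha+\log|\lambda_j|}\right\}.$$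
   Context: $\mathbb{T}^d=\mathbb{R}^d/\mathbb{Z}^d$ is the $d$-dimensional torus with the usual quotient distance, and $B(x,r)$ is the ball with centre $x$ and radius $r$ in this distance. The recurrence set is $R(\psi)=\{x\in\mathbb{T}^d : T^n x\in B(x,\psi(n))\text{ for infinitely many }n\ge1\}$. $\dim_{\rm H}$ denotes Hausdorff dimension. When $\alpha=\infty$, the right-hand side is interpreted as $0$. *)

theory Defs
  imports "HOL-Analysis.Analysis" "HOL-Computational_Algebra.Polynomial"
begin

quotient_type 'n torus = "real ^ ('n::finite)" /
  "\<lambda>x y. \<forall>i. x $ i - y $ i \<in> \<int>"
  morphisms torus_rep torus_of
proof (rule equivpI)
  show "reflp (\<lambda>(x::real^'n) y. \<forall>i. x $ i - y $ i \<in> \<int>)"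
    by (simp add: reflp_def)
  show "symp (\<lambda>(x::real^'n) y. \<forall>i. x $ i - y $ i \<in> \<int>)"
    unfolding symp_def by (metis Ints_minus minus_diff_eq)
  show "transp (\<lambda>(x::real^'n) y. \<forall>i. x $ i - y $ i \<in> \<int>)"
  proof (rule transpI, rule allI)
    fix x y z :: "real ^ 'n" and i
    assume "\<forall>i. x $ i - y $ i \<in> \<int>" "\<forall>i. y $ i - z $ i \<in> \<int>"
    then have "(x $ i - y $ i) + (y $ i - z $ i) \<in> \<int>" by (blast intro: Ints_add)
    then show "x $ i - z $ i \<in> \<int>" by simp
  qed
qed

lemma torus_of_eq_iff: "torus_of x = torus_of y \<longleftrightarrow> (\<forall>i. x $ i - y $ i \<in> \<int>)"
  by (rule torus.abs_eq_iff)

lemma torus_of_surj: "\<exists>x. torus_of x = p"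
  using Quotient3_abs_rep[OF Quotient3_torus] by blast

instantiation torus :: (finite) metric_space
begin

definition dist_torus :: "'a torus \<Rightarrow> 'a torus \<Rightarrow> real" where
  "dist_torus p q = Inf {dist x y | x y. torus_of x = p \<and> torus_of y = q}"

definition uniformity_torus :: "('a torus \<times> 'a torus) filter" where
  "uniformity_torus = (INF e\<in>{0 <..}. principal {(x::'a torus, y). dist x y < e})"

definition open_torus :: "'a torus set \<Rightarrow> bool" where
  "open_torus U = (\<forall>x\<in>U. eventually (\<lambda>(x', y). x' = x \<longrightarrow> y \<in> U) uniformity)"

instance
proof
  have bdd: "bdd_below {dist x y | x y. torus_of x = p \<and> torus_of y = q}" for p q :: "'a torus"
    by (rule bdd_belowI[of _ 0]) auto
  have ne: "{dist x y | x y. torus_of x = p \<and> torus_of y = q} \<noteq> {}" for p q :: "'a torus"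
    using torus_of_surj[of p] torus_of_surj[of q] by auto
  have approx: "\<exists>x y. torus_of x = p \<and> torus_of y = q \<and> dist x y < c"
    if "dist p q < c" for p q :: "'a torus" and c
    using that ne[of p q] bdd[of p q] unfolding dist_torus_def
    by (subst (asm) cInf_less_iff) auto
  have le: "dist p q \<le> dist x y" if "torus_of x = p" "torus_of y = q"
    for p q :: "'a torus" and x y
    unfolding dist_torus_def by (rule cInf_lower) (use that bdd in auto)
  have nonneg: "0 \<le> dist p q" for p q :: "'a torus"
    unfolding dist_torus_def by (rule cInf_greatest[OF ne]) auto
  show "dist p q = 0 \<longleftrightarrow> p = q" for p q :: "'a torus"
  proof
    assume "p = q"
    obtain x where "torus_of x = p" using torus_of_surj by blast
    from le[OF this, of x q] \<open>p = q\<close> this nonneg[of p q] show "dist p q = 0" by auto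
  next
    assume d0: "dist p q = 0"
    obtain x y where xy: "torus_of x = p" "torus_of y = q" using torus_of_surj by metis
    have "x $ i - y $ i \<in> \<int>" for i
    proof (rule ccontr)
      let ?c = "x $ i - y $ i"
      assume nin: "?c \<notin> \<int>"
      define e where "e = min (frac ?c) (1 - frac ?c)"
      have "e > 0" using nin frac_lt_1[of ?c] unfolding e_def by (simp add: frac_gt_0_iff)
      then obtain u v where uv: "torus_of u = p" "torus_of v = q" "dist u v < e"
        using approx d0 by metis
      have "u $ i - x $ i \<in> \<int>" "v $ i - y $ i \<in> \<int>"
        using uv xy torus_of_eq_iff by metis+
      then obtain a b where a: "u $ i - x $ i = of_int a" and b: "v $ i - y $ i = of_int b"
        by (auto elim!: Ints_cases)
      have "\<bar>u $ i - v $ i\<bar> < e"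
        using uv(3) dist_vec_nth_le[of u i v] by (simp add: dist_real_def)
      moreover define m where "m = a - b + \<lfloor>?c\<rfloor>"
      have "u $ i - v $ i = frac ?c + of_int m"
        using a b unfolding frac_def m_def by simp
      moreover have "m \<ge> 0 \<or> m \<le> -1" by linarith
      then have "real_of_int m \<ge> 0 \<or> real_of_int m \<le> -1" by (elim disjE) linarith+
      ultimately show False using frac_ge_0[of ?c] frac_lt_1[of ?c] unfolding e_def by linarith
    qed
    then show "p = q" using xy torus_of_eq_iff by metis
  qed
  show "dist p q \<le> dist p r + dist q r" for p q r :: "'a torus"
  proof (rule field_le_epsilon)
    fix e :: real assume "e > 0"
    obtain x z where 1: "torus_of x = p" "torus_of z = r" "dist x z < dist p r + e / 2"
      using approx[of p r "dist p r + e / 2"] \<open>e > 0\<close> by auto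
    obtain y w where 2: "torus_of y = q" "torus_of w = r" "dist y w < dist q r + e / 2"
      using approx[of q r "dist q r + e / 2"] \<open>e > 0\<close> by auto
    have "torus_of (y + (z - w)) = torus_of y"
      using 1(2) 2(2) torus_of_eq_iff[of z w] torus_of_eq_iff[of "y + (z - w)" y] by simp
    then have "dist p q \<le> dist x (y + (z - w))" using le 1(1) 2(1) by simp
    also have "\<dots> \<le> dist x z + dist z (y + (z - w))" by (rule dist_triangle)
    also have "dist z (y + (z - w)) = dist y w"
      by (simp add: dist_norm norm_minus_commute algebra_simps)
    finally show "dist p q \<le> dist p r + dist q r + e" using 1(3) 2(3) by simp
  qed
qed (rule uniformity_torus_def open_torus_def)+

end

lift_definition torus_map :: "int ^ 'n ^ 'n \<Rightarrow> 'n::finite torus \<Rightarrow> 'n torus"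
  is "\<lambda>A x. map_matrix real_of_int A *v x"
proof -
  fix A :: "int ^ 'n ^ 'n" and x y :: "real ^ 'n" and i
  assume *: "\<And>i. x $ i - y $ i \<in> \<int>"
  have "(map_matrix real_of_int A *v x) $ i - (map_matrix real_of_int A *v y) $ i
        = (\<Sum>j\<in>UNIV. real_of_int (A $ i $ j) * (x $ j - y $ j))"
    by (simp add: map_matrix_def matrix_vector_mult_def sum_subtractf algebra_simps)
  also have "\<dots> \<in> \<int>"
    by (intro Ints_sum Ints_mult Ints_of_int *)
  finally show "(map_matrix real_of_int A *v x) $ i - (map_matrix real_of_int A *v y) $ i \<in> \<int>" .
qed

definition recurrence_set :: "('a::metric_space \<Rightarrow> 'a) \<Rightarrow> (nat \<Rightarrow> real) \<Rightarrow> 'a set" where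
  "recurrence_set T \<psi> = {x. infinite {n. n \<ge> 1 \<and> (T ^^ n) x \<in> ball x (\<psi> n)}}"

definition charpoly :: "'a::comm_ring_1 ^ 'n ^ 'n \<Rightarrow> 'a poly" where
  "charpoly A = det (mat [:0, 1:] - map_matrix (\<lambda>a. [:a:]) A)"

text \<open>The gauge \<open>diam(U)\<^sup>s\<close> with the usual conventions that the empty set has gauge 0
  and that \<open>0\<^sup>0 = 1\<close> for nonempty sets (whereas \<open>0 powr 0 = 0\<close>).\<close>

definition hausdorff_gauge :: "real \<Rightarrow> 'a::metric_space set \<Rightarrow> ennreal" where
  "hausdorff_gauge s U =
     (if U = {} then 0 else if s = 0 then 1 else ennreal (diameter U powr s))"

text \<open>Boundedness is required because \<^const>\<open>diameter\<close> is unspecified on unbounded sets.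
  Finite covers are included, as members of the cover may be empty.\<close>

definition hausdorff_premeasure :: "real \<Rightarrow> real \<Rightarrow> 'a::metric_space set \<Rightarrow> ennreal" where
  "hausdorff_premeasure s \<delta> E =
     Inf {(\<Sum>i. hausdorff_gauge s (U i)) | U :: nat \<Rightarrow> 'a set.
            E \<subseteq> (\<Union>i. U i) \<and> (\<forall>i. bounded (U i) \<and> diameter (U i) \<le> \<delta>)}"

definition hausdorff_measure :: "real \<Rightarrow> 'a::metric_space set \<Rightarrow> ennreal" where
  "hausdorff_measure s E = (SUP \<delta>\<in>{0<..}. hausdorff_premeasure s \<delta> E)"

definition hausdorff_dim :: "'a::metric_space set \<Rightarrow> ereal" where
  "hausdorff_dim E = Inf {ereal s | s. s \<ge> 0 \<and> hausdorff_measure s E = 0}"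

end

theory Submission
  imports Defs "Jordan_Normal_Form.Schur_Decomposition"
begin

text \<open>Lifting to \<open>\<real>\<^sup>d\<close> and writing \<open>M\<^sub>n = A\<^sup>n - 1\<close>, a point is recurrent at time \<open>n\<close> iff \<open>M\<^sub>n x\<close> is
  \<open>\<psi>(n)\<close>-close to an integer vector, i.e. iff \<open>x\<close> lies in one of about \<open>\<Prod> |\<lambda>\<^sub>i|\<^sup>n\<close> ellipsoids.  A Schur
  triangularization gives one real coordinate system \<open>G\<close> in which all these ellipsoids lie in boxes with
  sides \<open>\<psi>(n) |\<lambda>\<^sub>i|\<^sup>-\<^sup>n\<close> up to subexponential factors; combined with the bound
  \<open>|det M\<^sub>n| \<le> 2\<^sup>d \<Prod> |\<lambda>\<^sub>i|\<^sup>n\<close> this is all that is used about \<open>A\<close>.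

  Upper bound: cut every box into pieces whose \<open>G\<close>-coordinates vary by at most \<open>\<psi>(n) |\<lambda>\<^sub>j|\<^sup>-\<^sup>n\<close>; the \<open>s\<close>-costs
  are summable for \<open>s\<close> above the \<open>j\<close>-th quotient.

  Lower bound: for \<open>s\<close> below all quotients, and for infinitely many \<open>n\<close>, normalised Lebesgue measure
  on the union of the ellipsoids inside a ball of radius \<open>R\<close> gives mass at most \<open>C (\<rho>/R)\<^sup>s\<close> to every ball of
  radius \<open>\<rho>\<close>, with \<open>C\<close> independent of \<open>R\<close> and \<open>n\<close>.  The hypothesis on \<open>\<alpha>\<close> enters here: the longest axis
  of an ellipsoid is at most the shortest side of a cell \<open>M\<^sub>n\<^sup>-\<^sup>1[0,1]\<^sup>d\<close>, up to subexponential factors.  Given a cheap cover, averaging over this measure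
  yields a tiny ball inside one ellipsoid that is again cheaply covered; iterating, one reaches a
  recurrent point that no member of the cover contains.\<close>

text \<open>The axes of the ellipsoids may turn with \<open>n\<close>, and Jordan blocks and complex
  eigenvalues rule out diagonal coordinates. Hence only a one-sided statement is sought: containment
  in boxes that are fixed up to scaling of their sides. This suffices because the upper bound for
  the determinant limits the number of ellipsoids. The order of the diagonal is essential: with
  moduli increasing, back substitution gives each coordinate its own rate, whereas in the opposite
  order a fast coordinate would inherit the rate of a slow one.

  In the lower bound no limit measure is built. The property passed from ball to ball is that the
  cover costs less than \<open>c * R powr s\<close> there, always with the same \<open>c\<close>;
  this is why the mass constant may not degrade with \<open>R\<close>. The gap between
  \<open>s\<close> and the quotients provides an exponential gain at small radii, which beats both
  the subexponential losses and the constants that do depend on \<open>R\<close>. The threshold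
  \<open>\<psi> n / 2\<close> in place of \<open>\<psi> n\<close> leaves room for a whole ball
  around the chosen point.\<close>

no_notation vec_index (infixl "$" 100)
hide_const (open) Matrix.mat Matrix.vec Matrix.row Matrix.col Determinant.det Matrix.transpose_mat
hide_fact (open) Matrix.vec_eq_iff Matrix.mat_def Matrix.vec_def Determinant.det_def
hide_type (open) Matrix.mat Matrix.vec

section \<open>Triangularization and matrix powers\<close>

text \<open>Bridge from matrices over a finite type to matrices with numerical indices: transporting
  permutations along \<open>f\<close> preserves their sign, so the two Leibniz sums agree term by
  term.\<close>

lemma det_eq_det_mat:
  fixes A :: "'a::comm_ring_1 ^ 'n ^ 'n"
  assumes f: "bij_betw f {0..<n} (UNIV :: 'n set)"
  shows "det A = Determinant.det (Matrix.mat n n (\<lambda>(i, j). A $ f i $ f j))"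
proof -
  let ?S = "{0..<n}"
  let ?F = "map_permutation ?S f"
  have inj: "inj_on f ?S" and im: "f ` ?S = UNIV" using f by (auto simp: bij_betw_def)
  have bij: "bij_betw ?F {p. p permutes ?S} {p. p permutes (UNIV :: 'n set)}"
  proof (rule bij_betwI[where g = "map_permutation UNIV (inv_into ?S f)"])
    show "?F \<in> {p. p permutes ?S} \<rightarrow> {p. p permutes UNIV}"
      using map_permutation_permutes[OF f] by auto
    show "map_permutation UNIV (inv_into ?S f) \<in> {p. p permutes UNIV} \<rightarrow> {p. p permutes ?S}"
      using map_permutation_permutes[OF bij_betw_inv_into[OF f]] by auto
    show "map_permutation UNIV (inv_into ?S f) (?F p) = p" if "p \<in> {p. p permutes ?S}" for p
      using that f by (intro map_permutation_compose_inv) (auto simp: inv_into_f_f[OF inj])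
    show "?F (map_permutation UNIV (inv_into ?S f) p) = p" if "p \<in> {p. p permutes UNIV}" for p
      using that bij_betw_inv_into[OF f] by (intro map_permutation_compose_inv) (auto simp: f_inv_into_f im)
  qed
  have "det A = (\<Sum>p\<in>{p. p permutes (UNIV :: 'n set)}. of_int (sign p) * (\<Prod>i\<in>UNIV. A $ i $ p i))"
    unfolding Determinants.det_def ..
  also have "\<dots> = (\<Sum>p\<in>{p. p permutes ?S}. of_int (sign (?F p)) * (\<Prod>i\<in>UNIV. A $ i $ ?F p i))"
    by (rule sum.reindex_bij_betw[OF bij, symmetric])
  also have "\<dots> = (\<Sum>p\<in>{p. p permutes ?S}. of_int (sign p) * (\<Prod>i\<in>?S. A $ f i $ f (p i)))"
  proof (rule sum.cong[OF refl])
    fix p assume p: "p \<in> {p. p permutes ?S}"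
    have "(\<Prod>i\<in>UNIV. A $ i $ ?F p i) = (\<Prod>i\<in>?S. A $ f i $ ?F p (f i))"
      by (rule prod.reindex_bij_betw[OF f, symmetric])
    also have "\<dots> = (\<Prod>i\<in>?S. A $ f i $ f (p i))"
      by (intro prod.cong refl) (simp add: map_permutation_apply[OF inj])
    finally show "of_int (sign (?F p)) * (\<Prod>i\<in>UNIV. A $ i $ ?F p i) =
      of_int (sign p) * (\<Prod>i\<in>?S. A $ f i $ f (p i))"
      using p by (simp add: sign_map_permutation[OF inj])
  qed
  also have "\<dots> = Determinant.det (Matrix.mat n n (\<lambda>(i, j). A $ f i $ f j))"
    by (subst det_def'[of _ n]) (auto intro!: sum.cong prod.cong simp: permutes_in_image)
  finally show ?thesis .
qed

lemma det_triangular: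
  fixes U :: "'a::idom ^ 'n ^ 'n" and h :: "'n \<Rightarrow> nat"
  assumes h: "bij_betw h UNIV {1..CARD('n)}" and U: "\<And>i j. h j < h i \<Longrightarrow> U $ i $ j = 0"
  shows "det U = (\<Prod>i\<in>UNIV. U $ i $ i)"
proof -
  let ?n = "CARD('n)"
  \<comment> \<open>\<open>h\<close> counts from 1 and numerical matrices count from 0, hence the
    shift by \<open>Suc\<close>.\<close>
  define f where "f = inv_into UNIV h \<circ> Suc"
  have "bij_betw Suc {0..<?n} {1..?n}"
    by (rule bij_betwI[where g = "\<lambda>x. x - 1"]) auto
  then have f: "bij_betw f {0..<?n} UNIV"
    unfolding f_def using bij_betw_inv_into[OF h] by (rule bij_betw_trans)
  have hf: "h (f i) = Suc i" if "i < ?n" for i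
  proof -
    have "Suc i \<in> h ` UNIV" using h that by (auto simp: bij_betw_def)
    then show ?thesis unfolding f_def by (simp add: f_inv_into_f)
  qed
  let ?M = "Matrix.mat ?n ?n (\<lambda>(i, j). U $ f i $ f j)"
  have "upper_triangular ?M"
    using U hf by (auto simp: upper_triangular_def)
  then have "Determinant.det ?M = prod_list (diag_mat ?M)"
    by (rule det_upper_triangular) auto
  also have "\<dots> = (\<Prod>i\<in>{0..<?n}. U $ f i $ f i)"
    by (simp add: diag_mat_def prod.distinct_set_conv_list[symmetric] del: upt_Suc)
  also have "\<dots> = (\<Prod>i\<in>UNIV. U $ i $ i)"
    by (rule prod.reindex_bij_betw[OF f])
  finally show ?thesis by (simp add: det_eq_det_mat[OF f])
qed

text \<open>The Schur decomposition takes the eigenvalues as a list and places them on the diagonal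
  in that order, so the diagonal can be made to follow \<open>ev\<close>. The numbering
  \<open>h\<close> carries this order to the index type. Of the decomposition only similarity is
  kept, not unitarity.\<close>

lemma schur_triangularization:
  fixes A :: "complex ^ 'n ^ 'n" and ev :: "nat \<Rightarrow> complex"
  assumes cp: "charpoly A = (\<Prod>i=1..CARD('n). [:- ev i, 1:])"
  obtains P Q U :: "complex ^ 'n ^ 'n" and h :: "'n \<Rightarrow> nat"
  where "bij_betw h UNIV {1..CARD('n)}" "P ** Q = mat 1" "Q ** P = mat 1"
    "A = P ** U ** Q" "\<And>i j. h j < h i \<Longrightarrow> U $ i $ j = 0" "\<And>i. U $ i $ i = ev (h i)"
proof -
  let ?n = "CARD('n)"
  let ?S = "{0..<?n}"
  obtain f where f: "bij_betw f ?S (UNIV :: 'n set)"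
    using ex_bij_betw_nat_finite[of "UNIV :: 'n set"] by auto
  define g where "g = inv_into ?S f"
  have g: "bij_betw g UNIV ?S" unfolding g_def by (rule bij_betw_inv_into[OF f])
  have gf: "g (f i) = i" if "i < ?n" for i
    using f that unfolding g_def bij_betw_def by (simp add: inv_into_f_f)
  have fg: "f (g x) = x" for x
    using f unfolding g_def bij_betw_def by (simp add: f_inv_into_f)
  have gn: "g x < ?n" for x using g by (auto simp: bij_betw_def)
  let ?h = "\<lambda>B :: complex ^ 'n ^ 'n. Matrix.mat ?n ?n (\<lambda>(i, j). B $ f i $ f j)"
  \<comment> \<open>Translation back to the finite type, inverse to \<open>?h\<close> because
    \<open>g\<close> inverts \<open>f\<close>; being multiplicative, it carries over the whole
    factorization.\<close>
  define bk where "bk M = (\<chi> i j. M $$ (g i, g j))" for M :: "complex Matrix.mat"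
  have bk_mult: "bk (M * N) = bk M ** bk N"
    if "M \<in> carrier_mat ?n ?n" "N \<in> carrier_mat ?n ?n" for M N
  proof -
    have "(M * N) $$ (g i, g j) = (\<Sum>k\<in>UNIV. M $$ (g i, g k) * N $$ (g k, g j))" for i j
    proof -
      have "(M * N) $$ (g i, g j) = (\<Sum>k\<in>?S. M $$ (g i, k) * N $$ (k, g j))"
        using that gn[of i] gn[of j] by (auto simp: scalar_prod_def)
      also have "\<dots> = (\<Sum>k\<in>UNIV. M $$ (g i, g k) * N $$ (g k, g j))"
        by (rule sum.reindex_bij_betw[OF g, symmetric])
      finally show ?thesis .
    qed
    then show ?thesis unfolding bk_def matrix_matrix_mult_def by (simp add: vec_eq_iff)
  qed
  have bk_one: "bk (1\<^sub>m ?n) = mat 1"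
  proof -
    have "g i = g j \<longleftrightarrow> i = j" for i j using g by (auto simp: bij_betw_def inj_on_def)
    then show ?thesis using gn unfolding vec_eq_iff by (simp add: bk_def Finite_Cartesian_Product.mat_def)
  qed
  have bk_h: "bk (?h A) = A"
    using gn by (simp add: bk_def vec_eq_iff fg)
  have "char_poly (?h A) = charpoly A"
    unfolding char_poly_defs charpoly_def
    by (subst det_eq_det_mat[OF f], rule arg_cong[where f = Determinant.det])
      (use f in \<open>auto simp: mat_eq_iff map_matrix_def Finite_Cartesian_Product.mat_def bij_betw_def inj_on_def\<close>)
  also have "\<dots> = (\<Prod>i\<in>{1..?n}. [:- ev i, 1:])" by (rule cp)
  also have "\<dots> = (\<Prod>i\<leftarrow>[1..<Suc ?n]. [:- ev i, 1:])"
    by (subst prod.distinct_set_conv_list[symmetric]) (auto simp del: upt_Suc simp: atLeastLessThanSuc_atLeastAtMost)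
  also have "\<dots> = (\<Prod>e\<leftarrow>map ev [1..<Suc ?n]. [:- e, 1:])" by (simp add: o_def del: upt_Suc)
  finally have c: "char_poly (?h A) = (\<Prod>e\<leftarrow>map ev [1..<Suc ?n]. [:- e, 1:])" .
  obtain B P Q where dec: "schur_decomposition (?h A) (map ev [1..<Suc ?n]) = (B, P, Q)"
    by (cases "schur_decomposition (?h A) (map ev [1..<Suc ?n])") auto
  have "?h A \<in> carrier_mat ?n ?n" by simp
  from schur_decomposition[OF this c dec] have
    w: "similar_mat_wit (?h A) B P Q" and ut: "upper_triangular B" and dg: "diag_mat B = map ev [1..<Suc ?n]"
    by auto
  from w have car: "B \<in> carrier_mat ?n ?n" "P \<in> carrier_mat ?n ?n" "Q \<in> carrier_mat ?n ?n"
    and PQ: "P * Q = 1\<^sub>m ?n" "Q * P = 1\<^sub>m ?n" "?h A = P * B * Q"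
    unfolding similar_mat_wit_def by (auto simp: Let_def)
  show thesis
  proof (rule that[of "\<lambda>x. Suc (g x)" "bk P" "bk Q" "bk B"])
    have "bij_betw Suc ?S {1..?n}" by (rule bij_betwI[where g = "\<lambda>x. x - 1"]) auto
    from bij_betw_trans[OF g this] show "bij_betw (\<lambda>x. Suc (g x)) UNIV {1..?n}" by (simp add: o_def)
    show "bk P ** bk Q = mat 1" "bk Q ** bk P = mat 1"
      using PQ car by (simp_all add: bk_mult[symmetric] bk_one)
    have "A = bk (P * B * Q)" using PQ(3) bk_h by metis
    also have "\<dots> = bk P ** bk B ** bk Q"
      using car by (simp add: bk_mult[OF mult_carrier_mat[OF car(2,1)] car(3)] bk_mult matrix_mul_assoc)
    finally show "A = bk P ** bk B ** bk Q" .
    show "bk B $ i $ j = 0" if "Suc (g j) < Suc (g i)" for i j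
      using ut car gn[of i] that by (auto simp: bk_def upper_triangular_def)
    show "bk B $ i $ i = ev (Suc (g i))" for i
    proof -
      have "diag_mat B ! g i = B $$ (g i, g i)" using car gn[of i] by (simp add: diag_mat_def)
      then show ?thesis using gn[of i] unfolding dg bk_def by (simp del: upt_Suc)
    qed
  qed
qed

section \<open>Growth of powers of a triangular matrix, and inversion of the power minus the
  identity\<close>

primrec matpow :: "'a::semiring_1 ^ 'n ^ 'n \<Rightarrow> nat \<Rightarrow> 'a ^ 'n ^ 'n" where
  "matpow A 0 = mat 1"
| "matpow A (Suc n) = A ** matpow A n"

lemma matpow_triangular:
  fixes U :: "'a::comm_ring_1 ^ 'n ^ 'n" and h :: "'n \<Rightarrow> nat"
  assumes inj: "inj h" and U: "\<And>i j. h j < h i \<Longrightarrow> U $ i $ j = 0"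
  shows "h j < h i \<Longrightarrow> matpow U n $ i $ j = 0" and "matpow U n $ i $ i = U $ i $ i ^ n"
proof -
  have lower: "matpow U n $ i $ j = 0" if "h j < h i" for i j n
    using that
  proof (induction n arbitrary: i j)
    case (Suc n)
    have "U $ i $ k * matpow U n $ k $ j = 0" for k
      using U[of k i] Suc.IH[of j k] Suc.prems by (cases "h k < h i") auto
    then show ?case by (simp add: matrix_matrix_mult_def)
  qed (auto simp: Finite_Cartesian_Product.mat_def)
  then show "h j < h i \<Longrightarrow> matpow U n $ i $ j = 0" .
  show "matpow U n $ i $ i = U $ i $ i ^ n"
  proof (induction n)
    case (Suc n)
    have "(\<Sum>k\<in>UNIV. U $ i $ k * matpow U n $ k $ i) = (\<Sum>k\<in>{i}. U $ i $ k * matpow U n $ k $ i)"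
    proof (rule sum.mono_neutral_right)
      show "\<forall>k\<in>UNIV - {i}. U $ i $ k * matpow U n $ k $ i = 0"
      proof
        fix k assume "k \<in> UNIV - {i}"
        then have "h k \<noteq> h i" using inj by (auto dest: injD)
        then show "U $ i $ k * matpow U n $ k $ i = 0"
          using U[of k i] lower[of i k] by (cases "h k < h i") auto
      qed
    qed auto
    then show ?case using Suc by (simp add: matrix_matrix_mult_def)
  qed (simp add: Finite_Cartesian_Product.mat_def)
qed

text \<open>Column \<open>k\<close> of a power is supported on the indices up to \<open>h k\<close>,
  where no diagonal entry exceeds that of \<open>k\<close> in modulus. So the column grows at the
  rate of its own diagonal entry rather than of the largest one; \<open>e\<close> pays for the
  off-diagonal part.\<close>

lemma matpow_triangular_bound:
  fixes U :: "complex ^ 'n ^ 'n" and h :: "'n \<Rightarrow> nat"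
  assumes inj: "inj h" and U: "\<And>i j. h j < h i \<Longrightarrow> U $ i $ j = 0"
    and mono: "\<And>i j. h i \<le> h j \<Longrightarrow> cmod (U $ i $ i) \<le> cmod (U $ j $ j)"
    and e: "e > 0"
  shows "\<exists>C>0. \<forall>n i k. cmod (matpow U n $ i $ k) \<le> C * (cmod (U $ k $ k) + e) ^ n"
proof -
  define B where "B = (\<Sum>i\<in>UNIV. \<Sum>m\<in>UNIV. cmod (U $ i $ m)) + 1"
  have B: "(\<Sum>m\<in>UNIV. cmod (U $ i $ m)) \<le> B" for i
    unfolding B_def
    using member_le_sum[of i UNIV "\<lambda>i. \<Sum>m\<in>UNIV. cmod (U $ i $ m)"] by (simp add: sum_nonneg add_increasing2)
  have Bpos: "B > 0" unfolding B_def by (simp add: sum_nonneg add_nonneg_pos)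
  define \<delta> where "\<delta> = min 1 (e / B)"
  have \<delta>: "0 < \<delta>" "\<delta> \<le> 1" "\<delta> * B \<le> e"
    using e Bpos unfolding \<delta>_def by (auto simp: min_def field_simps)
  \<comment> \<open>In the weighted supremum norm with weights \<open>\<delta>\<^sup>-\<^sup>h\<^sup>(\<^sup>i\<^sup>)\<close> the off-diagonal part of \<open>U\<close> has norm at most \<open>e\<close>.\<close>
  have main: "cmod (matpow U n $ i $ k) \<le> \<delta> ^ h i * ((cmod (U $ k $ k) + e) ^ n / \<delta> ^ h k)" for n i k
  proof (induction n arbitrary: i)
    case 0
    then show ?case using \<delta> by (auto simp: Finite_Cartesian_Product.mat_def)
  next
    case (Suc n)
    define W where "W = (cmod (U $ k $ k) + e) ^ n / \<delta> ^ h k"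
    have W: "W \<ge> 0" unfolding W_def using \<delta> e by simp
    show ?case
    proof (cases "h k < h i")
      case True
      then show ?thesis using matpow_triangular(1)[OF inj U True, of "Suc n"] \<delta> e by simp
    next
      case False
      have "cmod (matpow U (Suc n) $ i $ k) \<le> (\<Sum>m\<in>UNIV. cmod (U $ i $ m) * cmod (matpow U n $ m $ k))"
        by (simp add: matrix_matrix_mult_def) (rule sum_norm_le, simp add: norm_mult)
      also have "\<dots> \<le> (\<Sum>m\<in>UNIV. \<delta> ^ h i * W * ((if m = i then cmod (U $ i $ i) else 0) + \<delta> * cmod (U $ i $ m)))"
      proof (rule sum_mono)
        fix m
        have "cmod (U $ i $ m) * cmod (matpow U n $ m $ k) \<le> cmod (U $ i $ m) * (\<delta> ^ h m * W)"
          using Suc.IH[of m] unfolding W_def by (intro mult_left_mono) auto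
        also have "\<dots> \<le> \<delta> ^ h i * W * ((if m = i then cmod (U $ i $ i) else 0) + \<delta> * cmod (U $ i $ m))"
        proof (cases "m = i")
          case True
          then show ?thesis using \<delta> W by (simp add: algebra_simps)
        next
          case False
          show ?thesis
          proof (cases "h m < h i")
            case True
            then show ?thesis using U[OF True] False by simp
          next
            case nl: False
            have "h m \<noteq> h i" using False inj by (auto dest: injD)
            with nl have "Suc (h i) \<le> h m" by simp
            then have "\<delta> ^ h m \<le> \<delta> ^ Suc (h i)" using \<delta> by (intro power_decreasing) auto
            then have "(cmod (U $ i $ m) * W) * \<delta> ^ h m \<le> (cmod (U $ i $ m) * W) * \<delta> ^ Suc (h i)"
              using W by (intro mult_left_mono) auto
            then show ?thesis using False by (simp add: algebra_simps)
          qed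
        qed
        finally show "cmod (U $ i $ m) * cmod (matpow U n $ m $ k)
          \<le> \<delta> ^ h i * W * ((if m = i then cmod (U $ i $ i) else 0) + \<delta> * cmod (U $ i $ m))" .
      qed
      also have "\<dots> = \<delta> ^ h i * W * (cmod (U $ i $ i) + \<delta> * (\<Sum>m\<in>UNIV. cmod (U $ i $ m)))"
        by (simp add: sum_distrib_left[symmetric] sum.distrib)
      also have "\<dots> \<le> \<delta> ^ h i * W * (cmod (U $ k $ k) + e)"
      proof (rule mult_left_mono)
        have "\<delta> * (\<Sum>m\<in>UNIV. cmod (U $ i $ m)) \<le> \<delta> * B" using B \<delta> by (intro mult_left_mono) auto
        then show "cmod (U $ i $ i) + \<delta> * (\<Sum>m\<in>UNIV. cmod (U $ i $ m)) \<le> cmod (U $ k $ k) + e"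
          using \<delta>(3) mono[of i k] False by simp
      qed (use \<delta> W in auto)
      finally show ?thesis unfolding W_def by (simp add: algebra_simps)
    qed
  qed
  define C where "C = (\<Sum>k\<in>UNIV. 1 / \<delta> ^ h k)"
  have C: "1 / \<delta> ^ h k \<le> C" for k
    unfolding C_def using \<delta> by (intro member_le_sum) auto
  show ?thesis
  proof (intro exI[of _ C] conjI allI)
    show "C > 0" using \<delta> C[of undefined] by (meson less_le_trans zero_less_divide_1_iff zero_less_power)
    fix n i k
    have "cmod (matpow U n $ i $ k) \<le> \<delta> ^ h i * ((cmod (U $ k $ k) + e) ^ n / \<delta> ^ h k)" by (rule main)
    also have "\<dots> \<le> 1 * ((cmod (U $ k $ k) + e) ^ n / \<delta> ^ h k)"
      using \<delta> e by (intro mult_right_mono power_le_one) auto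
    also have "\<dots> = (1 / \<delta> ^ h k) * (cmod (U $ k $ k) + e) ^ n" by simp
    also have "\<dots> \<le> C * (cmod (U $ k $ k) + e) ^ n"
      using C e by (intro mult_right_mono) auto
    finally show "cmod (matpow U n $ i $ k) \<le> C * (cmod (U $ k $ k) + e) ^ n" .
  qed
qed

text \<open>Back substitution from the last index: in row \<open>i\<close> the entry of the power in
  column \<open>k\<close> grows at rate \<open>l k\<close>, while the component \<open>y $ k\<close>
  already bounded decays at the same rate, so the two cancel. What remains is division by the
  diagonal entry. Every row costs a factor \<open>exp (n * e0)\<close>, and with at most
  \<open>D + 1\<close> rounds the total loss is \<open>e\<close>.\<close>

lemma triangular_inverse_bound:
  fixes U :: "complex ^ 'n ^ 'n" and h :: "'n \<Rightarrow> nat"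
  assumes inj: "inj h" and hd: "\<And>i. h i \<le> D" and U: "\<And>i j. h j < h i \<Longrightarrow> U $ i $ j = 0"
    and mono: "\<And>i j. h i \<le> h j \<Longrightarrow> cmod (U $ i $ i) \<le> cmod (U $ j $ j)"
    and expanding: "\<And>i. 1 < cmod (U $ i $ i)" and e: "e > 0"
  shows "\<exists>C>0. \<forall>n\<ge>1. \<forall>y i. cmod (y $ i) \<le>
    C * exp (real n * (e - ln (cmod (U $ i $ i)))) * norm ((matpow U n - mat 1) *v y)"
proof -
  define l where "l i = ln (cmod (U $ i $ i))" for i
  have lam: "cmod (U $ i $ i) = exp (l i)" for i
    unfolding l_def by (subst exp_ln) (use expanding[of i] in linarith, rule refl)
  have lam_n: "cmod (U $ i $ i) ^ n = exp (n * l i)" for i n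
    by (simp add: lam exp_of_nat_mult)
  define e0 where "e0 = e / real (Suc D)"
  have e0: "e0 > 0" using e by (simp add: e0_def)
  \<comment> \<open>The additive error \<open>exp e0 - 1\<close> becomes the factor
    \<open>exp e0\<close>, since every diagonal entry exceeds 1 in modulus.\<close>
  have "exp e0 - 1 > 0" using e0 by simp
  from matpow_triangular_bound[OF inj U mono this] obtain C0 where C0: "C0 > 0"
    and C0b: "\<And>n i k. cmod (matpow U n $ i $ k) \<le> C0 * (cmod (U $ k $ k) + (exp e0 - 1)) ^ n"
    by blast
  have pw: "cmod (matpow U n $ i $ k) \<le> C0 * exp (n * (l k + e0))" for n i k
  proof -
    have "cmod (U $ k $ k) + (exp e0 - 1) \<le> cmod (U $ k $ k) + cmod (U $ k $ k) * (exp e0 - 1)"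
      using expanding[of k] e0 mult_right_mono[of 1 "cmod (U $ k $ k)" "exp e0 - 1"] by simp
    also have "\<dots> = exp (l k + e0)" by (simp add: lam exp_add algebra_simps)
    finally have "(cmod (U $ k $ k) + (exp e0 - 1)) ^ n \<le> exp (l k + e0) ^ n"
      using e0 by (intro power_mono add_nonneg_nonneg) auto
    also have "\<dots> = exp (n * (l k + e0))" by (simp add: exp_of_nat_mult)
    finally show ?thesis using C0b[of n i k] C0 by (meson mult_left_mono order.trans less_imp_le)
  qed
  \<comment> \<open>For \<open>x > 1\<close> and \<open>n \<ge> 1\<close> one has
    \<open>x ^ n - 1 \<ge> (1 - 1 / x) * x ^ n\<close>; thus \<open>\<eta>\<close> controls all
    diagonal entries of the power minus the identity, uniformly in \<open>n\<close>.\<close>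
  define \<eta> where "\<eta> = Min (range (\<lambda>i. 1 - 1 / cmod (U $ i $ i)))"
  have \<eta>0: "\<eta> > 0" unfolding \<eta>_def using expanding by (simp add: divide_less_eq)
  have \<eta>le: "\<eta> \<le> 1 - 1 / cmod (U $ i $ i)" for i unfolding \<eta>_def by (rule Min_le) auto
  have diag: "\<eta> * exp (n * l i) \<le> cmod (U $ i $ i ^ n - 1)" if "n \<ge> 1" for n i
  proof -
    let ?x = "cmod (U $ i $ i)"
    have x: "?x > 1" by (rule expanding)
    have "?x ^ n \<ge> ?x ^ 1" using x that by (intro power_increasing) auto
    moreover have "0 < ?x" using x by linarith
    ultimately have "1 \<le> ?x ^ n / ?x" by (subst pos_le_divide_eq) simp_all
    have "\<eta> * exp (n * l i) \<le> (1 - 1 / ?x) * ?x ^ n"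
      unfolding lam_n[symmetric] using \<eta>le by (intro mult_right_mono) auto
    also have "\<dots> = ?x ^ n - ?x ^ n / ?x" by (simp add: algebra_simps)
    also have "\<dots> \<le> ?x ^ n - 1" using \<open>1 \<le> ?x ^ n / ?x\<close> by simp
    also have "\<dots> \<le> cmod (U $ i $ i ^ n - 1)"
      using norm_triangle_ineq2[of "U $ i $ i ^ n" 1] by (simp add: norm_power)
    finally show ?thesis .
  qed
  \<comment> \<open>\<open>q\<close> is the number of rows solved so far, counted from the last
    index; \<open>q = 0\<close> is vacuous and \<open>q = Suc D\<close> covers all rows.\<close>
  have ind: "\<exists>C>0. \<forall>n\<ge>1. \<forall>y i. D - h i < q \<longrightarrow> cmod (y $ i) \<le>
    C * exp (real n * (q * e0 - l i)) * norm ((matpow U n - mat 1) *v y)" for q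
  proof (induction q)
    case 0
    show ?case by (rule exI[of _ 1]) auto
  next
    case (Suc q)
    then obtain C where C: "C > 0" and IH: "\<And>n y i. n \<ge> 1 \<Longrightarrow> D - h i < q \<Longrightarrow> cmod (y $ i) \<le>
      C * exp (real n * (q * e0 - l i)) * norm ((matpow U n - mat 1) *v y)" by blast
    define C' where "C' = (1 + CARD('n) * (C0 * C)) / \<eta>"
    have C'0: "C' > 0" unfolding C'_def using C C0 \<eta>0 by (simp add: add_pos_nonneg)
    have "cmod (y $ i) \<le> C' * exp (real n * (Suc q * e0 - l i)) * norm ((matpow U n - mat 1) *v y)"
      if n: "n \<ge> 1" and i: "D - h i < Suc q" for n i and y :: "complex ^ 'n"
    proof -
      define b where "b = (matpow U n - mat 1) *v y"
      let ?E = "exp (real n * (Suc q * e0))"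
      have E1: "?E \<ge> 1" using e0 by simp
      have eq: "(U $ i $ i ^ n - 1) * y $ i = b $ i - (\<Sum>k\<in>UNIV - {i}. matpow U n $ i $ k * y $ k)"
      proof -
        have "b $ i = (\<Sum>k\<in>UNIV. matpow U n $ i $ k * y $ k) - y $ i"
          unfolding b_def by (simp add: matrix_vector_mult_diff_rdistrib) (simp add: matrix_vector_mult_def)
        also have "(\<Sum>k\<in>UNIV. matpow U n $ i $ k * y $ k) =
          matpow U n $ i $ i * y $ i + (\<Sum>k\<in>UNIV - {i}. matpow U n $ i $ k * y $ k)"
          by (rule sum.remove) auto
        finally show ?thesis using matpow_triangular(2)[OF inj U] by (simp add: algebra_simps)
      qed
      have termb: "cmod (matpow U n $ i $ k * y $ k) \<le> C0 * C * ?E * norm b" if k: "k \<in> UNIV - {i}" for k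
      proof (cases "h k < h i")
        case True
        then show ?thesis using matpow_triangular(1)[OF inj U True] C C0 by simp
      next
        case False
        moreover have "h k \<noteq> h i" using k inj by (auto dest: injD)
        ultimately have "D - h k < q" using i hd[of k] by linarith
        from IH[OF n this, of y] have yk: "cmod (y $ k) \<le> C * exp (real n * (q * e0 - l k)) * norm b"
          unfolding b_def .
        have "cmod (matpow U n $ i $ k * y $ k) = cmod (matpow U n $ i $ k) * cmod (y $ k)" by (rule norm_mult)
        also have "\<dots> \<le> (C0 * exp (n * (l k + e0))) * (C * exp (real n * (q * e0 - l k)) * norm b)"
          using pw yk C0 by (intro mult_mono) auto
        also have "\<dots> = C0 * C * (exp (n * (l k + e0)) * exp (real n * (q * e0 - l k))) * norm b"
          by simp
        also have "exp (n * (l k + e0)) * exp (real n * (q * e0 - l k)) = ?E"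
          by (subst exp_add[symmetric]) (simp add: algebra_simps)
        finally show ?thesis .
      qed
      have "\<eta> * exp (n * l i) * cmod (y $ i) \<le> cmod (U $ i $ i ^ n - 1) * cmod (y $ i)"
        using diag[OF n] by (intro mult_right_mono) auto
      also have "\<dots> = cmod (b $ i - (\<Sum>k\<in>UNIV - {i}. matpow U n $ i $ k * y $ k))"
        by (simp only: eq[symmetric] norm_mult)
      also have "\<dots> \<le> cmod (b $ i) + (\<Sum>k\<in>UNIV - {i}. cmod (matpow U n $ i $ k * y $ k))"
        by (rule order_trans[OF norm_triangle_ineq4]) (intro add_left_mono norm_sum)
      also have "\<dots> \<le> norm b + (\<Sum>k\<in>UNIV - {i}. C0 * C * ?E * norm b)"
        using termb Finite_Cartesian_Product.norm_nth_le[of b i] by (intro add_mono sum_mono) auto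
      also have "\<dots> \<le> norm b * ?E + CARD('n) * (C0 * C * ?E * norm b)"
      proof (rule add_mono)
        show "norm b \<le> norm b * ?E" using E1 by (simp add: mult_left_mono[of 1 ?E "norm b", simplified])
        have "real (card (UNIV - {i})) \<le> CARD('n)" by (simp add: card_mono)
        then show "(\<Sum>k\<in>UNIV - {i}. C0 * C * ?E * norm b) \<le> CARD('n) * (C0 * C * ?E * norm b)"
          unfolding sum_constant using C C0 by (intro mult_right_mono) auto
      qed
      also have "\<dots> = \<eta> * C' * ?E * norm b"
        unfolding C'_def using \<eta>0 by (simp add: field_simps)
      finally have "\<eta> * (exp (n * l i) * cmod (y $ i)) \<le> \<eta> * (C' * ?E * norm b)" by (simp only: mult.assoc)
      then have "exp (n * l i) * cmod (y $ i) \<le> C' * ?E * norm b" using \<eta>0 by simp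
      then have "exp (- (n * l i)) * (exp (n * l i) * cmod (y $ i)) \<le> exp (- (n * l i)) * (C' * ?E * norm b)"
        by (intro mult_left_mono) auto
      also have "exp (- (n * l i)) * (exp (n * l i) * cmod (y $ i)) = cmod (y $ i)"
        by (simp add: mult.assoc[symmetric] exp_add[symmetric])
      also have "exp (- (n * l i)) * (C' * ?E * norm b) = C' * (?E * exp (- (n * l i))) * norm b" by simp
      also have "?E * exp (- (n * l i)) = exp (real n * (Suc q * e0 - l i))"
        by (subst exp_add[symmetric]) (simp add: algebra_simps)
      finally show ?thesis unfolding b_def .
    qed
    then show ?case using C'0 by blast
  qed
  have "Suc D * e0 = e" by (simp add: e0_def)
  moreover have "D - h i < Suc D" for i by simp
  ultimately show ?thesis using ind[of "Suc D"] unfolding l_def by metis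
qed

section \<open>From the complex triangular form to real coordinates\<close>

lemma matpow_commute_diff:
  fixes A :: "'a::comm_ring_1 ^ 'n ^ 'n"
  assumes QA: "Q ** A = U ** Q"
  shows "Q ** (matpow A n - mat 1) = (matpow U n - mat 1) ** Q"
proof -
  have "Q ** matpow A n = matpow U n ** Q"
  proof (induction n)
    case (Suc n)
    have "Q ** matpow A (Suc n) = (Q ** A) ** matpow A n" by (simp add: matrix_mul_assoc)
    also have "\<dots> = U ** (Q ** matpow A n)" by (simp add: QA matrix_mul_assoc)
    also have "\<dots> = matpow U (Suc n) ** Q" by (simp add: Suc matrix_mul_assoc)
    finally show ?case .
  qed simp
  moreover have "Q ** (matpow A n - mat 1) = Q ** matpow A n - Q"
    by (simp add: matrix_matrix_mult_def vec_eq_iff Finite_Cartesian_Product.mat_def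
        right_diff_distrib sum_subtractf if_distrib[of "\<lambda>x. _ * x"] cong: if_cong)
  moreover have "(matpow U n - mat 1) ** Q = matpow U n ** Q - Q"
    by (simp add: matrix_matrix_mult_def vec_eq_iff Finite_Cartesian_Product.mat_def
        left_diff_distrib sum_subtractf if_distrib[of "\<lambda>x. x * _"] cong: if_cong)
  ultimately show ?thesis by simp
qed

lemma map_matrix_of_real_mult:
  fixes A B :: "real ^ 'n ^ 'n"
  shows "map_matrix complex_of_real (A ** B) = map_matrix of_real A ** map_matrix of_real B"
  by (simp add: map_matrix_def matrix_matrix_mult_def vec_eq_iff)

lemma map_matrix_of_real_matpow_diff:
  fixes A :: "real ^ 'n ^ 'n"
  shows "map_matrix complex_of_real (matpow A n - mat 1) = matpow (map_matrix of_real A) n - mat 1"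
proof -
  have "map_matrix complex_of_real (matpow A n) = matpow (map_matrix of_real A) n"
  proof (induction n)
    case 0
    show ?case by (simp add: map_matrix_def Finite_Cartesian_Product.mat_def vec_eq_iff)
  qed (simp add: map_matrix_of_real_mult)
  then show ?thesis by (simp add: map_matrix_def Finite_Cartesian_Product.mat_def vec_eq_iff)
qed

lemma det_map_matrix_of_real:
  fixes A :: "real ^ 'n ^ 'n"
  shows "det (map_matrix complex_of_real A) = of_real (det A)"
  by (simp add: Determinants.det_def map_matrix_def)

text \<open>Expanding the determinant along \<open>q = Re q + \<i> Im q\<close> in every row, some choice of real and
  imaginary parts contributes a nonzero term.\<close>

lemma det_re_or_im_rows:
  fixes Q :: "complex ^ 'n ^ 'n"
  assumes "det Q \<noteq> 0"
  obtains F :: "'n \<Rightarrow> complex \<Rightarrow> real"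
  where "\<And>i. F i = Re \<or> F i = Im" "det ((\<chi> i j. F i (Q $ i $ j)) :: real ^ 'n ^ 'n) \<noteq> 0"
proof -
  define part where "part b = (if b then Re else Im)" for b
  define r where "r b i = (\<chi> j. complex_of_real (part b (Q $ i $ j)))" for b i
  have Q: "Q $ i = r True i + \<i> *s r False i" for i
    by (simp add: vec_eq_iff r_def part_def complex_eq_iff)
  have "\<exists>p. det (\<chi> i. if i \<in> T then r (p i) i else Q $ i) \<noteq> 0" for T
  proof (induction T rule: finite_induct[OF finite])
    case 1
    then show ?case using assms by simp
  next
    case (2 z T)
    then obtain p where p: "det (\<chi> i. if i \<in> T then r (p i) i else Q $ i) \<noteq> 0" by blast
    let ?c = "\<lambda>i. if i \<in> T then r (p i) i else Q $ i"
    have "(\<chi> i. ?c i) = (\<chi> i. if i = z then r True i + \<i> *s r False i else ?c i)"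
      using 2 Q by (simp add: vec_eq_iff)
    then have "det (\<chi> i. ?c i) = det (\<chi> i. if i = z then r True i else ?c i)
        + \<i> * det (\<chi> i. if i = z then r False i else ?c i)"
      by (simp add: Determinants.det_row_add[of z "r True" "\<lambda>i. \<i> *s r False i"] Determinants.det_row_mul[of z "\<i>" "r False"])
    then obtain b where b: "det (\<chi> i. if i = z then r b i else ?c i) \<noteq> 0" using p by fastforce
    have "(\<chi> i. if i = z then r b i else ?c i) = (\<chi> i. if i \<in> insert z T then r ((p(z := b)) i) i else Q $ i)"
      using 2 by (auto simp: vec_eq_iff)
    then show ?case using b by metis
  qed
  from this[of UNIV] obtain p where p: "det (\<chi> i. r (p i) i) \<noteq> 0" by auto
  have "(\<chi> i. r (p i) i) = map_matrix complex_of_real (\<chi> i j. part (p i) (Q $ i $ j))"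
    by (simp add: r_def map_matrix_def)
  then have "det ((\<chi> i j. part (p i) (Q $ i $ j)) :: real ^ 'n ^ 'n) \<noteq> 0"
    using p by (auto simp: det_map_matrix_of_real)
  then show thesis by (intro that[of "\<lambda>i. part (p i)"]) (auto simp: part_def)
qed

text \<open>Row \<open>i\<close> of \<open>G\<close> is the real or the imaginary part of row
  \<open>i\<close> of \<open>Q\<close>. On real vectors its value is the corresponding part of
  \<open>(Q *v x) $ i\<close>, so the bounds for the complex coordinates pass to \<open>G\<close>;
  the parts are chosen to keep \<open>G\<close> invertible. \<open>G\<close> need not triangularize
  \<open>A\<close>, as only upper bounds for the coordinates are claimed.\<close>

lemma expanding_matrix_estimates:
  fixes A :: "real ^ 'n ^ 'n" and ev :: "nat \<Rightarrow> complex"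
  assumes cp: "charpoly (map_matrix of_real A) = (\<Prod>i=1..CARD('n). [:- ev i, 1:])"
    and expanding: "1 < cmod (ev 1)" and ordered: "mono_on {1..CARD('n)} (\<lambda>i. cmod (ev i))"
  obtains G :: "real ^ 'n ^ 'n" and h :: "'n \<Rightarrow> nat"
  where "bij_betw h UNIV {1..CARD('n)}" "det G \<noteq> 0"
    "\<And>e. e > 0 \<Longrightarrow> \<exists>C>0. \<forall>n\<ge>1. \<forall>x i. \<bar>(G *v x) $ i\<bar> \<le>
       C * exp (real n * (e - ln (cmod (ev (h i))))) * norm ((matpow A n - mat 1) *v x)"
    "\<And>n. \<bar>det (matpow A n - mat 1)\<bar> \<le> 2 ^ CARD('n) * exp (real n * (\<Sum>i\<in>UNIV. ln (cmod (ev (h i)))))"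
proof -
  obtain P Q U :: "complex ^ 'n ^ 'n" and h :: "'n \<Rightarrow> nat"
    where h: "bij_betw h UNIV {1..CARD('n)}" and PQ: "P ** Q = mat 1" "Q ** P = mat 1"
      and A: "map_matrix of_real A = P ** U ** Q"
      and U: "\<And>i j. h j < h i \<Longrightarrow> U $ i $ j = 0" "\<And>i. U $ i $ i = ev (h i)"
    by (rule schur_triangularization[OF cp]) blast
  have inj: "inj h" and hd: "h i \<in> {1..CARD('n)}" for i using h by (auto simp: bij_betw_def)
  have mono: "cmod (U $ i $ i) \<le> cmod (U $ j $ j)" if "h i \<le> h j" for i j
    unfolding U(2) using that hd by (intro mono_onD[OF ordered]) auto
  have ev1: "1 < cmod (ev (h i))" for i
  proof -
    have "cmod (ev 1) \<le> cmod (ev (h i))"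
      using hd[of i] by (intro mono_onD[OF ordered]) auto
    then show ?thesis using expanding by linarith
  qed
  have QA: "Q ** map_matrix of_real A = U ** Q"
    unfolding A by (simp add: matrix_mul_assoc PQ)
  have "det Q \<noteq> 0"
    using arg_cong[OF PQ(1), of det] by (auto simp: det_mul)
  then obtain F :: "'n \<Rightarrow> complex \<Rightarrow> real" where F: "\<And>i. F i = Re \<or> F i = Im"
    and detF: "det ((\<chi> i j. F i (Q $ i $ j)) :: real ^ 'n ^ 'n) \<noteq> 0"
    by (rule det_re_or_im_rows) blast
  define G :: "real ^ 'n ^ 'n" where "G = (\<chi> i j. F i (Q $ i $ j))"
  define cv where "cv x = (\<chi> i. complex_of_real (x $ i))" for x :: "real ^ 'n"
  have Gx: "\<bar>(G *v x) $ i\<bar> \<le> cmod ((Q *v cv x) $ i)" for x i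
  proof -
    have "(G *v x) $ i = F i ((Q *v cv x) $ i)"
      using F[of i] by (auto simp: G_def cv_def matrix_vector_mult_def)
    then show ?thesis using F[of i] abs_Re_le_cmod abs_Im_le_cmod by metis
  qed
  have ncv: "norm (cv x) = norm x" for x
    by (simp add: cv_def norm_vec_def)
  have mcv: "map_matrix complex_of_real M *v cv x = cv (M *v x)" for M :: "real ^ 'n ^ 'n" and x
    by (simp add: cv_def map_matrix_def matrix_vector_mult_def vec_eq_iff)
  obtain K where K: "K > 0" "\<And>z. norm (Q *v z) \<le> norm z * K"
    using bounded_linear.pos_bounded[OF matrix_vector_mul_bounded_linear[of Q]] by blast
  show thesis
  proof (rule that[OF h, of G])
    show "det G \<noteq> 0" using detF unfolding G_def .
    fix e :: real assume "e > 0"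
    have "\<exists>C>0. \<forall>n\<ge>1. \<forall>y i. cmod (y $ i) \<le>
      C * exp (real n * (e - ln (cmod (U $ i $ i)))) * norm ((matpow U n - mat 1) *v y)"
      by (rule triangular_inverse_bound[OF inj _ U(1) mono _ \<open>e > 0\<close>, where D = "CARD('n)"])
        (use hd ev1 in \<open>auto simp: U(2)\<close>)
    then obtain C where C: "C > 0" and Cb: "\<And>n y i. n \<ge> 1 \<Longrightarrow> cmod (y $ i) \<le>
      C * exp (real n * (e - ln (cmod (ev (h i))))) * norm ((matpow U n - mat 1) *v y)"
      unfolding U(2) by blast
    have "\<bar>(G *v x) $ i\<bar> \<le> (C * K) * exp (real n * (e - ln (cmod (ev (h i))))) * norm ((matpow A n - mat 1) *v x)"
      if n: "n \<ge> 1" for n x i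
    proof -
      let ?E = "exp (real n * (e - ln (cmod (ev (h i)))))"
      have "(matpow U n - mat 1) *v (Q *v cv x) = Q *v cv ((matpow A n - mat 1) *v x)"
        by (simp add: matrix_vector_mul_assoc matpow_commute_diff[OF QA, symmetric]
            map_matrix_of_real_matpow_diff[symmetric] mcv[symmetric])
      then have "norm ((matpow U n - mat 1) *v (Q *v cv x)) \<le> norm ((matpow A n - mat 1) *v x) * K"
        using K(2)[of "cv ((matpow A n - mat 1) *v x)"] by (simp add: ncv)
      then have "C * ?E * norm ((matpow U n - mat 1) *v (Q *v cv x))
          \<le> C * ?E * (norm ((matpow A n - mat 1) *v x) * K)"
        using C by (intro mult_left_mono) auto
      then show ?thesis using Cb[OF n, of "Q *v cv x" i] Gx[of x i] by (simp add: algebra_simps)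
    qed
    then show "\<exists>C>0. \<forall>n\<ge>1. \<forall>x i. \<bar>(G *v x) $ i\<bar> \<le>
       C * exp (real n * (e - ln (cmod (ev (h i))))) * norm ((matpow A n - mat 1) *v x)"
      using mult_pos_pos[OF C K(1)] by blast
  next
    fix n
    let ?M = "matpow A n - mat 1" and ?N = "matpow U n - mat 1"
    have "Q ** map_matrix of_real ?M = ?N ** Q"
      unfolding map_matrix_of_real_matpow_diff by (rule matpow_commute_diff[OF QA])
    then have "det Q * complex_of_real (det ?M) = det ?N * det Q"
      by (metis det_mul det_map_matrix_of_real)
    then have dM: "complex_of_real (det ?M) = det ?N" using \<open>det Q \<noteq> 0\<close> by simp
    have "det ?N = (\<Prod>i\<in>UNIV. ?N $ i $ i)"
      by (rule det_triangular[OF h])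
        (auto simp: matpow_triangular(1)[OF inj U(1)] Finite_Cartesian_Product.mat_def)
    also have "\<dots> = (\<Prod>i\<in>UNIV. ev (h i) ^ n - 1)"
      by (simp add: matpow_triangular(2)[OF inj U(1)] U(2) Finite_Cartesian_Product.mat_def)
    finally have "\<bar>det ?M\<bar> = (\<Prod>i\<in>UNIV. cmod (ev (h i) ^ n - 1))"
      using dM by (metis norm_of_real prod_norm)
    also have "\<dots> \<le> (\<Prod>i\<in>UNIV. 2 * exp (real n * ln (cmod (ev (h i)))))"
    proof (rule prod_mono, intro conjI)
      fix i
      have "cmod (ev (h i) ^ n - 1) \<le> cmod (ev (h i)) ^ n + 1"
        using norm_triangle_ineq4[of "ev (h i) ^ n" 1] by (simp add: norm_power)
      also have "\<dots> \<le> 2 * cmod (ev (h i)) ^ n"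
        using one_le_power[of "cmod (ev (h i))" n] ev1[of i] by simp
      also have "cmod (ev (h i)) = exp (ln (cmod (ev (h i))))"
        by (subst exp_ln) (use ev1[of i] in linarith, rule refl)
      also have "exp (ln (cmod (ev (h i)))) ^ n = exp (real n * ln (cmod (ev (h i))))"
        by (simp add: exp_of_nat_mult)
      finally show "cmod (ev (h i) ^ n - 1) \<le> 2 * exp (real n * ln (cmod (ev (h i))))" .
    qed auto
    also have "\<dots> = 2 ^ CARD('n) * exp (real n * (\<Sum>i\<in>UNIV. ln (cmod (ev (h i)))))"
      by (simp add: prod.distrib exp_sum sum_distrib_left)
    finally show "\<bar>det ?M\<bar> \<le> 2 ^ CARD('n) * exp (real n * (\<Sum>i\<in>UNIV. ln (cmod (ev (h i)))))" .
  qed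
qed

section \<open>Volumes of linear preimages\<close>

text \<open>The change of variables formula \<open>measure_linear_image\<close> needs a wellordered index type; this
  copy of an arbitrary finite type provides one.\<close>

typedef 'n wcopy = "{..<CARD('n::finite)}"
  by (rule exI[of _ 0]) simp

instantiation wcopy :: (finite) "{finite, wellorder}"
begin

definition less_eq_wcopy :: "'a wcopy \<Rightarrow> 'a wcopy \<Rightarrow> bool" where
  "x \<le> y \<longleftrightarrow> Rep_wcopy x \<le> Rep_wcopy y"

definition less_wcopy :: "'a wcopy \<Rightarrow> 'a wcopy \<Rightarrow> bool" where
  "x < y \<longleftrightarrow> Rep_wcopy x < Rep_wcopy y"

instance
proof
  have "finite (range (Rep_wcopy :: 'a wcopy \<Rightarrow> nat))"
    by (simp add: type_definition.Rep_range[OF type_definition_wcopy])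
  then show "finite (UNIV :: 'a wcopy set)"
    by (rule finite_imageD) (simp add: inj_on_def Rep_wcopy_inject)
  show "P a" if "\<And>x. (\<And>y. y < x \<Longrightarrow> P y) \<Longrightarrow> P x" for P and a :: "'a wcopy"
    by (rule measure_induct[of Rep_wcopy P a]) (rule that, simp add: less_wcopy_def)
qed (auto simp: less_eq_wcopy_def less_wcopy_def Rep_wcopy_inject)

end

lemma card_wcopy: "CARD('n::finite wcopy) = CARD('n)"
  by (simp add: type_definition.card[OF type_definition_wcopy])

lemma prod_Basis_cart:
  fixes f :: "real ^ 'n \<Rightarrow> 'a::comm_monoid_mult"
  shows "(\<Prod>b\<in>Basis. f b) = (\<Prod>i\<in>UNIV. f (axis i 1))"
proof -
  have *: "(Basis :: (real ^ 'n) set) = range (\<lambda>i. axis i 1)" by (auto simp: Basis_vec_def)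
  show ?thesis unfolding * by (subst prod.reindex) (auto simp: inj_on_def axis_eq_axis)
qed

text \<open>Lebesgue measure is determined by the volumes of boxes, and renaming the coordinates
  only permutes the factors of such a volume.\<close>

lemma lborel_reindex_cart:
  fixes e :: "'m::finite \<Rightarrow> 'n::finite"
  assumes e: "bij e"
  shows "(lborel :: (real ^ 'm) measure) = distr lborel borel (\<lambda>x :: real ^ 'n. \<chi> k. x $ e k)"
proof (rule lborel_eqI)
  let ?f = "\<lambda>x :: real ^ 'n. (\<chi> k. x $ e k) :: real ^ 'm"
  have "continuous_on UNIV ?f" by (intro continuous_intros)
  then have m[measurable]: "?f \<in> borel_measurable borel" by (rule borel_measurable_continuous_onI)
  fix l u :: "real ^ 'm" assume lu: "\<And>b. b \<in> Basis \<Longrightarrow> l \<bullet> b \<le> u \<bullet> b"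
  have lu': "l $ k \<le> u $ k" for k
    using lu[of "axis k 1"] by (simp add: axis_in_Basis_iff inner_axis)
  define l' u' where "l' = (\<chi> i. l $ inv_into UNIV e i)" and "u' = (\<chi> i. u $ inv_into UNIV e i)"
  have ie: "inv_into UNIV e (e k) = k" "e (inv_into UNIV e i) = i" for k i
    using e by (simp_all add: bij_is_inj bij_is_surj surj_f_inv_f)
  have "?f -` box l u = box l' u'"
  proof (intro Set.set_eqI iffI)
    fix x assume "x \<in> ?f -` box l u"
    then have *: "l $ k < x $ e k \<and> x $ e k < u $ k" for k by (simp add: mem_box_cart)
    show "x \<in> box l' u'" using *[of "inv_into UNIV e _"] by (simp add: mem_box_cart l'_def u'_def ie)
  next
    fix x assume "x \<in> box l' u'"
    then have *: "l $ inv_into UNIV e i < x $ i \<and> x $ i < u $ inv_into UNIV e i" for i by (simp add: mem_box_cart l'_def u'_def)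
    show "x \<in> ?f -` box l u" using *[of "e _"] by (simp add: mem_box_cart ie)
  qed
  then have "emeasure (distr lborel borel ?f) (box l u) = emeasure lborel (box l' u')"
    by (simp add: emeasure_distr)
  also have "\<dots> = (\<Prod>b\<in>Basis. (u' - l') \<bullet> b)"
    by (rule emeasure_lborel_box) (use lu' in \<open>auto simp: Basis_vec_def inner_axis l'_def u'_def\<close>)
  also have "(\<Prod>b\<in>Basis. (u' - l') \<bullet> b) = (\<Prod>i\<in>UNIV. (\<lambda>k. u $ k - l $ k) (inv_into UNIV e i))"
    by (simp add: prod_Basis_cart inner_axis l'_def u'_def)
  also have "\<dots> = (\<Prod>k\<in>UNIV. u $ k - l $ k)"
    using prod.reindex_bij_betw[OF bij_imp_bij_inv[OF e], of "\<lambda>k. u $ k - l $ k"] by simp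
  also have "\<dots> = (\<Prod>b\<in>Basis. (u - l) \<bullet> b)"
    by (simp add: prod_Basis_cart inner_axis)
  finally show "emeasure (distr lborel borel ?f) (box l u) = ennreal (\<Prod>b\<in>Basis. (u - l) \<bullet> b)" .
qed simp

text \<open>The preimage under \<open>M\<close> is the image under its inverse \<open>N\<close>,
  whose determinant is the reciprocal.\<close>

lemma measure_matrix_vimage_wellorder:
  fixes M :: "real ^ 'n :: {finite, wellorder} ^ 'n :: _"
  assumes M: "det M \<noteq> 0" and S: "S \<in> lmeasurable"
  shows "{x. M *v x \<in> S} \<in> lmeasurable"
    and "measure lebesgue {x. M *v x \<in> S} = measure lebesgue S / \<bar>det M\<bar>"
proof -
  have "invertible M" using M by (simp add: invertible_det_nz)
  then obtain N where N: "M ** N = mat 1" "N ** M = mat 1" by (auto simp: invertible_def)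
  have *: "{x. M *v x \<in> S} = (*v) N ` S"
  proof (intro Set.set_eqI iffI)
    fix x assume "x \<in> {x. M *v x \<in> S}"
    moreover have "x = N *v (M *v x)" by (simp add: matrix_vector_mul_assoc N)
    ultimately show "x \<in> (*v) N ` S" by blast
  qed (auto simp: matrix_vector_mul_assoc N)
  have lin: "linear ((*v) N)" by simp
  show "{x. M *v x \<in> S} \<in> lmeasurable"
    unfolding * by (rule measurable_linear_image[OF lin S])
  have "det N * det M = 1" using arg_cong[OF N(2), of det] by (simp add: det_mul)
  then have "det N = 1 / det M" using M by (simp add: field_simps)
  then show "measure lebesgue {x. M *v x \<in> S} = measure lebesgue S / \<bar>det M\<bar>"
    unfolding * by (simp add: measure_linear_image[OF lin S])
qed

text \<open>The wellordered case transported along a bijection \<open>e\<close> of the index types,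
  which preserves volumes and the determinant. \<open>S\<close> is Borel because the coordinate
  renamings enter as Borel measurable maps.\<close>

lemma measure_matrix_vimage:
  fixes M :: "real ^ 'n ^ 'n"
  assumes M: "det M \<noteq> 0" and S: "S \<in> lmeasurable" "S \<in> sets borel"
  shows "{x. M *v x \<in> S} \<in> lmeasurable"
    and "measure lebesgue {x. M *v x \<in> S} = measure lebesgue S / \<bar>det M\<bar>"
proof -
  have "card (UNIV :: 'n wcopy set) = card (UNIV :: 'n set)" by (rule card_wcopy)
  then obtain e :: "'n wcopy \<Rightarrow> 'n" where e: "bij e"
    using finite_same_card_bij[OF finite finite] by blast
  have ie: "inv_into UNIV e (e k) = k" "e (inv_into UNIV e i) = i" for k i
    using e by (simp_all add: bij_is_inj bij_is_surj surj_f_inv_f)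
  let ?f = "\<lambda>x :: real ^ 'n. (\<chi> k. x $ e k) :: real ^ 'n wcopy"
  let ?g = "\<lambda>x :: real ^ 'n wcopy. (\<chi> k. x $ inv_into UNIV e k) :: real ^ 'n"
  have gf: "?g (?f x) = x" "?f (?g z) = z" for x z by (simp_all add: ie vec_eq_iff)
  define M' :: "real ^ 'n wcopy ^ 'n wcopy" where "M' = (\<chi> i j. M $ e i $ e j)"
  have detM': "det M' = det M"
  proof -
    obtain f where f: "bij_betw f {0..<CARD('n)} (UNIV :: 'n wcopy set)"
      using ex_bij_betw_nat_finite[of "UNIV :: 'n wcopy set"] by (auto simp: card_wcopy)
    have "bij_betw (e \<circ> f) {0..<CARD('n)} UNIV" using f e by (rule bij_betw_trans)
    then show ?thesis by (simp add: det_eq_det_mat[OF f] det_eq_det_mat M'_def)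
  qed
  have fM: "M' *v ?f x = ?f (M *v x)" for x
  proof -
    have "(\<Sum>j\<in>UNIV. M $ e i $ e j * x $ e j) = (\<Sum>j\<in>UNIV. M $ e i $ j * x $ j)" for i
      by (rule sum.reindex_bij_betw[OF e])
    then show ?thesis by (simp add: M'_def matrix_vector_mult_def vec_eq_iff)
  qed
  have "continuous_on UNIV ?g" by (intro continuous_intros)
  then have mg[measurable]: "?g \<in> borel_measurable borel" by (rule borel_measurable_continuous_onI)
  have "continuous_on UNIV ?f" by (intro continuous_intros)
  then have mf[measurable]: "?f \<in> borel_measurable borel" by (rule borel_measurable_continuous_onI)
  have ems: "emeasure lborel (?g -` X) = emeasure lborel X" if [measurable]: "X \<in> sets borel" for X
  proof -
    have "emeasure lborel X = emeasure (distr lborel borel ?g) X"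
      using lborel_reindex_cart[OF bij_imp_bij_inv[OF e]] by metis
    then show ?thesis by (simp add: emeasure_distr)
  qed
  have P: "{x. M *v x \<in> S} \<in> sets borel"
  proof -
    have "continuous_on UNIV ((*v) M)" by (simp add: linear_continuous_on)
    then have [measurable]: "(*v) M \<in> borel_measurable borel" by (rule borel_measurable_continuous_onI)
    have "(*v) M -` S \<inter> space borel \<in> sets borel" using S(2) by measurable
    then show ?thesis by (simp add: vimage_def)
  qed
  have gS: "?g -` S \<in> sets borel" using measurable_sets[OF mg S(2)] by simp
  have fin: "emeasure lborel S < \<infinity>"
    using S by (simp add: fmeasurable_def)
  have "?g -` S \<in> lmeasurable"
    using gS fin ems[OF S(2)] by (simp add: fmeasurable_def)
  note * = measure_matrix_vimage_wellorder[OF _ this, of M', unfolded detM', OF M]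
  have eq: "{z. M' *v z \<in> ?g -` S} = ?g -` {x. M *v x \<in> S}"
  proof -
    have "?g (M' *v z) = M *v ?g z" for z using fM[of "?g z"] by (simp only: gf)
    then show ?thesis by (auto simp del: vimage_Collect_eq)
  qed
  have e1: "emeasure lebesgue {x. M *v x \<in> S} = emeasure lebesgue {z. M' *v z \<in> ?g -` S}"
  proof -
    have "emeasure lebesgue {z. M' *v z \<in> ?g -` S} = emeasure lborel {z. M' *v z \<in> ?g -` S}"
      unfolding eq using measurable_sets[OF mg P] by simp
    also have "\<dots> = emeasure lborel {x. M *v x \<in> S}"
      unfolding eq by (rule ems[OF P])
    finally show ?thesis using P by simp
  qed
  show "{x. M *v x \<in> S} \<in> lmeasurable"
    using P fmeasurableD2[OF *(1)] e1 by (intro fmeasurableI) (simp_all add: less_top)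
  have "measure lebesgue {x. M *v x \<in> S} = measure lebesgue {z. M' *v z \<in> ?g -` S}"
    by (simp only: measure_def e1)
  also have "\<dots> = measure lebesgue (?g -` S) / \<bar>det M\<bar>" by (rule *(2))
  also have "measure lebesgue (?g -` S) = measure lebesgue S"
    using ems[OF S(2)] gS S(2) by (simp add: measure_def)
  finally show "measure lebesgue {x. M *v x \<in> S} = measure lebesgue S / \<bar>det M\<bar>" .
qed

section \<open>Counting and volume near integer vectors\<close>

definition int_vecs :: "(real ^ 'n) set" where
  "int_vecs = {y. \<forall>i. y $ i \<in> \<int>}"

lemma int_vecs_near: "\<exists>y\<in>int_vecs. norm (w - y) \<le> CARD('n)" for w :: "real ^ 'n"
proof (intro bexI)
  let ?y = "\<chi> i. real_of_int \<lfloor>w $ i\<rfloor>"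
  have "norm (w - ?y) \<le> (\<Sum>i\<in>UNIV. \<bar>(w - ?y) $ i\<bar>)" by (rule norm_le_l1_cart)
  also have "\<dots> \<le> (\<Sum>i\<in>(UNIV :: 'n set). 1)"
    by (intro sum_mono) (simp, linarith)
  finally show "norm (w - ?y) \<le> CARD('n)" by simp
qed (simp add: int_vecs_def)

lemma int_vecs_dist:
  assumes "y \<in> int_vecs" "y' \<in> int_vecs" "norm (y - y') < 1"
  shows "y = y'"
proof -
  have "y $ i = y' $ i" for i
  proof -
    have "\<bar>y $ i - y' $ i\<bar> < 1"
      using component_le_norm_cart[of "y - y'" i] assms(3) by simp
    moreover obtain a b where "y $ i = of_int a" "y' $ i = of_int b"
      using assms(1,2) by (auto simp: int_vecs_def elim!: Ints_cases[of "y $ i"] Ints_cases[of "y' $ i"]) (metis Ints_cases)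
    ultimately show ?thesis by simp
  qed
  then show ?thesis by (simp add: vec_eq_iff)
qed

lemma box_measure:
  fixes G :: "real ^ 'n ^ 'n"
  assumes G: "det G \<noteq> 0" and c: "\<And>i. c i \<ge> 0"
  shows "{x. \<forall>i. \<bar>(G *v x) $ i - g i\<bar> \<le> c i} \<in> lmeasurable"
    and "measure lebesgue {x. \<forall>i. \<bar>(G *v x) $ i - g i\<bar> \<le> c i} = (\<Prod>i\<in>UNIV. 2 * c i) / \<bar>det G\<bar>"
proof -
  let ?B = "cbox (\<chi> i. g i - c i) (\<chi> i. g i + c i)"
  have eq: "{x. \<forall>i. \<bar>(G *v x) $ i - g i\<bar> \<le> c i} = {x. G *v x \<in> ?B}"
    by (auto simp: mem_box_cart abs_le_iff algebra_simps)
  have B: "?B \<in> lmeasurable" "?B \<in> sets borel" by auto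
  show "{x. \<forall>i. \<bar>(G *v x) $ i - g i\<bar> \<le> c i} \<in> lmeasurable"
    unfolding eq by (rule measure_matrix_vimage(1)[OF G B])
  have "measure lebesgue ?B = (\<Prod>i\<in>UNIV. 2 * c i)"
  proof -
    have "measure lebesgue ?B = (\<Prod>b\<in>Basis. (\<chi> i. g i + c i) \<bullet> b - (\<chi> i. g i - c i) \<bullet> b)"
      by (subst measure_completion, simp, rule content_cbox)
        (use c in \<open>auto simp: Basis_vec_def inner_axis\<close>)
    then show ?thesis by (simp add: prod_Basis_cart inner_axis)
  qed
  then show "measure lebesgue {x. \<forall>i. \<bar>(G *v x) $ i - g i\<bar> \<le> c i} = (\<Prod>i\<in>UNIV. 2 * c i) / \<bar>det G\<bar>"
    unfolding eq by (simp add: measure_matrix_vimage(2)[OF G B])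
qed

lemma ellipsoid_measure:
  fixes M :: "real ^ 'n ^ 'n"
  assumes M: "det M \<noteq> 0" and r: "r \<ge> 0"
  shows "{x. norm (M *v x - y) < r} \<in> lmeasurable"
    and "measure lebesgue {x. norm (M *v x - y) < r} = unit_ball_vol (real CARD('n)) * r ^ CARD('n) / \<bar>det M\<bar>"
proof -
  have eq: "{x. norm (M *v x - y) < r} = {x. M *v x \<in> ball y r}"
    by (auto simp: dist_norm norm_minus_commute)
  have B: "ball y r \<in> lmeasurable" "ball y r \<in> sets borel" by auto
  show "{x. norm (M *v x - y) < r} \<in> lmeasurable"
    unfolding eq by (rule measure_matrix_vimage(1)[OF M B])
  have "measure lebesgue (ball y r) = unit_ball_vol (real CARD('n)) * r ^ CARD('n)"
    using content_ball[OF r, of y] by simp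
  then show "measure lebesgue {x. norm (M *v x - y) < r} = unit_ball_vol (real CARD('n)) * r ^ CARD('n) / \<bar>det M\<bar>"
    unfolding eq measure_matrix_vimage(2)[OF M B] by simp
qed

text \<open>Distinct integer vectors are at distance at least 1, so balls of radius at most 1/2
  around them are disjoint, and so are their preimages.\<close>

lemma ellipsoids_disjoint:
  fixes M :: "real ^ 'n ^ 'n"
  assumes "r \<le> 1 / 2"
  shows "pairwise (\<lambda>y y'. disjnt {x. norm (M *v x - y) < r} {x. norm (M *v x - y') < r}) int_vecs"
proof (intro pairwiseI)
  fix y y' :: "real ^ 'n" assume y: "y \<in> int_vecs" "y' \<in> int_vecs" "y \<noteq> y'"
  have False if "norm (M *v x - y) < r" "norm (M *v x - y') < r" for x
  proof -
    have "norm (y - y') \<le> norm (M *v x - y') + norm (M *v x - y)"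
      using norm_triangle_ineq4[of "M *v x - y'" "M *v x - y"] by simp
    then have "norm (y - y') < 1" using that assms by linarith
    then show False using int_vecs_dist y by blast
  qed
  then show "disjnt {x. norm (M *v x - y) < r} {x. norm (M *v x - y') < r}"
    by (auto simp: disjnt_def)
qed

text \<open>Packing arguments bound finite subfamilies; this turns such a bound into finiteness of
  the whole family together with the count.\<close>

lemma card_bound_of_finite_subsets:
  fixes v V :: real
  assumes v: "v > 0" and F: "\<And>F. finite F \<Longrightarrow> F \<subseteq> Y \<Longrightarrow> real (card F) * v \<le> V"
  shows "finite Y" and "real (card Y) * v \<le> V"
proof -
  show "finite Y"
  proof (rule ccontr)
    assume "infinite Y"
    then obtain F where F': "finite F" "card F = nat \<lceil>V / v\<rceil> + 1" "F \<subseteq> Y"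
      using infinite_arbitrarily_large by blast
    have "real (card F) > V / v" unfolding F'(2) by linarith
    then have "real (card F) * v > V" using v by (simp add: pos_divide_less_eq)
    then show False using F[OF F'(1,3)] by simp
  qed
  then show "real (card Y) * v \<le> V" using F by simp
qed

text \<open>Packing: the ellipsoids of radius 1/2 around the counted integer vectors are disjoint,
  have equal volume, and all lie in one box in \<open>G\<close>-coordinates. Its half-sides add the
  extent \<open>K * \<rho>\<close> of the ball to the extent \<open>a i * (t + 1/2)\<close> of an
  enlarged ellipsoid.\<close>

lemma int_vecs_count:
  fixes M G :: "real ^ 'n ^ 'n" and x0 :: "real ^ 'n"
  assumes M: "det M \<noteq> 0" and G: "det G \<noteq> 0"
    and a: "\<And>z i. \<bar>(G *v z) $ i\<bar> \<le> a i * norm (M *v z)" "\<And>i. a i \<ge> 0"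
    and K: "\<And>z i. \<bar>(G *v z) $ i\<bar> \<le> K * norm z" "K \<ge> 0" and \<rho>: "\<rho> \<ge> 0" and t: "t \<ge> 0"
  defines "Y \<equiv> {y \<in> int_vecs. \<exists>x\<in>cball x0 \<rho>. norm (M *v x - y) \<le> t}"
  shows "finite Y"
    and "real (card Y) * (unit_ball_vol (real CARD('n)) * (1/2) ^ CARD('n) / \<bar>det M\<bar>)
      \<le> (\<Prod>i\<in>UNIV. 2 * (K * \<rho> + a i * (t + 1/2))) / \<bar>det G\<bar>"
proof -
  let ?v = "unit_ball_vol (real CARD('n)) * (1/2) ^ CARD('n) / \<bar>det M\<bar>"
  let ?V = "(\<Prod>i\<in>UNIV. 2 * (K * \<rho> + a i * (t + 1/2))) / \<bar>det G\<bar>"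
  let ?E = "\<lambda>y. {x. norm (M *v x - y) < 1/2}"
  let ?B = "{x. \<forall>i. \<bar>(G *v x) $ i - (G *v x0) $ i\<bar> \<le> K * \<rho> + a i * (t + 1/2)}"
  have v: "?v > 0" using M by simp
  have c: "K * \<rho> + a i * (t + 1/2) \<ge> 0" for i using K \<rho> a t by simp
  have EB: "?E y \<subseteq> ?B" if "y \<in> Y" for y
  proof safe
    fix z i assume z: "norm (M *v z - y) < 1/2"
    obtain x where x: "dist x0 x \<le> \<rho>" "norm (M *v x - y) \<le> t" using \<open>y \<in> Y\<close> by (auto simp: Y_def)
    have "norm (M *v (z - x)) \<le> norm (M *v z - y) + norm (M *v x - y)"
      using norm_triangle_ineq4[of "M *v z - y" "M *v x - y"] by (simp add: matrix_vector_mult_diff_distrib)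
    then have "norm (M *v (z - x)) \<le> t + 1/2" using z x by simp
    then have "a i * norm (M *v (z - x)) \<le> a i * (t + 1/2)" using a(2) by (intro mult_left_mono) auto
    then have 1: "\<bar>(G *v (z - x)) $ i\<bar> \<le> a i * (t + 1/2)" using a(1)[of "z - x" i] by linarith
    have "K * norm (x - x0) \<le> K * \<rho>" using x K by (intro mult_left_mono) (auto simp: dist_norm norm_minus_commute)
    then have 2: "\<bar>(G *v (x - x0)) $ i\<bar> \<le> K * \<rho>" using K(1)[of "x - x0" i] by linarith
    have "(G *v z) $ i - (G *v x0) $ i = (G *v (z - x)) $ i + (G *v (x - x0)) $ i"
      by (simp add: matrix_vector_mult_diff_distrib)
    then show "\<bar>(G *v z) $ i - (G *v x0) $ i\<bar> \<le> K * \<rho> + a i * (t + 1/2)" using 1 2 by linarith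
  qed
  have fin: "real (card F) * ?v \<le> ?V" if F: "finite F" "F \<subseteq> Y" for F
  proof -
    have "real (card F) * ?v = (\<Sum>y\<in>F. measure lebesgue (?E y))"
      by (subst ellipsoid_measure(2)[OF M]) auto
    also have "\<dots> = measure lebesgue (\<Union>y\<in>F. ?E y)"
    proof (rule measure_UNION'[symmetric, OF F(1)])
      show "pairwise (\<lambda>y y'. disjnt (?E y) (?E y')) F"
        using F(2) by (intro pairwise_subset[OF ellipsoids_disjoint]) (auto simp: Y_def)
    qed (rule ellipsoid_measure(1)[OF M], simp)
    also have "\<dots> \<le> measure lebesgue ?B"
    proof (rule measure_mono_fmeasurable)
      show "(\<Union>y\<in>F. ?E y) \<in> sets lebesgue"
        using F ellipsoid_measure(1)[OF M, of "1/2"] by (intro sets.finite_UN) (auto intro: fmeasurableD)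
    qed (use F EB box_measure(1)[OF G c] in auto)
    also have "\<dots> = ?V" by (rule box_measure(2)[OF G c])
    finally show ?thesis .
  qed
  show "finite Y" by (rule card_bound_of_finite_subsets(1)[OF v fin])
  show "real (card Y) * ?v \<le> ?V" by (rule card_bound_of_finite_subsets(2)[OF v fin])
qed

lemma near_int_set_open:
  fixes M :: "real ^ 'n ^ 'n"
  shows "open {z. \<exists>y\<in>int_vecs. norm (M *v z - y) < r}"
proof -
  have "{z. \<exists>y\<in>int_vecs. norm (M *v z - y) < r} = (\<Union>y\<in>int_vecs. {z. norm (M *v z - y) < r})" by auto
  moreover have "open {z. norm (M *v z - y) < r}" for y
    by (intro open_Collect_less continuous_intros linear_continuous_on) simp
  ultimately show ?thesis by auto
qed

lemma lmeasurable_Int_near_int: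
  fixes M :: "real ^ 'n ^ 'n"
  assumes "A \<in> lmeasurable"
  shows "A \<inter> {z. \<exists>y\<in>int_vecs. norm (M *v z - y) < r} \<in> lmeasurable"
  by (intro fmeasurable_Int_fmeasurable[OF assms] sets_completionI_sets) (simp add: near_int_set_open borel_open)

text \<open>Every point of the ball of radius \<open>R / 2\<close> is within \<open>d\<close> of an
  integer vector after applying \<open>M\<close>, so ellipsoids of radius \<open>d + 1\<close> cover
  that ball. Shrinking each to radius \<open>r\<close> multiplies its volume by exactly
  \<open>(r / (d + 1)) ^ d\<close>, and the shrunk ones are disjoint. The condition on
  \<open>\<kappa>\<close> keeps them inside the ball of radius \<open>R\<close>.\<close>

lemma near_int_measure_lower:
  fixes M :: "real ^ 'n ^ 'n" and \<kappa> R r :: real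
  assumes M: "det M \<noteq> 0" and \<kappa>: "\<And>x. norm x \<le> \<kappa> * norm (M *v x)" "\<kappa> * (real CARD('n) + 1) \<le> R / 2"
    and r: "0 < r" "r \<le> 1 / 2" and R: "R > 0"
  shows "(r / (real CARD('n) + 1)) ^ CARD('n) * measure lebesgue (ball x0 (R / 2))
    \<le> measure lebesgue (ball x0 R \<inter> {z. \<exists>y\<in>int_vecs. norm (M *v z - y) < r})"
proof -
  let ?d = "real CARD('n)" and ?\<omega> = "unit_ball_vol (real CARD('n))"
  let ?E = "\<lambda>t y. {x. norm (M *v x - y) < t}"
  let ?S = "ball x0 R \<inter> {z. \<exists>y\<in>int_vecs. norm (M *v z - y) < r}"
  define Y where "Y = {y \<in> int_vecs. \<exists>x\<in>ball x0 (R / 2). norm (M *v x - y) \<le> ?d}"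
  have \<kappa>0: "\<kappa> \<ge> 0"
  proof (rule ccontr)
    assume "\<not> \<kappa> \<ge> 0"
    then have "\<kappa> * norm (M *v x) \<le> 0" for x by (simp add: mult_nonpos_nonneg)
    then have "norm x \<le> 0" for x :: "real ^ 'n" using \<kappa>(1) order_trans by blast
    from this[of "axis undefined 1"] show False by simp
  qed
  have fY: "finite Y"
  proof (rule finite_subset)
    have "\<bar>x $ i\<bar> \<le> \<kappa> * norm (M *v x)" for x i
      using component_le_norm_cart[of x i] \<kappa>(1)[of x] by linarith
    then show "finite {y \<in> int_vecs. \<exists>x\<in>cball x0 (R / 2). norm (M *v x - y) \<le> ?d}"
      using component_le_norm_cart R \<kappa>0
      by (intro int_vecs_count(1)[OF M, of "mat 1" "\<lambda>_. \<kappa>" 1]) auto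
  qed (auto simp: Y_def)
  have "measure lebesgue (ball x0 (R / 2)) \<le> measure lebesgue (\<Union>y\<in>Y. ?E (?d + 1) y)"
  proof (rule measure_mono_fmeasurable)
    show "ball x0 (R / 2) \<subseteq> (\<Union>y\<in>Y. ?E (?d + 1) y)"
    proof
      fix x assume x: "x \<in> ball x0 (R / 2)"
      obtain y where y: "y \<in> int_vecs" "norm (M *v x - y) \<le> ?d" using int_vecs_near by blast
      then have "y \<in> Y" using x unfolding Y_def by blast
      then show "x \<in> (\<Union>y\<in>Y. ?E (?d + 1) y)" using y by (intro UN_I[of y]) auto
    qed
    show "(\<Union>y\<in>Y. ?E (?d + 1) y) \<in> lmeasurable"
      using fY ellipsoid_measure(1)[OF M, of "?d + 1"] by (intro fmeasurable.finite_UN) auto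
  qed auto
  also have "\<dots> \<le> (\<Sum>y\<in>Y. measure lebesgue (?E (?d + 1) y))"
    by (rule measure_UNION_le[OF fY]) (use ellipsoid_measure(1)[OF M, of "?d + 1"] in \<open>auto intro: fmeasurableD\<close>)
  also have "\<dots> = real (card Y) * (?\<omega> * (?d + 1) ^ CARD('n) / \<bar>det M\<bar>)"
    by (subst ellipsoid_measure(2)[OF M]) auto
  finally have 1: "measure lebesgue (ball x0 (R / 2)) \<le> real (card Y) * (?\<omega> * (?d + 1) ^ CARD('n) / \<bar>det M\<bar>)" .
  have "(r / (?d + 1)) ^ CARD('n) * measure lebesgue (ball x0 (R / 2))
    \<le> (r / (?d + 1)) ^ CARD('n) * (real (card Y) * (?\<omega> * (?d + 1) ^ CARD('n) / \<bar>det M\<bar>))"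
    using r by (intro mult_left_mono[OF 1]) auto
  also have "\<dots> = real (card Y) * (?\<omega> * r ^ CARD('n) / \<bar>det M\<bar>)"
  proof -
    have "(?d + 1) ^ CARD('n) \<noteq> 0" by (simp add: add_nonneg_eq_0_iff)
    then show ?thesis by (simp add: power_divide)
  qed
  also have "\<dots> = (\<Sum>y\<in>Y. measure lebesgue (?E r y))"
    by (subst ellipsoid_measure(2)[OF M]) (use r in auto)
  also have "\<dots> = measure lebesgue (\<Union>y\<in>Y. ?E r y)"
  proof (rule measure_UNION'[symmetric, OF fY])
    show "pairwise (\<lambda>y y'. disjnt (?E r y) (?E r y')) Y"
      by (intro pairwise_subset[OF ellipsoids_disjoint[OF r(2)]]) (auto simp: Y_def)
  qed (use r in \<open>auto intro: ellipsoid_measure(1)[OF M]\<close>)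
  also have "\<dots> \<le> measure lebesgue ?S"
  proof (rule measure_mono_fmeasurable)
    show "(\<Union>y\<in>Y. ?E r y) \<subseteq> ?S"
    proof safe
      fix y z assume y: "y \<in> Y" and z: "norm (M *v z - y) < r"
      then obtain x where x: "x \<in> ball x0 (R / 2)" "norm (M *v x - y) \<le> ?d" by (auto simp: Y_def)
      have "norm (M *v (z - x)) \<le> norm (M *v z - y) + norm (M *v x - y)"
        using norm_triangle_ineq4[of "M *v z - y" "M *v x - y"] by (simp add: matrix_vector_mult_diff_distrib)
      then have "\<kappa> * norm (M *v (z - x)) \<le> \<kappa> * (?d + 1)"
        using z x r \<kappa>0 by (intro mult_left_mono) auto
      then have "dist x z \<le> R / 2"
        using \<kappa>(1)[of "z - x"] \<kappa>(2) unfolding dist_norm norm_minus_commute[of x z] by linarith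
      then show "z \<in> ball x0 R" using x(1) dist_triangle[of x0 z x] by simp
      show "\<exists>y\<in>int_vecs. norm (M *v z - y) < r" using y z by (auto simp: Y_def)
    qed
    show "(\<Union>y\<in>Y. ?E r y) \<in> sets lebesgue"
      using fY ellipsoid_measure(1)[OF M, of r] r by (intro sets.finite_UN) (auto intro: fmeasurableD)
    show "?S \<in> lmeasurable"
      by (rule lmeasurable_Int_near_int) simp
  qed
  finally show ?thesis .
qed

text \<open>\<open>N\<close> bounds the number of ellipsoids that meet the ball. The first estimate
  charges each with its full volume, which is good for large \<open>\<rho>\<close>; the second
  charges only a box around its intersection with the ball, which is good for small
  \<open>\<rho>\<close>.\<close>

lemma near_int_measure_upper:
  fixes M G :: "real ^ 'n ^ 'n" and x :: "real ^ 'n"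
  assumes M: "det M \<noteq> 0" and G: "det G \<noteq> 0"
    and a: "\<And>z i. \<bar>(G *v z) $ i\<bar> \<le> a i * norm (M *v z)" "\<And>i. a i \<ge> 0"
    and K: "\<And>z i. \<bar>(G *v z) $ i\<bar> \<le> K * norm z" "K \<ge> 0" and \<rho>: "\<rho> \<ge> 0"
    and r: "0 < r" "r \<le> 1 / 2"
  defines "N \<equiv> (\<Prod>i\<in>UNIV. 2 * (K * \<rho> + a i)) / \<bar>det G\<bar>
      / (unit_ball_vol (real CARD('n)) * (1/2) ^ CARD('n) / \<bar>det M\<bar>)"
  defines "S \<equiv> cball x \<rho> \<inter> {z. \<exists>y\<in>int_vecs. norm (M *v z - y) < r}"
  shows "measure lebesgue S \<le> N * (unit_ball_vol (real CARD('n)) * r ^ CARD('n) / \<bar>det M\<bar>)"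
    and "measure lebesgue S \<le> N * ((\<Prod>i\<in>UNIV. 2 * min (K * \<rho>) (r * a i)) / \<bar>det G\<bar>)"
proof -
  let ?E = "\<lambda>y. {z. norm (M *v z - y) < r}"
  define Y where "Y = {y \<in> int_vecs. \<exists>z\<in>cball x \<rho>. norm (M *v z - y) \<le> 1/2}"
  have "0 \<le> (1/2 :: real)" by simp
  note cnt = int_vecs_count[OF M G a K \<rho> this, of x, folded Y_def]
  have card: "real (card Y) \<le> N"
  proof -
    have "unit_ball_vol (real CARD('n)) * (1/2) ^ CARD('n) / \<bar>det M\<bar> > 0" using M by simp
    then show ?thesis using cnt(2) unfolding N_def by (simp only: pos_le_divide_eq) simp
  qed
  have bound: "measure lebesgue S \<le> N * m"
    if m: "\<And>y. y \<in> int_vecs \<Longrightarrow> measure lebesgue (cball x \<rho> \<inter> ?E y) \<le> m" for m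
  proof -
    have meas: "cball x \<rho> \<inter> ?E y \<in> lmeasurable" for y
      using ellipsoid_measure(1)[OF M, of r y] r by (intro fmeasurable_Int_fmeasurable) (auto intro: fmeasurableD)
    have "measure lebesgue S \<le> measure lebesgue (\<Union>y\<in>Y. cball x \<rho> \<inter> ?E y)"
    proof (rule measure_mono_fmeasurable)
      show "S \<subseteq> (\<Union>y\<in>Y. cball x \<rho> \<inter> ?E y)"
      proof
        fix z assume "z \<in> S"
        then obtain y where y: "z \<in> cball x \<rho>" "y \<in> int_vecs" "norm (M *v z - y) < r" by (auto simp: S_def)
        then have "y \<in> Y" using r unfolding Y_def by (auto intro!: bexI[of _ z])
        then show "z \<in> (\<Union>y\<in>Y. cball x \<rho> \<inter> ?E y)" using y by auto
      qed
      show "S \<in> sets lebesgue" unfolding S_def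
        by (intro sets.Int sets_completionI_sets) (simp_all add: near_int_set_open borel_open)
      show "(\<Union>y\<in>Y. cball x \<rho> \<inter> ?E y) \<in> lmeasurable"
        using cnt(1) meas by (intro fmeasurable.finite_UN) auto
    qed
    also have "\<dots> \<le> (\<Sum>y\<in>Y. measure lebesgue (cball x \<rho> \<inter> ?E y))"
      by (rule measure_UNION_le[OF cnt(1)]) (use meas in \<open>auto intro: fmeasurableD\<close>)
    also have "\<dots> \<le> (\<Sum>y\<in>Y. m)" by (intro sum_mono m) (auto simp: Y_def)
    also have "\<dots> = real (card Y) * m" by simp
    also have "\<dots> \<le> N * m"
    proof (rule mult_right_mono[OF card])
      have "measure lebesgue (cball x \<rho> \<inter> ?E 0) \<le> m" by (rule m) (simp add: int_vecs_def)
      then show "0 \<le> m" using measure_nonneg order_trans by blast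
    qed
    finally show ?thesis .
  qed
  have r0: "r \<ge> 0" using r by simp
  show "measure lebesgue S \<le> N * (unit_ball_vol (real CARD('n)) * r ^ CARD('n) / \<bar>det M\<bar>)"
  proof (rule bound)
    fix y
    have "measure lebesgue (cball x \<rho> \<inter> ?E y) \<le> measure lebesgue (?E y)"
      using ellipsoid_measure(1)[OF M r0] by (intro measure_mono_fmeasurable) (auto intro: fmeasurableD)
    then show "measure lebesgue (cball x \<rho> \<inter> ?E y) \<le> unit_ball_vol (real CARD('n)) * r ^ CARD('n) / \<bar>det M\<bar>"
      by (simp only: ellipsoid_measure(2)[OF M r0])
  qed
  show "measure lebesgue S \<le> N * ((\<Prod>i\<in>UNIV. 2 * min (K * \<rho>) (r * a i)) / \<bar>det G\<bar>)"
  proof (rule bound)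
    fix y
    have "invertible M" using M by (simp add: invertible_det_nz)
    then obtain M' where "M ** M' = mat 1" by (auto simp: invertible_def)
    then have w: "M *v (M' *v y) = y" by (simp add: matrix_vector_mul_assoc)
    \<comment> \<open>The centre of the box is chosen coordinate by coordinate: that of the ball
      where the ball is narrower, otherwise that of the ellipsoid.\<close>
    define g where "g i = (if K * \<rho> \<le> r * a i then (G *v x) $ i else (G *v (M' *v y)) $ i)" for i
    let ?B = "{z. \<forall>i. \<bar>(G *v z) $ i - g i\<bar> \<le> min (K * \<rho>) (r * a i)}"
    have c: "min (K * \<rho>) (r * a i) \<ge> 0" for i using K \<rho> a r by simp
    have "cball x \<rho> \<inter> ?E y \<subseteq> ?B"
    proof safe
      fix z i assume z: "z \<in> cball x \<rho>" "norm (M *v z - y) < r"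
      have "K * norm (z - x) \<le> K * \<rho>" using z K by (intro mult_left_mono) (auto simp: dist_norm norm_minus_commute)
      then have 1: "\<bar>(G *v (z - x)) $ i\<bar> \<le> K * \<rho>" using K(1)[of "z - x" i] by linarith
      have "a i * norm (M *v (z - M' *v y)) \<le> a i * r"
        using z a by (intro mult_left_mono) (auto simp: matrix_vector_mult_diff_distrib w)
      then have 2: "\<bar>(G *v (z - M' *v y)) $ i\<bar> \<le> r * a i"
        using a(1)[of "z - M' *v y" i] by (simp add: mult.commute)
      show "\<bar>(G *v z) $ i - g i\<bar> \<le> min (K * \<rho>) (r * a i)"
        using 1 2 by (auto simp: g_def matrix_vector_mult_diff_distrib)
    qed
    then have "measure lebesgue (cball x \<rho> \<inter> ?E y) \<le> measure lebesgue ?B"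
      using ellipsoid_measure(1)[OF M r0] box_measure(1)[OF G c] by (intro measure_mono_fmeasurable) (auto intro: fmeasurableD)
    also have "\<dots> = (\<Prod>i\<in>UNIV. 2 * min (K * \<rho>) (r * a i)) / \<bar>det G\<bar>"
      by (rule box_measure(2)[OF G c])
    finally show "measure lebesgue (cball x \<rho> \<inter> ?E y) \<le> (\<Prod>i\<in>UNIV. 2 * min (K * \<rho>) (r * a i)) / \<bar>det G\<bar>" .
  qed
qed

section \<open>The exponent inequality\<close>

text \<open>Here \<open>u\<close> is the exponent of the radius,
  \<open>\<rho> = exp (- n * u)\<close>. The right-hand side is piecewise linear in
  \<open>u\<close>, and the hypotheses on \<open>h\<close> are the wanted inequality at the points
  \<open>u = \<alpha> + l k\<close>; it remains to fill in the values between them and at both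
  ends.\<close>

lemma exponent_inequality:
  fixes l :: "'n::finite \<Rightarrow> real" and \<alpha> h u :: real
  assumes l: "\<And>i. l i > 0" and \<alpha>: "\<alpha> \<ge> 0" and spread: "\<And>i j. l i - l j \<le> \<alpha>"
    and h: "\<And>k. h * (\<alpha> + l k) \<le> (\<Sum>i\<in>UNIV. max (l i) (l k))" and h0: "h \<ge> 0" and u: "u \<ge> 0"
  shows "h * u \<le> (\<Sum>i\<in>UNIV. max (u - \<alpha>) (l i) - max 0 (l i - u))"
proof -
  obtain k0 where k0: "\<And>i. l k0 \<le> l i"
    using ex_min_if_finite[of "range l"] by (auto simp: not_less)
  show ?thesis
  proof (cases "u \<le> \<alpha> + l k0")
    case True
    \<comment> \<open>Up to \<open>w\<close> the summands on the right equal
      \<open>min (l i) u\<close>, and \<open>spread\<close> gives \<open>l i \<le> w\<close>; hence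
      each is at least \<open>(u / w) * l i\<close>, and the hypothesis for the smallest rate is
      scaled by \<open>u / w\<close>.\<close>
    define w where "w = \<alpha> + l k0"
    have w: "w > 0" "u \<le> w" using \<alpha> l[of k0] True by (auto simp: w_def)
    have "h * u = (u / w) * (h * w)" using w by simp
    also have "\<dots> \<le> (u / w) * (\<Sum>i\<in>UNIV. l i)"
      using h[of k0] w u k0 by (intro mult_left_mono) (auto simp: w_def max_absorb1)
    also have "\<dots> = (\<Sum>i\<in>UNIV. (u / w) * l i)" by (rule sum_distrib_left)
    also have "\<dots> \<le> (\<Sum>i\<in>UNIV. max (u - \<alpha>) (l i) - max 0 (l i - u))"
    proof (rule sum_mono)
      fix i
      have "u - \<alpha> \<le> l i" using True k0[of i] by linarith
      moreover have "(u / w) * l i \<le> u"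
      proof -
        have "l i \<le> w" using spread[of i k0] by (simp add: w_def)
        then have "u * l i \<le> u * w" using u by (rule mult_left_mono)
        then show ?thesis using w by (simp add: field_simps)
      qed
      moreover have "(u / w) * l i \<le> 1 * l i"
        using w u l[of i] by (intro mult_right_mono) auto
      ultimately show "(u / w) * l i \<le> max (u - \<alpha>) (l i) - max 0 (l i - u)"
        by (auto simp: max_def)
    qed
    finally show ?thesis .
  next
    case False
    \<comment> \<open>By \<open>spread\<close> every \<open>l i\<close> is now below
      \<open>u\<close>, so the right-hand side is a sum of maxima, linear in \<open>v\<close>
      between neighbouring rates. Interpolation between \<open>k1\<close> and \<open>k2\<close> does
      the rest; beyond the largest rate the slope is the dimension, which is at least
      \<open>h\<close>.\<close>
    define v where "v = u - \<alpha>"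
    have v: "l k0 < v" using False by (simp add: v_def)
    have "max 0 (l i - u) = 0" for i using spread[of i k0] False by (simp add: max_def)
    then have rhs: "(\<Sum>i\<in>UNIV. max (u - \<alpha>) (l i) - max 0 (l i - u)) = (\<Sum>i\<in>UNIV. max v (l i))"
      by (simp add: v_def)
    have "h * (\<alpha> + v) \<le> (\<Sum>i\<in>UNIV. max v (l i))"
    proof -
      have ne: "finite (l ` {k. l k \<le> v})" "l ` {k. l k \<le> v} \<noteq> {}" using less_imp_le[OF v] by auto
      obtain k1 where k1: "Max (l ` {k. l k \<le> v}) = l k1" "l k1 \<le> v" using Max_in[OF ne] by auto
      have k1_ge: "l i \<le> l k1" if "l i \<le> v" for i
        unfolding k1(1)[symmetric] using that by (intro Max_ge) auto
      show ?thesis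
      proof (cases "\<exists>k. l k > v")
        case True
        then have ne: "finite (l ` {k. l k > v})" "l ` {k. l k > v} \<noteq> {}" by auto
        obtain k2 where k2: "Min (l ` {k. l k > v}) = l k2" "l k2 > v" using Min_in[OF ne] by auto
        have k2_le: "l k2 \<le> l i" if "l i > v" for i
          unfolding k2(1)[symmetric] using that by (intro Min_le) auto
        define t where "t = (v - l k1) / (l k2 - l k1)"
        have t: "0 \<le> t" "t \<le> 1" using k1(2) k2(2) by (auto simp: t_def)
        have tv: "v = (1 - t) * l k1 + t * l k2"
        proof -
          have "t * (l k2 - l k1) = v - l k1" using k1(2) k2(2) by (simp add: t_def)
          then show ?thesis by (simp add: algebra_simps)
        qed
        have "h * (\<alpha> + v) = (1 - t) * (h * (\<alpha> + l k1)) + t * (h * (\<alpha> + l k2))"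
          unfolding tv by (simp add: algebra_simps)
        also have "\<dots> \<le> (1 - t) * (\<Sum>i\<in>UNIV. max (l i) (l k1)) + t * (\<Sum>i\<in>UNIV. max (l i) (l k2))"
          using t h by (intro add_mono mult_left_mono) auto
        also have "\<dots> = (\<Sum>i\<in>UNIV. (1 - t) * max (l i) (l k1) + t * max (l i) (l k2))"
          by (simp add: sum_distrib_left sum.distrib)
        also have "\<dots> = (\<Sum>i\<in>UNIV. max v (l i))"
        proof (rule sum.cong[OF refl])
          fix i
          show "(1 - t) * max (l i) (l k1) + t * max (l i) (l k2) = max v (l i)"
          proof (cases "l i \<le> v")
            case True
            then have "max (l i) (l k1) = l k1" "max (l i) (l k2) = l k2" "max v (l i) = v"
              using k1_ge[OF True] k2(2) True k1(2) by (simp_all add: max_def)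
            then show ?thesis using tv by simp
          next
            case False
            then have "max (l i) (l k1) = l i" "max (l i) (l k2) = l i" "max v (l i) = l i"
              using k2_le[of i] k1(2) False by (simp_all add: max_def)
            then show ?thesis by (simp add: algebra_simps)
          qed
        qed
        finally show ?thesis .
      next
        case False
        then have all: "l i \<le> l k1" "l i \<le> v" for i using k1_ge[of i] by (auto simp: not_less)
        let ?d = "real CARD('n)"
        have h1: "h * (\<alpha> + l k1) \<le> ?d * l k1" using h[of k1] all by (simp add: max_absorb2)
        have "h * l k1 \<le> ?d * l k1" using h1 mult_nonneg_nonneg[OF h0 \<alpha>]
          unfolding distrib_left by linarith
        then have "h \<le> ?d" using l[of k1] by simp
        then have "h * (v - l k1) \<le> ?d * (v - l k1)" using k1(2) by (intro mult_right_mono) auto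
        then have "h * (\<alpha> + v) \<le> ?d * v" using h1 by (simp add: algebra_simps)
        then show ?thesis using all by (simp add: max_absorb1)
      qed
    qed
    then show ?thesis unfolding rhs by (simp add: v_def)
  qed
qed

text \<open>Up to constants the left-hand side is the normalised mass of a ball of radius
  \<open>\<rho>\<close>: the number of ellipsoids met times the volume of the part of each inside
  the ball, divided by \<open>r ^ d\<close>. In logarithmic form it is
  \<open>exponent_inequality\<close>; per coordinate the maximum loses \<open>e\<close> and the
  minimum \<open>2 * e\<close>.\<close>

lemma exponent_product_bound:
  fixes l :: "'n::finite \<Rightarrow> real" and \<alpha> h e r \<rho> :: real and n :: nat
  assumes l: "\<And>i. l i > 0" and \<alpha>: "\<alpha> \<ge> 0" and spread: "\<And>i j. l i - l j \<le> \<alpha>"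
    and h: "\<And>k. h * (\<alpha> + l k) \<le> (\<Sum>i\<in>UNIV. max (l i) (l k))" and h0: "h \<ge> 0"
    and e: "e > 0" and n: "n \<ge> 1" and r: "r \<ge> exp (- (real n * (\<alpha> + 2 * e)))" and \<rho>: "0 < \<rho>" "\<rho> \<le> 1"
  defines "a \<equiv> \<lambda>i. exp (real n * (e - l i))"
  shows "exp (real n * (\<Sum>i\<in>UNIV. l i)) * (\<Prod>i\<in>UNIV. max \<rho> (a i) * min (\<rho> / r) (a i))
    \<le> exp (real n * (3 * real CARD('n) * e)) * \<rho> powr h"
proof -
  define u where "u = - ln \<rho> / real n"
  have nu: "real n * u = - ln \<rho>" using n by (simp add: u_def)
  have u: "u \<ge> 0" unfolding u_def using \<rho> n by (simp add: divide_nonpos_nonneg)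
  have \<rho>u: "\<rho> = exp (- (real n * u))" using \<rho> by (simp add: nu)
  have emax: "max (exp x) (exp y) = exp (max x y)" "min (exp x) (exp y) = exp (min x y)" for x y :: real
    by (auto simp: max_def min_def)
  let ?d = "real CARD('n)"
  have r0: "r > 0" using r less_le_trans[OF exp_gt_zero] by blast
  have f: "max \<rho> (a i) * min (\<rho> / r) (a i)
    \<le> exp (real n * (3 * e - l i - (max (u - \<alpha>) (l i) - max 0 (l i - u))))" for i
  proof -
    have 1: "max \<rho> (a i) \<le> exp (real n * (e - l i + max 0 (l i - u)))"
    proof -
      have "max \<rho> (a i) = exp (max (- (real n * u)) (real n * (e - l i)))"
        unfolding \<rho>u a_def by (rule emax)
      also have "\<dots> \<le> exp (real n * (e - l i + max 0 (l i - u)))"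
      proof -
        have "real n * (- u) \<le> real n * (e - l i + max 0 (l i - u))" using e by (intro mult_left_mono) auto
        moreover have "real n * (e - l i) \<le> real n * (e - l i + max 0 (l i - u))" by (intro mult_left_mono) auto
        ultimately show ?thesis by simp
      qed
      finally show ?thesis .
    qed
    have 2: "min (\<rho> / r) (a i) \<le> exp (real n * (2 * e - max (u - \<alpha>) (l i)))"
    proof -
      have "\<rho> / r \<le> \<rho> / exp (- (real n * (\<alpha> + 2 * e)))"
        using r \<rho> by (intro divide_left_mono mult_pos_pos r0) auto
      also have "\<dots> = exp (real n * (\<alpha> + 2 * e - u))"
        unfolding \<rho>u by (subst exp_diff[symmetric]) (simp add: algebra_simps)
      finally have \<rho>r: "\<rho> / r \<le> exp (real n * (2 * e - (u - \<alpha>)))" by (simp add: algebra_simps)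
      have ai: "a i \<le> exp (real n * (2 * e - l i))" unfolding a_def using e by (simp add: mult_left_mono)
      show ?thesis
      proof (cases "u - \<alpha> \<le> l i")
        case True
        then show ?thesis using ai by (simp add: max_def min_le_iff_disj)
      next
        case False
        then show ?thesis using \<rho>r by (simp add: max_def min_le_iff_disj)
      qed
    qed
    have "max \<rho> (a i) * min (\<rho> / r) (a i)
      \<le> exp (real n * (e - l i + max 0 (l i - u))) * exp (real n * (2 * e - max (u - \<alpha>) (l i)))"
      using 1 2 \<rho> r0 by (intro mult_mono) (auto simp: a_def)
    also have "\<dots> = exp (real n * (3 * e - l i - (max (u - \<alpha>) (l i) - max 0 (l i - u))))"
      by (subst exp_add[symmetric]) (simp add: algebra_simps)
    finally show ?thesis .
  qed
  have "(\<Prod>i\<in>UNIV. max \<rho> (a i) * min (\<rho> / r) (a i))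
    \<le> (\<Prod>i\<in>UNIV. exp (real n * (3 * e - l i - (max (u - \<alpha>) (l i) - max 0 (l i - u)))))"
    using f \<rho> r0 by (intro prod_mono) (auto simp: a_def)
  also have "\<dots> = exp (real n * (3 * ?d * e - (\<Sum>i\<in>UNIV. l i)
      - (\<Sum>i\<in>UNIV. max (u - \<alpha>) (l i) - max 0 (l i - u))))"
    by (simp add: exp_sum[symmetric] sum_distrib_left[symmetric] sum_subtractf)
  also have "\<dots> \<le> exp (real n * (3 * ?d * e - (\<Sum>i\<in>UNIV. l i) - h * u))"
    using exponent_inequality[OF l \<alpha> spread h h0 u] by (simp add: mult_left_mono)
  finally have "exp (real n * (\<Sum>i\<in>UNIV. l i)) * (\<Prod>i\<in>UNIV. max \<rho> (a i) * min (\<rho> / r) (a i))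
    \<le> exp (real n * (\<Sum>i\<in>UNIV. l i)) * exp (real n * (3 * ?d * e - (\<Sum>i\<in>UNIV. l i) - h * u))"
    by (intro mult_left_mono) auto
  also have "\<dots> = exp (real n * (3 * ?d * e)) * exp (- (real n * u) * h)"
    by (simp add: exp_add[symmetric] algebra_simps)
  also have "exp (- (real n * u) * h) = \<rho> powr h"
    using \<rho> unfolding nu by (simp add: powr_def mult.commute)
  finally show ?thesis .
qed

section \<open>Expanding sequences of matrices\<close>

lemma eventually_exp_absorb:
  fixes C c :: real
  assumes "c > 0"
  shows "\<forall>\<^sub>F n in sequentially. C \<le> exp (real n * c)"
proof (rule eventually_sequentiallyI)
  fix n assume "n \<ge> nat \<lceil>C / c\<rceil>"
  then have "C / c \<le> real n" by linarith
  then have "C \<le> real n * c" using assms by (simp add: pos_divide_le_eq)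
  then show "C \<le> exp (real n * c)" using exp_ge_add_one_self[of "real n * c"] by linarith
qed

lemma power_mult_rearrange: "a ^ k * b ^ k = c ^ k * d ^ k"
  if "a * b = c * d" for a b c d :: real
  using that by (simp only: power_mult_distrib[symmetric])

text \<open>The number of ellipsoids is proportional to the determinant \<open>D\<close> and the
  volume of each to \<open>1 / D\<close>, so \<open>D\<close> drops out.\<close>

lemma ellipsoid_count_cancel: "X / g / (w * (1/2) ^ k / D) * (w * r ^ k / D) = X * (2 * r) ^ k / g"
  if "w \<noteq> 0" "D \<noteq> 0" for X g w D r :: real
  using that by (simp add: power_mult_distrib power_divide)

text \<open>With boxes in place of full ellipsoids the determinant survives; \<open>det_M_le\<close>
  is applied to it.\<close>

lemma box_count_cancel: "X / g / (w * (1/2) ^ k / D) * (Y / g) = (X * Y) * (2 ^ k / (w * g ^ 2) * D)"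
  for X Y g w D :: real
  by (simp add: power_divide power2_eq_square mult_ac)

text \<open>A Frostman condition for normalised Lebesgue measure on \<open>S\<close>, with radii
  measured in units of \<open>R\<close>.\<close>

definition evenly_spread :: "(real ^ 'n) set \<Rightarrow> real \<Rightarrow> real \<Rightarrow> real \<Rightarrow> bool" where
  "evenly_spread S C R s \<longleftrightarrow> measure lebesgue S > 0 \<and>
    (\<forall>x \<rho>. \<rho> > 0 \<longrightarrow> measure lebesgue (cball x \<rho> \<inter> S) \<le> C * measure lebesgue S * (\<rho> / R) powr s)"

text \<open>\<open>M n\<close> stands for \<open>matpow A n - mat 1\<close> and \<open>l i\<close>
  for the logarithm of the modulus attached to coordinate \<open>i\<close> of \<open>G\<close>. By
  \<open>contraction\<close>, the preimage of a ball of radius \<open>r\<close> lies in a box with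
  half-sides about \<open>r * exp (- n * l i)\<close>.\<close>

locale expanding_sequence =
  fixes M :: "nat \<Rightarrow> real ^ 'n ^ 'n" and G :: "real ^ 'n ^ 'n" and l :: "'n \<Rightarrow> real"
  assumes det_G: "det G \<noteq> 0" and l_pos: "l i > 0"
    and contraction: "e > 0 \<Longrightarrow> \<exists>C>0. \<forall>n\<ge>1. \<forall>x i. \<bar>(G *v x) $ i\<bar> \<le>
       C * exp (real n * (e - l i)) * norm (M n *v x)"
    and det_M_le: "\<bar>det (M n)\<bar> \<le> 2 ^ CARD('n) * exp (real n * (\<Sum>i\<in>UNIV. l i))"
begin

lemma eventually_contraction:
  assumes "e > 0"
  shows "\<forall>\<^sub>F n in sequentially. \<forall>x i. \<bar>(G *v x) $ i\<bar> \<le> exp (real n * (e - l i)) * norm (M n *v x)"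
proof -
  from assms have "e / 2 > 0" by simp
  from contraction[OF this] obtain C where C: "C > 0" "\<And>n x i. n \<ge> 1 \<Longrightarrow> \<bar>(G *v x) $ i\<bar> \<le>
       C * exp (real n * (e / 2 - l i)) * norm (M n *v x)" by blast
  show ?thesis
    using eventually_exp_absorb[OF \<open>e / 2 > 0\<close>, of C] eventually_ge_at_top[of 1]
  proof eventually_elim
    case (elim n)
    show ?case
    proof (intro allI)
      fix x i
      have "C * exp (real n * (e / 2 - l i)) \<le> exp (real n * (e / 2)) * exp (real n * (e / 2 - l i))"
        using elim(1) by (intro mult_right_mono) auto
      also have "\<dots> = exp (real n * (e - l i))" by (subst exp_add[symmetric]) (simp add: algebra_simps)
      finally have "C * exp (real n * (e / 2 - l i)) * norm (M n *v x) \<le> exp (real n * (e - l i)) * norm (M n *v x)"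
        by (intro mult_right_mono) auto
      then show "\<bar>(G *v x) $ i\<bar> \<le> exp (real n * (e - l i)) * norm (M n *v x)"
        using C(2)[OF elim(2), of x i] by linarith
    qed
  qed
qed

lemma G_inverse_bound:
  obtains K where "K > 0" "\<And>x c. (\<And>i. \<bar>(G *v x) $ i\<bar> \<le> c) \<Longrightarrow> norm x \<le> K * c"
proof -
  have "invertible G" using det_G by (simp add: invertible_det_nz)
  then obtain N where N: "N ** G = mat 1" by (auto simp: invertible_def)
  obtain K where K: "K > 0" "\<And>z. norm (N *v z) \<le> norm z * K"
    using bounded_linear.pos_bounded[OF matrix_vector_mul_bounded_linear[of N]] by blast
  show thesis
  proof (rule that[of "K * CARD('n)"])
    show "K * real CARD('n) > 0" using K by simp
    fix x c assume c: "\<And>i. \<bar>(G *v x) $ i\<bar> \<le> c"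
    have "norm x = norm (N *v (G *v x))" by (simp add: matrix_vector_mul_assoc N)
    also have "\<dots> \<le> norm (G *v x) * K" by (rule K)
    also have "\<dots> \<le> (\<Sum>i\<in>(UNIV :: 'n set). c) * K"
      using K by (intro mult_right_mono order_trans[OF norm_le_l1_cart] sum_mono c) auto
    finally show "norm x \<le> K * real CARD('n) * c" by (simp add: algebra_simps)
  qed
qed

lemma G_bound:
  obtains K where "K \<ge> 1" "\<And>x i. \<bar>(G *v x) $ i\<bar> \<le> K * norm x"
proof -
  obtain K where K: "K > 0" "\<And>z. norm (G *v z) \<le> norm z * K"
    using bounded_linear.pos_bounded[OF matrix_vector_mul_bounded_linear[of G]] by blast
  show thesis
  proof (rule that[of "max 1 K"])
    fix x i
    have "\<bar>(G *v x) $ i\<bar> \<le> norm x * K" using component_le_norm_cart[of "G *v x" i] K(2)[of x] by linarith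
    also have "\<dots> \<le> max 1 K * norm x" by (simp add: mult.commute[of _ K] mult_right_mono)
    finally show "\<bar>(G *v x) $ i\<bar> \<le> max 1 K * norm x" .
  qed simp
qed

text \<open>By \<open>contraction\<close>, \<open>M n *v x = 0\<close> forces
  \<open>G *v x = 0\<close>, hence \<open>x = 0\<close>.\<close>

lemma det_M_nonzero:
  assumes "n \<ge> 1"
  shows "det (M n) \<noteq> 0"
proof -
  obtain C where C: "\<And>x i. \<bar>(G *v x) $ i\<bar> \<le> C * exp (real n * (1 - l i)) * norm (M n *v x)"
    using contraction[of 1] assms by force
  obtain K where K: "K > 0" "\<And>x c. (\<And>i. \<bar>(G *v x) $ i\<bar> \<le> c) \<Longrightarrow> norm x \<le> K * c"
    by (rule G_inverse_bound) blast
  have "x = 0" if "M n *v x = 0" for x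
    using K(2)[of x 0] C[of x] that by simp
  then have "\<exists>B. B ** M n = mat 1" by (simp add: matrix_left_invertible_ker)
  then show ?thesis using invertible_det_nz invertible_left_inverse by blast
qed

text \<open>All rates are at least \<open>l k0 > 0\<close>, so the cells cut out by the integer
  lattice eventually become small compared with any fixed ball.\<close>

lemma eventually_norm_contraction:
  assumes "\<kappa> > 0"
  shows "\<forall>\<^sub>F n in sequentially. \<forall>x. norm x \<le> \<kappa> * norm (M n *v x)"
proof -
  obtain K where K: "K > 0" "\<And>x c. (\<And>i. \<bar>(G *v x) $ i\<bar> \<le> c) \<Longrightarrow> norm x \<le> K * c"
    by (rule G_inverse_bound) blast
  obtain k0 where k0: "\<And>i. l k0 \<le> l i"
    using ex_min_if_finite[of "range l"] by (auto simp: not_less)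
  have e: "l k0 / 2 > 0" using l_pos[of k0] by simp
  show ?thesis
    using eventually_contraction[OF e] eventually_exp_absorb[OF e, of "K / \<kappa>"]
  proof eventually_elim
    case (elim n)
    show ?case
    proof
      fix x
      have "norm x \<le> K * (exp (- (real n * (l k0 / 2))) * norm (M n *v x))"
      proof (rule K(2))
        fix i
        have "real n * (l k0 / 2 - l i) \<le> real n * (- (l k0 / 2))"
          using k0[of i] by (intro mult_left_mono) auto
        then have "exp (real n * (l k0 / 2 - l i)) * norm (M n *v x) \<le> exp (- (real n * (l k0 / 2))) * norm (M n *v x)"
          by (intro mult_right_mono) auto
        then show "\<bar>(G *v x) $ i\<bar> \<le> exp (- (real n * (l k0 / 2))) * norm (M n *v x)"
          using elim(1)[rule_format, of x i] by linarith
      qed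
      also have "\<dots> = K * exp (- (real n * (l k0 / 2))) * norm (M n *v x)" by simp
      also have "\<dots> \<le> \<kappa> * norm (M n *v x)"
      proof (rule mult_right_mono)
        have "K \<le> \<kappa> * exp (real n * (l k0 / 2))" using elim(2) assms by (simp add: field_simps)
        then show "K * exp (- (real n * (l k0 / 2))) \<le> \<kappa>" by (simp add: exp_minus field_simps)
      qed simp
      finally show "norm x \<le> \<kappa> * norm (M n *v x)" .
    qed
  qed
qed

text \<open>Below scale \<open>R\<close> there are two regimes. Down to the size of the cells the
  ellipsoids are distributed like Lebesgue measure, and the ratio is a power of
  \<open>\<rho> / R\<close> with exponent the dimension, with a constant free of \<open>R\<close>.
  Below that size the exponent is \<open>h\<close>, and the surplus over \<open>s\<close> gives an
  exponentially small factor; it absorbs the constant that depends on \<open>R\<close> once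
  \<open>n\<close> is large. Hence \<open>C\<close> can be chosen before \<open>R\<close>.\<close>

lemma near_int_measure_ratio:
  assumes \<alpha>: "\<alpha> \<ge> 0" and spread: "\<And>i j. l i - l j \<le> \<alpha>"
    and h: "\<And>k. h * (\<alpha> + l k) \<le> (\<Sum>i\<in>UNIV. max (l i) (l k))"
    and s: "0 < s" "s < h" "s \<le> real CARD('n)"
    and psi_pos: "\<And>n. n \<ge> 1 \<Longrightarrow> \<psi> n > 0" and psi0: "\<psi> \<longlonglongrightarrow> 0"
    and liminf: "\<And>e. e > 0 \<Longrightarrow> \<exists>\<^sub>F n in sequentially. \<psi> n \<ge> exp (- (real n * (\<alpha> + e)))"
  shows "\<exists>C\<ge>1. \<forall>x0 R. 0 < R \<longrightarrow> R \<le> 1 \<longrightarrow> (\<exists>\<^sub>F n in sequentially.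
    evenly_spread (ball x0 R \<inter> {z. \<exists>y\<in>int_vecs. norm (M n *v z - y) < \<psi> n / 2}) C R s)"
proof -
  let ?d = "real CARD('n)" and ?\<omega> = "unit_ball_vol (real CARD('n))"
  obtain K where K: "K \<ge> 1" "\<And>x i. \<bar>(G *v x) $ i\<bar> \<le> K * norm x" by (rule G_bound) blast
  obtain k0 where k0: "\<And>i. l k0 \<le> l i"
    using ex_min_if_finite[of "range l"] by (auto simp: not_less)
  have h0: "h \<ge> 0" using s by simp
  have \<omega>: "?\<omega> > 0" by simp
  have gd: "\<bar>det G\<bar> > 0" using det_G by simp
  \<comment> \<open>Chosen so that
    \<open>exp (- n * l k0 / 2) powr (h - s) = exp (- 2 * n * \<theta>)\<close>.\<close>
  define \<theta> where "\<theta> = (h - s) * l k0 / 4"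
  have \<theta>: "\<theta> > 0" using s l_pos[of k0] by (simp add: \<theta>_def)
  \<comment> \<open>The first bound keeps every \<open>a i\<close> below
    \<open>exp (- n * l k0 / 2)\<close>, the second keeps the loss in
    \<open>exponent_product_bound\<close> below \<open>exp (n * \<theta>)\<close>.\<close>
  define e where "e = min (l k0 / 2) (\<theta> / (3 * ?d))"
  have e: "e > 0" "e \<le> l k0 / 2" "3 * ?d * e \<le> \<theta>"
    using \<theta> l_pos[of k0] by (auto simp: e_def min_def field_simps)
  define c where "c = ?\<omega> / (2 * (?d + 1)) ^ CARD('n)"
  have c_eq: "c = ?\<omega> / (2 ^ CARD('n) * (?d + 1) ^ CARD('n))" by (simp only: c_def power_mult_distrib)
  have c: "c > 0" unfolding c_def by (simp add: add_pos_pos)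
  \<comment> \<open>\<open>C1\<close> and \<open>C3\<close> are the constants of the upper estimates
    divided by the constant \<open>c\<close> of the lower estimate for the measure of
    \<open>S\<close>.\<close>
  define C1 where "C1 = (8 * K) ^ CARD('n) / \<bar>det G\<bar> / c"
  define C3 where "C3 = (16 * K ^ 2) ^ CARD('n) / (?\<omega> * \<bar>det G\<bar> ^ 2) * 2 ^ CARD('n) / c"
  have C3: "C3 > 0" unfolding C3_def using K \<omega> gd c by simp
  have C1: "C1 > 0" unfolding C1_def using K gd c by simp
  define C where "C = max 1 C1"
  have C: "C \<ge> 1" "C \<ge> C1" "C > 0" by (auto simp: C_def)
  show ?thesis
  proof (intro exI[of _ C] conjI allI impI)
    show "C \<ge> 1" by (rule C)
    fix x0 :: "real ^ 'n" and R :: real assume "0 < R" "R \<le> 1"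
    then have R: "0 < R \<and> R \<le> 1" ..
    define \<kappa> where "\<kappa> = R / (2 * (?d + 1))"
    have "?d + 1 > 0" by simp
    then have \<kappa>: "\<kappa> > 0" "\<kappa> * (?d + 1) \<le> R / 2" using R by (simp_all add: \<kappa>_def field_simps)
    have "\<forall>\<^sub>F n in sequentially. \<psi> n < 1" using order_tendstoD(2)[OF psi0, of 1] by simp
    then have "\<forall>\<^sub>F n in sequentially. n \<ge> 1 \<and> \<psi> n < 1 \<and> (\<forall>x. norm x \<le> \<kappa> * norm (M n *v x))
      \<and> (\<forall>x i. \<bar>(G *v x) $ i\<bar> \<le> exp (real n * (e - l i)) * norm (M n *v x))
      \<and> 2 \<le> exp (real n * e) \<and> C3 / R ^ CARD('n) \<le> exp (real n * \<theta>)"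
      using eventually_ge_at_top[of 1] eventually_norm_contraction[OF \<kappa>(1)] eventually_contraction[OF e(1)]
        eventually_exp_absorb[OF e(1), of 2] eventually_exp_absorb[OF \<theta>, of "C3 / R ^ CARD('n)"]
      by eventually_elim auto
    from frequently_eventually_conj[OF liminf[OF e(1)] this]
    show "\<exists>\<^sub>F n in sequentially.
      evenly_spread (ball x0 R \<inter> {z. \<exists>y\<in>int_vecs. norm (M n *v z - y) < \<psi> n / 2}) C R s"
    proof (rule frequently_mono[rotated], intro allI impI)
      fix n
      define r where "r = \<psi> n / 2"
      define S where "S = ball x0 R \<inter> {z. \<exists>y\<in>int_vecs. norm (M n *v z - y) < r}"
      define a where "a i = exp (real n * (e - l i))" for i
      assume *: "(n \<ge> 1 \<and> \<psi> n < 1 \<and> (\<forall>x. norm x \<le> \<kappa> * norm (M n *v x))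
      \<and> (\<forall>x i. \<bar>(G *v x) $ i\<bar> \<le> exp (real n * (e - l i)) * norm (M n *v x))
      \<and> 2 \<le> exp (real n * e) \<and> C3 / R ^ CARD('n) \<le> exp (real n * \<theta>)) \<and> \<psi> n \<ge> exp (- (real n * (\<alpha> + e)))"
      then have n: "n \<ge> 1" and nk: "\<And>x. norm x \<le> \<kappa> * norm (M n *v x)"
        and con: "\<And>x i. \<bar>(G *v x) $ i\<bar> \<le> a i * norm (M n *v x)" by (auto simp: a_def)
      have r: "0 < r" "r \<le> 1 / 2" using psi_pos[OF n] * by (auto simp: r_def)
      have rlow: "r \<ge> exp (- (real n * (\<alpha> + 2 * e)))"
      proof -
        have "2 * exp (- (real n * (\<alpha> + 2 * e))) \<le> exp (real n * e) * exp (- (real n * (\<alpha> + 2 * e)))"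
          using * by (intro mult_right_mono) auto
        also have "\<dots> = exp (- (real n * (\<alpha> + e)))" by (subst exp_add[symmetric]) (simp add: algebra_simps)
        also have "\<dots> \<le> 2 * r" using * by (simp add: r_def)
        finally show ?thesis by simp
      qed
      have dM: "det (M n) \<noteq> 0" by (rule det_M_nonzero[OF n])
      have a0: "a i > 0" for i by (simp add: a_def)
      have a0': "a i \<ge> 0" for i by (simp add: a_def)
      have K0: "K \<ge> 0" using K by simp
      have lower: "c * r ^ CARD('n) * R ^ CARD('n) \<le> measure lebesgue S"
      proof -
        have "measure lebesgue (ball x0 (R / 2)) = ?\<omega> * (R / 2) ^ CARD('n)"
          using content_ball[of "R / 2" x0] R by simp
        then have "c * r ^ CARD('n) * R ^ CARD('n) = (r / (?d + 1)) ^ CARD('n) * measure lebesgue (ball x0 (R / 2))"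
          by (simp add: c_eq power_divide mult_ac)
        also have "\<dots> \<le> measure lebesgue S"
          unfolding S_def using near_int_measure_lower[OF dM nk \<kappa>(2) r] R by simp
        finally show ?thesis .
      qed
      have Spos: "measure lebesgue S > 0"
        by (rule less_le_trans[OF _ lower]) (use c r R in simp)
      have Smeas: "S \<in> lmeasurable"
        unfolding S_def by (rule lmeasurable_Int_near_int) simp
      have upper: "measure lebesgue (cball x \<rho> \<inter> S) \<le> C * measure lebesgue S * (\<rho> / R) powr s"
        if \<rho>: "\<rho> > 0" for x \<rho>
      proof -
        let ?T = "cball x \<rho> \<inter> {z. \<exists>y\<in>int_vecs. norm (M n *v z - y) < r}"
        have Tmeas: "?T \<in> lmeasurable"
          by (rule lmeasurable_Int_near_int) simp
        have ST: "measure lebesgue (cball x \<rho> \<inter> S) \<le> measure lebesgue ?T"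
          using Smeas by (intro measure_mono_fmeasurable[OF _ _ Tmeas]) (auto simp: S_def fmeasurableD)
        have "\<rho> \<ge> 0" using \<rho> by simp
        note up = near_int_measure_upper[OF dM det_G con a0' K(2) K0 this r, of x]
        define N where "N = (\<Prod>i\<in>UNIV. 2 * (K * \<rho> + a i)) / \<bar>det G\<bar> / (?\<omega> * (1/2) ^ CARD('n) / \<bar>det (M n)\<bar>)"
        have N0: "N \<ge> 0" unfolding N_def using K \<rho> a0' by (intro divide_nonneg_nonneg prod_nonneg) auto
        \<comment> \<open>The ball is at least as large as the one containing \<open>S\<close>; or
          it is smaller but no smaller than the longest half-side \<open>a i\<close> of a cell; or
          its radius is exponentially small in \<open>n\<close>.\<close>
        consider "\<rho> \<ge> R" | "\<rho> < R" "\<rho> \<ge> exp (- (real n * (l k0 / 2)))" | "\<rho> < R" "\<rho> < exp (- (real n * (l k0 / 2)))"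
          by linarith
        then show ?thesis
        proof cases
          case 1
          have "measure lebesgue (cball x \<rho> \<inter> S) \<le> measure lebesgue S"
            using Smeas by (intro measure_mono_fmeasurable) auto
          also have "\<dots> \<le> C * measure lebesgue S * (\<rho> / R) powr s"
          proof -
            have "1 \<le> (\<rho> / R) powr s" using 1 R s by (intro ge_one_powr_ge_zero) auto
            then have "1 * 1 \<le> C * (\<rho> / R) powr s" using C by (intro mult_mono) auto
            then have "measure lebesgue S * 1 \<le> measure lebesgue S * (C * (\<rho> / R) powr s)"
              by (intro mult_left_mono) auto
            then show ?thesis by (simp add: mult_ac)
          qed
          finally show ?thesis .
        next
          case 2
          have ai: "a i \<le> \<rho>" for i
          proof -
            have "real n * (e - l i) \<le> real n * (- (l k0 / 2))"
              using e k0[of i] by (intro mult_left_mono) auto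
            then have "a i \<le> exp (real n * (- (l k0 / 2)))" unfolding a_def by simp
            then show ?thesis using 2(2) by simp
          qed
          have "(\<Prod>i\<in>(UNIV :: 'n set). 2 * (K * \<rho> + a i)) \<le> (\<Prod>i\<in>(UNIV :: 'n set). 4 * K * \<rho>)"
          proof (intro prod_mono conjI)
            fix i
            have "\<rho> \<le> K * \<rho>" using K \<rho> by (simp add: mult_left_mono[of 1 K \<rho>, simplified] mult_right_mono[of 1 K \<rho>, simplified])
            then have "2 * (K * \<rho> + a i) \<le> 2 * (K * \<rho> + K * \<rho>)"
              using order_trans[OF ai[of i]] by (intro mult_left_mono add_left_mono) auto
            then show "2 * (K * \<rho> + a i) \<le> 4 * K * \<rho>" by simp
          qed (use K \<rho> a0' in auto)
          then have P: "(\<Prod>i\<in>(UNIV :: 'n set). 2 * (K * \<rho> + a i)) \<le> (4 * K * \<rho>) ^ CARD('n)" by simp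
          have "measure lebesgue (cball x \<rho> \<inter> S) \<le> N * (?\<omega> * r ^ CARD('n) / \<bar>det (M n)\<bar>)"
            using ST up(1) unfolding N_def by linarith
          also have "\<dots> = (\<Prod>i\<in>UNIV. 2 * (K * \<rho> + a i)) * (2 * r) ^ CARD('n) / \<bar>det G\<bar>"
          proof -
            have w: "?\<omega> \<noteq> 0" by (rule less_imp_neq[OF \<omega>, symmetric])
            have D: "\<bar>det (M n)\<bar> \<noteq> 0" using dM by simp
            show ?thesis unfolding N_def by (rule ellipsoid_count_cancel[OF w D])
          qed
          also have "\<dots> \<le> (4 * K * \<rho>) ^ CARD('n) * (2 * r) ^ CARD('n) / \<bar>det G\<bar>"
            using P r by (intro divide_right_mono mult_right_mono) auto
          also have "\<dots> = C1 * (c * r ^ CARD('n) * R ^ CARD('n)) * (\<rho> / R) ^ CARD('n)"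
          proof -
            have "(4 * K * \<rho>) ^ CARD('n) * (2 * r) ^ CARD('n) = (8 * K) ^ CARD('n) * \<rho> ^ CARD('n) * r ^ CARD('n)"
              unfolding power_mult_distrib[of _ \<rho>, symmetric] by (rule power_mult_rearrange) simp
            then show ?thesis unfolding C1_def using c R by (simp add: power_divide)
          qed
          also have "\<dots> \<le> C * measure lebesgue S * (\<rho> / R) powr s"
          proof (intro mult_mono)
            have "(\<rho> / R) ^ CARD('n) = (\<rho> / R) powr ?d" using \<rho> R by (simp add: powr_realpow)
            also have "\<dots> \<le> (\<rho> / R) powr s" using s \<rho> 2 R by (intro powr_mono') auto
            finally show "(\<rho> / R) ^ CARD('n) \<le> (\<rho> / R) powr s" .
          qed (use C C1 lower c r R \<rho> in auto)
          finally show ?thesis .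
        next
          case 3
          let ?P = "\<Prod>i\<in>UNIV. max \<rho> (a i) * min (\<rho> / r) (a i)"
          have \<rho>1: "\<rho> \<le> 1" using 3(1) R by simp
          \<comment> \<open>A factor \<open>r\<close> is taken out of every minimum; the resulting
            power of \<open>r\<close> is the one in \<open>lower\<close>.\<close>
          have P1: "(\<Prod>i\<in>UNIV. 2 * (K * \<rho> + a i)) * (\<Prod>i\<in>UNIV. 2 * min (K * \<rho>) (r * a i))
            \<le> (8 * K ^ 2 * r) ^ CARD('n) * ?P"
          proof -
            have "(\<Prod>i\<in>UNIV. 2 * (K * \<rho> + a i)) * (\<Prod>i\<in>UNIV. 2 * min (K * \<rho>) (r * a i))
              = (\<Prod>i\<in>UNIV. (2 * (K * \<rho> + a i)) * (2 * min (K * \<rho>) (r * a i)))"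
              by (rule prod.distrib[symmetric])
            also have "\<dots> \<le> (\<Prod>i\<in>UNIV. (8 * K ^ 2 * r) * (max \<rho> (a i) * min (\<rho> / r) (a i)))"
            proof (intro prod_mono conjI)
              fix i
              have "K * \<rho> \<le> K * max \<rho> (a i)" "a i \<le> max \<rho> (a i)" using K by auto
              moreover have "max \<rho> (a i) \<le> K * max \<rho> (a i)" using K \<rho> mult_right_mono[of 1 K "max \<rho> (a i)"] by auto
              ultimately have "K * \<rho> + a i \<le> K * max \<rho> (a i) + K * max \<rho> (a i)" by linarith
              then have f1: "2 * (K * \<rho> + a i) \<le> 4 * K * max \<rho> (a i)" by simp
              have f2: "min (K * \<rho>) (r * a i) \<le> K * r * min (\<rho> / r) (a i)"
              proof (cases "\<rho> / r \<le> a i")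
                case True
                then show ?thesis using r K by (simp add: min_le_iff_disj)
              next
                case False
                have "1 * (r * a i) \<le> K * (r * a i)" using K r a0[of i] by (intro mult_right_mono) auto
                then show ?thesis using False by (simp add: min_le_iff_disj mult_ac)
              qed
              have "(2 * (K * \<rho> + a i)) * (2 * min (K * \<rho>) (r * a i))
                \<le> (4 * K * max \<rho> (a i)) * (2 * (K * r * min (\<rho> / r) (a i)))"
              proof (rule mult_mono[OF f1])
                show "0 \<le> 4 * K * max \<rho> (a i)" using K \<rho> by (simp add: le_max_iff_disj)
                show "0 \<le> 2 * min (K * \<rho>) (r * a i)" using K \<rho> r a0[of i] by simp
              qed (use f2 in simp)
              then show "(2 * (K * \<rho> + a i)) * (2 * min (K * \<rho>) (r * a i))
                \<le> (8 * K ^ 2 * r) * (max \<rho> (a i) * min (\<rho> / r) (a i))"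
                by (simp add: power2_eq_square mult_ac)
              show "0 \<le> (2 * (K * \<rho> + a i)) * (2 * min (K * \<rho>) (r * a i))"
                using K \<rho> r a0[of i] by simp
            qed
            also have "\<dots> = (8 * K ^ 2 * r) ^ CARD('n) * ?P" by (simp add: prod.distrib)
            finally show ?thesis .
          qed
          \<comment> \<open>The surplus \<open>\<rho> powr (h - s)\<close> is at most
            \<open>exp (- 2 * n * \<theta>)\<close>. Half of it cancels the loss
            \<open>exp (n * \<theta>)\<close>, the other half is kept against
            \<open>C3 / R ^ d\<close>.\<close>
          have P2: "exp (real n * (\<Sum>i\<in>UNIV. l i)) * ?P \<le> exp (real n * \<theta>) * exp (- (real n * (2 * \<theta>))) * \<rho> powr s"
          proof -
            have "exp (real n * (\<Sum>i\<in>UNIV. l i)) * ?P \<le> exp (real n * (3 * ?d * e)) * \<rho> powr h"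
              unfolding a_def by (rule exponent_product_bound[OF l_pos \<alpha> spread h h0 e(1) n rlow \<rho> \<rho>1])
            also have "\<dots> \<le> exp (real n * \<theta>) * \<rho> powr h"
              using e(3) by (intro mult_right_mono) (auto intro!: mult_left_mono)
            also have "\<rho> powr h = \<rho> powr (h - s) * \<rho> powr s" by (simp add: powr_add[symmetric])
            also have "exp (real n * \<theta>) * (\<rho> powr (h - s) * \<rho> powr s)
              \<le> exp (real n * \<theta>) * (exp (- (real n * (2 * \<theta>))) * \<rho> powr s)"
            proof (intro mult_left_mono mult_right_mono)
              have "\<rho> powr (h - s) \<le> exp (- (real n * (l k0 / 2))) powr (h - s)"
                using 3(2) \<rho> s by (intro powr_mono2) auto
              also have "\<dots> = exp (- (real n * (2 * \<theta>)))"
                by (simp add: powr_def \<theta>_def field_simps)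
              finally show "\<rho> powr (h - s) \<le> exp (- (real n * (2 * \<theta>)))" .
            qed auto
            finally show ?thesis by (simp add: mult_ac)
          qed
          define Z where "Z = (8 * K ^ 2 * r) ^ CARD('n) * 2 ^ CARD('n) / (?\<omega> * \<bar>det G\<bar> ^ 2)"
          have Z0: "Z \<ge> 0" unfolding Z_def using K r \<omega> by simp
          have Pn: "?P \<ge> 0" using \<rho> r a0' by (intro prod_nonneg mult_nonneg_nonneg) (auto simp: le_max_iff_disj)
          have "measure lebesgue (cball x \<rho> \<inter> S) \<le> N * ((\<Prod>i\<in>UNIV. 2 * min (K * \<rho>) (r * a i)) / \<bar>det G\<bar>)"
            using ST up(2) unfolding N_def by linarith
          also have "\<dots> = ((\<Prod>i\<in>UNIV. 2 * (K * \<rho> + a i)) * (\<Prod>i\<in>UNIV. 2 * min (K * \<rho>) (r * a i)))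
              * (2 ^ CARD('n) / (?\<omega> * \<bar>det G\<bar> ^ 2) * \<bar>det (M n)\<bar>)"
            unfolding N_def by (rule box_count_cancel)
          also have "\<dots> \<le> ((8 * K ^ 2 * r) ^ CARD('n) * ?P) * (2 ^ CARD('n) / (?\<omega> * \<bar>det G\<bar> ^ 2) * \<bar>det (M n)\<bar>)"
            using P1 \<omega> by (intro mult_right_mono) auto
          also have "\<dots> = Z * ?P * \<bar>det (M n)\<bar>" by (simp add: Z_def)
          also have "\<dots> \<le> Z * ?P * (2 ^ CARD('n) * exp (real n * (\<Sum>i\<in>UNIV. l i)))"
            using Z0 Pn by (intro mult_left_mono det_M_le) auto
          also have "\<dots> = Z * 2 ^ CARD('n) * (exp (real n * (\<Sum>i\<in>UNIV. l i)) * ?P)" by simp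
          also have "\<dots> \<le> Z * 2 ^ CARD('n) * (exp (real n * \<theta>) * exp (- (real n * (2 * \<theta>))) * \<rho> powr s)"
            using Z0 by (intro mult_left_mono[OF P2]) auto
          also have "\<dots> = (C3 / R ^ CARD('n) * exp (- (real n * \<theta>))) * (c * r ^ CARD('n) * R ^ CARD('n)) * \<rho> powr s"
          proof -
            have "exp (real n * \<theta>) * exp (- (real n * (2 * \<theta>))) = exp (- (real n * \<theta>))"
              by (subst exp_add[symmetric]) (simp add: algebra_simps)
            moreover have "Z = C3 * c / 2 ^ CARD('n) * r ^ CARD('n)"
            proof -
              have "(8 * K ^ 2 * r) ^ CARD('n) * 2 ^ CARD('n) = (16 * K ^ 2) ^ CARD('n) * r ^ CARD('n)"
                by (rule power_mult_rearrange) simp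
              then show ?thesis unfolding Z_def C3_def using c by simp
            qed
            ultimately show ?thesis using R by simp
          qed
          also have "\<dots> \<le> 1 * measure lebesgue S * (\<rho> / R) powr s"
          proof (intro mult_mono)
            have "C3 / R ^ CARD('n) \<le> exp (real n * \<theta>)" using * by simp
            then have "C3 / R ^ CARD('n) * exp (- (real n * \<theta>)) \<le> exp (real n * \<theta>) * exp (- (real n * \<theta>))"
              by (rule mult_right_mono) simp
            then show "C3 / R ^ CARD('n) * exp (- (real n * \<theta>)) \<le> 1"
              by (simp add: exp_minus_inverse)
            show "\<rho> powr s \<le> (\<rho> / R) powr s"
              using \<rho> R s by (intro powr_mono2) (auto simp: field_simps)
          qed (use lower c r R in auto)
          also have "\<dots> \<le> C * measure lebesgue S * (\<rho> / R) powr s"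
            using C by (intro mult_right_mono) auto
          finally show ?thesis .
        qed
      qed
      show "evenly_spread (ball x0 R \<inter> {z. \<exists>y\<in>int_vecs. norm (M n *v z - y) < \<psi> n / 2}) C R s"
        using Spos upper unfolding evenly_spread_def S_def r_def by blast
    qed
  qed
qed

end

section \<open>Points avoiding a cheap cover\<close>

text \<open>Localised cost of a cover by balls: its sum over \<open>i\<close> is the quantity that
  the iteration keeps below \<open>c * R powr s\<close>.\<close>

definition hit_gauge :: "real \<Rightarrow> (nat \<Rightarrow> 'a::metric_space) \<Rightarrow> (nat \<Rightarrow> real) \<Rightarrow> 'a set \<Rightarrow> nat \<Rightarrow> real" where
  "hit_gauge s p \<rho> K i = (if cball (p i) (\<rho> i) \<inter> K \<noteq> {} then \<rho> i powr s else 0)"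

lemma term_le_suminf_ennreal: "f i \<le> (\<Sum>i. f i)" for f :: "nat \<Rightarrow> ennreal"
  using sum_le_suminf[of f "{i}"] by simp

lemma powr_less_cancel_base:
  fixes x y s :: real
  assumes "x powr s < y powr s" "0 < s" "0 < y"
  shows "x < y"
proof (rule ccontr)
  assume "\<not> x < y"
  then have "y powr s \<le> x powr s" using assms by (intro powr_mono2) auto
  then show False using assms(1) by simp
qed

text \<open>The weight is chosen such that a total weight below 1 around \<open>z\<close> means that the radii of the
  balls meeting \<open>cball z \<kappa>\<close> satisfy the smallness condition at scale \<open>\<kappa>\<close>.\<close>

lemma weighted_radius_bound:
  fixes s s' c \<kappa> R \<rho> :: real
  assumes s: "0 < s" "s < s'" and c: "0 < c" and \<kappa>: "0 < \<kappa>" "(\<kappa> / R) powr (s' - s) \<le> c"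
    and R: "0 < R" and \<rho>: "0 < \<rho>" "\<rho> \<le> R"
  shows "min 1 (\<rho> powr s / (c * \<kappa> powr s)) * ((\<rho> + \<kappa>) / (R / 2)) powr s' \<le> 4 powr s' * (\<rho> / R) powr s"
\<comment> \<open>If \<open>\<kappa> \<le> \<rho>\<close> the weight is at most 1 and the enlarged
  radius at most \<open>2 * \<rho>\<close>. Otherwise the other term of the minimum is used, and
  \<open>(\<kappa> / R) powr (s' - s)\<close> compensates the division by \<open>c\<close>.\<close>
proof (cases "\<kappa> \<le> \<rho>")
  case True
  have "min 1 (\<rho> powr s / (c * \<kappa> powr s)) * ((\<rho> + \<kappa>) / (R / 2)) powr s' \<le> 1 * ((\<rho> + \<kappa>) / (R / 2)) powr s'"
    by (intro mult_right_mono) auto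
  also have "\<dots> \<le> (4 * (\<rho> / R)) powr s'"
    unfolding mult_1 using True R \<rho> \<kappa> s by (intro powr_mono2) (auto simp: field_simps)
  also have "\<dots> = 4 powr s' * (\<rho> / R) powr s'" by (rule powr_mult)
  also have "\<dots> \<le> 4 powr s' * (\<rho> / R) powr s"
    using \<rho> R s by (intro mult_left_mono powr_mono') auto
  finally show ?thesis .
next
  case False
  have "min 1 (\<rho> powr s / (c * \<kappa> powr s)) * ((\<rho> + \<kappa>) / (R / 2)) powr s'
    \<le> (\<rho> powr s / (c * \<kappa> powr s)) * (4 * (\<kappa> / R)) powr s'"
  proof (intro mult_mono)
    show "((\<rho> + \<kappa>) / (R / 2)) powr s' \<le> (4 * (\<kappa> / R)) powr s'"
      using False R \<rho> \<kappa> s by (intro powr_mono2) (auto simp: field_simps)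
  qed (use c in auto)
  also have "(4 * (\<kappa> / R)) powr s' = 4 powr s' * ((\<kappa> / R) powr (s' - s) * (\<kappa> / R) powr s)"
    using \<kappa> R by (subst powr_mult) (auto simp: powr_add[symmetric])
  also have "(\<rho> powr s / (c * \<kappa> powr s)) * (4 powr s' * ((\<kappa> / R) powr (s' - s) * (\<kappa> / R) powr s))
    = ((\<kappa> / R) powr (s' - s) / c) * (4 powr s' * (\<rho> / R) powr s)"
    unfolding powr_divide[of \<kappa> R s] powr_divide[of \<rho> R s] using \<kappa>(1) c by simp
  also have "\<dots> \<le> 1 * (4 powr s' * (\<rho> / R) powr s)"
    using \<kappa> c by (intro mult_right_mono) (auto simp: pos_divide_le_eq)
  finally show ?thesis by simp
qed

text \<open>Averaging: \<open>F z\<close> is the weighted number of cover balls meeting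
  \<open>cball z \<kappa>\<close>. Its integral over \<open>S\<close> is less than the measure of
  \<open>S\<close>, by the spread of \<open>S\<close> and the value of \<open>c\<close>, so
  \<open>F z < 1\<close> for some \<open>z\<close> in \<open>S\<close>.\<close>

lemma ball_avoiding_covers:
  fixes p :: "nat \<Rightarrow> real ^ 'n" and \<rho> :: "nat \<Rightarrow> real" and S :: "(real ^ 'n) set" and C R \<kappa> c s s' :: real
  assumes S: "S \<in> lmeasurable" "measure lebesgue S > 0"
    and ratio: "\<And>x \<rho>. \<rho> > 0 \<Longrightarrow> measure lebesgue (cball x \<rho> \<inter> S) \<le> C * measure lebesgue S * (\<rho> / (R / 2)) powr s'"
    and C: "C > 0" and s: "0 < s" "s < s'" and c: "c = 1 / (C * 4 powr s')" "c \<le> 1"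
    and \<kappa>: "0 < \<kappa>" "(\<kappa> / R) powr (s' - s) \<le> c" and R: "0 < R"
    and \<rho>: "\<And>i. \<rho> i > 0" and hit: "(\<Sum>i. ennreal (hit_gauge s p \<rho> (cball x0 R) i)) < ennreal (c * R powr s)"
    and sub: "\<And>z. z \<in> S \<Longrightarrow> cball z \<kappa> \<subseteq> cball x0 R"
  obtains z where "z \<in> S" "(\<Sum>i. ennreal (hit_gauge s p \<rho> (cball z \<kappa>) i)) < ennreal (c * \<kappa> powr s)"
proof -
  let ?t = "hit_gauge s p \<rho> (cball x0 R)"
  let ?B = "\<lambda>i. cball (p i) (\<rho> i + \<kappa>)"
  have c0: "c > 0" using C c by simp
  have t0: "?t i \<ge> 0" for i by (simp add: hit_gauge_def)
  obtain T where T: "(\<Sum>i. ennreal (?t i)) = ennreal T" "T \<ge> 0" "T < c * R powr s"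
    using hit by (cases "\<Sum>i. ennreal (?t i)") (auto simp: ennreal_less_iff)
  \<comment> \<open>The weight is the cost in units of the budget
    \<open>c * \<kappa> powr s\<close>, cut off at 1. A single ball of weight 1 rules out
    \<open>F z < 1\<close>, so for the balls that are met the cut-off is inactive and the sum of
    weights is the true relative cost.\<close>
  define v where "v i = min 1 (?t i / (c * \<kappa> powr s))" for i
  have v0: "v i \<ge> 0" for i using t0 c0 by (simp add: v_def)
  define F where "F z = (\<Sum>i. ennreal (v i) * indicator (?B i) z)" for z
  have vb: "v i * measure lebesgue (?B i \<inter> S) \<le> C * 4 powr s' * measure lebesgue S / R powr s * ?t i" for i
  proof (cases "cball (p i) (\<rho> i) \<inter> cball x0 R = {}")
    case True
    then show ?thesis by (simp add: v_def hit_gauge_def)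
  next
    case False
    then have t: "?t i = \<rho> i powr s" by (simp add: hit_gauge_def)
    have "ennreal (?t i) \<le> (\<Sum>i. ennreal (?t i))"
      by (rule term_le_suminf_ennreal)
    then have "?t i \<le> T" unfolding T(1) using T(2) by simp
    also have "T < c * R powr s" by (rule T)
    also have "\<dots> \<le> R powr s" using c(2) by (simp add: mult_left_le_one_le c0 less_imp_le)
    finally have "\<rho> i < R" unfolding t by (rule powr_less_cancel_base[OF _ s(1) R])
    have "v i * measure lebesgue (?B i \<inter> S) \<le> v i * (C * measure lebesgue S * ((\<rho> i + \<kappa>) / (R / 2)) powr s')"
      using ratio[of "\<rho> i + \<kappa>" "p i"] \<rho>[of i] \<kappa> v0 by (intro mult_left_mono) auto
    also have "\<dots> = C * measure lebesgue S * (v i * ((\<rho> i + \<kappa>) / (R / 2)) powr s')" by simp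
    also have "\<dots> \<le> C * measure lebesgue S * (4 powr s' * (\<rho> i / R) powr s)"
      unfolding v_def t using weighted_radius_bound[OF s c0 \<kappa> R \<rho>] \<open>\<rho> i < R\<close> C
      by (intro mult_left_mono) auto
    also have "\<dots> = C * 4 powr s' * measure lebesgue S / R powr s * ?t i"
      using R \<rho>[of i] by (simp add: t powr_divide)
    finally show ?thesis .
  qed
  have "\<exists>z\<in>S. F z < 1"
  proof (rule ccontr)
    assume "\<not> (\<exists>z\<in>S. F z < 1)"
    then have ge: "F z \<ge> 1" if "z \<in> S" for z using that by (auto simp: not_less)
    have meas: "?B i \<inter> S \<in> lmeasurable" for i
      using S(1) by (intro fmeasurable_Int_fmeasurable) auto
    have "ennreal (measure lebesgue S) = emeasure lebesgue S"
      using S(1) by (simp add: emeasure_eq_measure2)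
    also have "\<dots> = (\<integral>\<^sup>+z. indicator S z \<partial>lebesgue)" using S(1) by (simp add: fmeasurableD)
    also have "\<dots> \<le> (\<integral>\<^sup>+z. (\<Sum>i. ennreal (v i) * indicator (?B i \<inter> S) z) \<partial>lebesgue)"
    proof (rule nn_integral_mono)
      fix z :: "real ^ 'n"
      show "indicator S z \<le> (\<Sum>i. ennreal (v i) * indicator (?B i \<inter> S) z)"
        using ge[of z] by (cases "z \<in> S") (auto simp: F_def indicator_inter_arith)
    qed
    also have "\<dots> = (\<Sum>i. \<integral>\<^sup>+z. ennreal (v i) * indicator (?B i \<inter> S) z \<partial>lebesgue)"
      using meas by (intro nn_integral_suminf borel_measurable_times borel_measurable_const borel_measurable_indicator)
        (auto intro: fmeasurableD)
    also have "\<dots> = (\<Sum>i. ennreal (v i * measure lebesgue (?B i \<inter> S)))"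
      using meas v0 by (simp add: nn_integral_cmult_indicator fmeasurableD emeasure_eq_measure2 ennreal_mult)
    also have "\<dots> \<le> (\<Sum>i. ennreal (C * 4 powr s' * measure lebesgue S / R powr s * ?t i))"
      by (intro suminf_le ennreal_leI vb) auto
    also have "\<dots> = ennreal (C * 4 powr s' * measure lebesgue S / R powr s) * (\<Sum>i. ennreal (?t i))"
      unfolding ennreal_mult''[OF t0] by (rule ennreal_suminf_cmult)
    also have "\<dots> = ennreal (C * 4 powr s' * measure lebesgue S / R powr s * T)"
      unfolding T(1) by (rule ennreal_mult''[OF T(2), symmetric])
    also have "\<dots> < ennreal (measure lebesgue S)"
    proof (rule ennreal_lessI[OF S(2)])
      have "C * 4 powr s' * measure lebesgue S / R powr s * T < C * 4 powr s' * measure lebesgue S / R powr s * (c * R powr s)"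
        using C S(2) R T(3) by (intro mult_strict_left_mono) auto
      also have "\<dots> = measure lebesgue S" using C R by (simp add: c)
      finally show "C * 4 powr s' * measure lebesgue S / R powr s * T < measure lebesgue S" .
    qed
    finally show False by simp
  qed
  then obtain z where z: "z \<in> S" "F z < 1" by blast
  let ?q = "c * \<kappa> powr s"
  have q: "?q > 0" using c0 \<kappa> by simp
  have le: "ennreal (hit_gauge s p \<rho> (cball z \<kappa>) i) \<le> ennreal ?q * (ennreal (v i) * indicator (?B i) z)" for i
  proof (cases "cball (p i) (\<rho> i) \<inter> cball z \<kappa> = {}")
    case False
    then obtain w where w: "dist (p i) w \<le> \<rho> i" "dist z w \<le> \<kappa>" by auto
    then have "dist (p i) z \<le> \<rho> i + \<kappa>" using dist_triangle2[of "p i" z w] by linarith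
    then have zB: "z \<in> ?B i" by simp
    have "w \<in> cball (p i) (\<rho> i) \<inter> cball x0 R" using w sub[OF z(1)] by auto
    then have t: "?t i = \<rho> i powr s" by (auto simp: hit_gauge_def)
    have "ennreal (v i) * indicator (?B i) z \<le> F z"
      unfolding F_def by (rule term_le_suminf_ennreal[of "\<lambda>i. ennreal (v i) * indicator (?B i) z"])
    then have "ennreal (v i) \<le> F z" using zB by simp
    then have "ennreal (v i) < 1" using z(2) by (rule order.strict_trans1)
    then have "v i < 1" using v0 by (simp add: ennreal_less_one_iff)
    then have "v i = \<rho> i powr s / ?q" unfolding v_def t by (auto simp: min_def split: if_splits)
    then have "v i * ?q = \<rho> i powr s" using q by (metis less_irrefl nonzero_eq_divide_eq)
    then have "ennreal (\<rho> i powr s) = ennreal ?q * ennreal (v i)"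
      using v0 q by (metis ennreal_mult'' mult.commute)
    then show ?thesis using zB by (simp add: hit_gauge_def)
  qed (simp add: hit_gauge_def)
  have "(\<Sum>i. ennreal (hit_gauge s p \<rho> (cball z \<kappa>) i)) \<le> (\<Sum>i. ennreal ?q * (ennreal (v i) * indicator (?B i) z))"
    by (intro suminf_le le) auto
  also have "\<dots> = ennreal ?q * F z" by (simp add: F_def)
  also have "\<dots> < ennreal ?q"
  proof -
    obtain f where f: "F z = ennreal f" "0 \<le> f" "f < 1"
      using z(2) by (cases "F z") (auto simp: ennreal_less_one_iff)
    have "?q * f < ?q" using mult_strict_left_mono[OF f(3) q] by simp
    then show ?thesis unfolding f(1) using q f by (simp add: ennreal_mult''[symmetric] ennreal_less_iff)
  qed
  finally show thesis using z(1) that by blast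
qed

context expanding_sequence
begin

text \<open>The centre comes from the set with threshold \<open>\<psi> n / 2\<close> inside the ball
  of half the radius; both halvings leave room for the new ball.\<close>

lemma avoid_covers_step:
  assumes ratio: "\<And>x0 R. 0 < R \<Longrightarrow> R \<le> 1 \<Longrightarrow> \<exists>\<^sub>F n in sequentially.
    evenly_spread (ball x0 R \<inter> {z. \<exists>y\<in>int_vecs. norm (M n *v z - y) < \<psi> n / 2}) C R s'"
    and C: "C > 0" and s: "0 < s" "s < s'" and c: "c = 1 / (C * 4 powr s')" "c \<le> 1"
    and psi_pos: "\<And>n. n \<ge> 1 \<Longrightarrow> \<psi> n > 0"
    and R: "0 < R" "R \<le> 1" and \<rho>: "\<And>i. \<rho> i > 0"
    and hit: "(\<Sum>i. ennreal (hit_gauge s p \<rho> (cball x0 R) i)) < ennreal (c * R powr s)"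
  obtains n x1 \<kappa> where "n > m" "0 < \<kappa>" "\<kappa> \<le> R / 2" "cball x1 \<kappa> \<subseteq> cball x0 R"
    "cball x1 \<kappa> \<subseteq> {z. \<exists>y\<in>int_vecs. norm (M n *v z - y) < \<psi> n}"
    "(\<Sum>i. ennreal (hit_gauge s p \<rho> (cball x1 \<kappa>) i)) < ennreal (c * \<kappa> powr s)"
proof -
  have "0 < R / 2" "R / 2 \<le> 1" using R by auto
  from ratio[OF this, of x0] obtain n where n: "n \<ge> Suc m" and
    nS: "evenly_spread (ball x0 (R / 2) \<inter> {z. \<exists>y\<in>int_vecs. norm (M n *v z - y) < \<psi> n / 2}) C (R / 2) s'"
    unfolding frequently_sequentially by blast
  define S where "S = ball x0 (R / 2) \<inter> {z. \<exists>y\<in>int_vecs. norm (M n *v z - y) < \<psi> n / 2}"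
  have S: "measure lebesgue S > 0"
    "\<And>x \<rho>. \<rho> > 0 \<Longrightarrow> measure lebesgue (cball x \<rho> \<inter> S) \<le> C * measure lebesgue S * (\<rho> / (R / 2)) powr s'"
    using nS unfolding evenly_spread_def S_def[symmetric] by blast+
  have Sm: "S \<in> lmeasurable"
    unfolding S_def by (rule lmeasurable_Int_near_int) simp
  obtain K where K: "K > 0" "\<And>z. norm (M n *v z) \<le> norm z * K"
    using bounded_linear.pos_bounded[OF matrix_vector_mul_bounded_linear[of "M n"]] by blast
  have pn: "\<psi> n > 0" using n psi_pos by simp
  have c0: "c > 0" using C c by simp
  \<comment> \<open>In this order the bounds keep the new ball inside the old one, make
    \<open>M n\<close> move its points by at most \<open>\<psi> n / 2\<close>, and meet the scale
    condition of \<open>ball_avoiding_covers\<close>.\<close>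
  define \<kappa> where "\<kappa> = Min {R / 2, \<psi> n / (2 * K), R * c powr (1 / (s' - s))}"
  have \<kappa>: "\<kappa> > 0" "\<kappa> \<le> R / 2" "\<kappa> \<le> \<psi> n / (2 * K)" "\<kappa> \<le> R * c powr (1 / (s' - s))"
    unfolding \<kappa>_def using R pn K c0 by auto
  have \<kappa>c: "(\<kappa> / R) powr (s' - s) \<le> c"
  proof -
    have "(\<kappa> / R) powr (s' - s) \<le> (c powr (1 / (s' - s))) powr (s' - s)"
      using \<kappa> R s by (intro powr_mono2) (auto simp: field_simps)
    then show ?thesis using s c0 by (simp add: powr_powr)
  qed
  have sub: "cball z \<kappa> \<subseteq> cball x0 R" if "z \<in> S" for z
  proof
    fix w assume "w \<in> cball z \<kappa>"
    then show "w \<in> cball x0 R" using that \<kappa>(2) dist_triangle[of x0 w z] by (auto simp: S_def)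
  qed
  obtain z where z: "z \<in> S" "(\<Sum>i. ennreal (hit_gauge s p \<rho> (cball z \<kappa>) i)) < ennreal (c * \<kappa> powr s)"
    by (rule ball_avoiding_covers[OF Sm S C s c \<kappa>(1) \<kappa>c R(1) \<rho> hit sub])
  show thesis
  proof (rule that[OF _ \<kappa>(1,2) sub[OF z(1)] _ z(2)])
    show "n > m" using n by simp
    obtain y where y: "y \<in> int_vecs" "norm (M n *v z - y) < \<psi> n / 2" using z(1) by (auto simp: S_def)
    show "cball z \<kappa> \<subseteq> {z. \<exists>y\<in>int_vecs. norm (M n *v z - y) < \<psi> n}"
    proof safe
      fix w assume "w \<in> cball z \<kappa>"
      then have "norm (w - z) \<le> \<psi> n / (2 * K)" using \<kappa>(3) by (simp add: dist_norm norm_minus_commute)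
      then have "norm (w - z) * K \<le> \<psi> n / 2" using K(1) by (simp add: field_simps)
      then have "norm (M n *v (w - z)) \<le> \<psi> n / 2" using K(2)[of "w - z"] by linarith
      moreover have eq: "M n *v w - y = M n *v (w - z) + (M n *v z - y)"
        by (simp add: matrix_vector_mult_diff_distrib)
      ultimately have "norm (M n *v w - y) < \<psi> n"
        unfolding eq using norm_triangle_ineq[of "M n *v (w - z)" "M n *v z - y"] y(2) by linarith
      then show "\<exists>y\<in>int_vecs. norm (M n *v w - y) < \<psi> n" using y(1) by blast
    qed
  qed
qed

text \<open>Nested balls shrink to a point \<open>z\<close>. A cover ball containing
  \<open>z\<close> would meet all of them, and its cost would be below every budget; its radius
  would be smaller than every \<open>\<kappa> k\<close>, although it is positive.\<close>

lemma limsup_set_not_covered: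
  assumes ratio: "\<And>x0 R. 0 < R \<Longrightarrow> R \<le> 1 \<Longrightarrow> \<exists>\<^sub>F n in sequentially.
    evenly_spread (ball x0 R \<inter> {z. \<exists>y\<in>int_vecs. norm (M n *v z - y) < \<psi> n / 2}) C R s'"
    and C: "C > 0" and s: "0 < s" "s < s'" and c: "c = 1 / (C * 4 powr s')" "c \<le> 1"
    and psi_pos: "\<And>n. n \<ge> 1 \<Longrightarrow> \<psi> n > 0"
    and R: "0 < R" "R \<le> 1" and \<rho>: "\<And>i. \<rho> i > 0"
    and hit: "(\<Sum>i. ennreal (\<rho> i powr s)) < ennreal (c * R powr s)"
  shows "\<exists>z\<in>cball x0 R. (\<forall>i. z \<notin> cball (p i) (\<rho> i)) \<and>
    infinite {n. n \<ge> 1 \<and> (\<exists>y\<in>int_vecs. norm (M n *v z - y) < \<psi> n)}"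
proof -
  define P where "P k w \<longleftrightarrow> (case w of (x, \<kappa>, n) \<Rightarrow> 0 < \<kappa> \<and> \<kappa> \<le> R / 2 ^ k \<and> k \<le> n \<and> cball x \<kappa> \<subseteq> cball x0 R \<and>
    (\<Sum>i. ennreal (hit_gauge s p \<rho> (cball x \<kappa>) i)) < ennreal (c * \<kappa> powr s))"
    for k :: nat and w :: "(real ^ 'n) \<times> real \<times> nat"
  define Q where "Q k w w' \<longleftrightarrow> (case w of (x, \<kappa>, n) \<Rightarrow> case w' of (x', \<kappa>', n') \<Rightarrow> n < n' \<and> cball x' \<kappa>' \<subseteq> cball x \<kappa> \<and>
    cball x' \<kappa>' \<subseteq> {z. \<exists>y\<in>int_vecs. norm (M n' *v z - y) < \<psi> n'})"
    for k :: nat and w w' :: "(real ^ 'n) \<times> real \<times> nat"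
  have "\<exists>f. \<forall>k. P k (f k) \<and> Q k (f k) (f (Suc k))"
  proof (rule dependent_nat_choice)
    have "(\<Sum>i. ennreal (hit_gauge s p \<rho> (cball x0 R) i)) \<le> (\<Sum>i. ennreal (\<rho> i powr s))"
      by (intro suminf_le) (auto simp: hit_gauge_def)
    \<comment> \<open>The starting time 0 is a dummy: a recurrence condition is imposed by
      \<open>Q\<close> on successors only, at strictly increasing times.\<close>
    then show "\<exists>w. P 0 w" using hit R by (intro exI[of _ "(x0, R, 0)"]) (auto simp: P_def)
  next
    fix w k assume "P k w"
    then obtain x \<kappa> n where w: "w = (x, \<kappa>, n)" and \<kappa>: "0 < \<kappa>" "\<kappa> \<le> R / 2 ^ k" and k: "k \<le> n"
      and sub: "cball x \<kappa> \<subseteq> cball x0 R"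
      and hit': "(\<Sum>i. ennreal (hit_gauge s p \<rho> (cball x \<kappa>) i)) < ennreal (c * \<kappa> powr s)"
      by (auto simp: P_def split: prod.splits)
    have "R / 2 ^ k \<le> R / 1" using R by (intro divide_left_mono) auto
    then have "\<kappa> \<le> 1" using \<kappa> R by linarith
    obtain n' x' \<kappa>' where *: "n' > n" "0 < \<kappa>'" "\<kappa>' \<le> \<kappa> / 2" "cball x' \<kappa>' \<subseteq> cball x \<kappa>"
      "cball x' \<kappa>' \<subseteq> {z. \<exists>y\<in>int_vecs. norm (M n' *v z - y) < \<psi> n'}"
      "(\<Sum>i. ennreal (hit_gauge s p \<rho> (cball x' \<kappa>') i)) < ennreal (c * \<kappa>' powr s)"
      by (rule avoid_covers_step[OF ratio C s c psi_pos \<kappa>(1) \<open>\<kappa> \<le> 1\<close> \<rho> hit'])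
    have "\<kappa>' \<le> R / 2 ^ Suc k" using *(3) \<kappa> by simp
    then show "\<exists>w'. P (Suc k) w' \<and> Q k w w'"
      using * k sub by (intro exI[of _ "(x', \<kappa>', n')"]) (auto simp: P_def Q_def w)
  qed
  then obtain f where f: "\<And>k. P k (f k)" "\<And>k. Q k (f k) (f (Suc k))" by blast
  define x \<kappa> n where "x k = fst (f k)" and "\<kappa> k = fst (snd (f k))" and "n k = snd (snd (f k))" for k
  have fk: "f k = (x k, \<kappa> k, n k)" for k by (simp add: x_def \<kappa>_def n_def)
  have Pk: "0 < \<kappa> k" "\<kappa> k \<le> R / 2 ^ k" "cball (x k) (\<kappa> k) \<subseteq> cball x0 R"
    "(\<Sum>i. ennreal (hit_gauge s p \<rho> (cball (x k) (\<kappa> k)) i)) < ennreal (c * \<kappa> k powr s)" for k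
    using f(1)[of k] by (auto simp: P_def fk)
  have Qk: "n k < n (Suc k)" "cball (x (Suc k)) (\<kappa> (Suc k)) \<subseteq> cball (x k) (\<kappa> k)"
    "cball (x (Suc k)) (\<kappa> (Suc k)) \<subseteq> {z. \<exists>y\<in>int_vecs. norm (M (n (Suc k)) *v z - y) < \<psi> (n (Suc k))}" for k
    using f(2)[of k] by (auto simp: Q_def fk)
  have "\<Inter>(range (\<lambda>k. cball (x k) (\<kappa> k))) \<noteq> {}"
  proof (rule compact_nest)
    show "compact (cball (x k) (\<kappa> k))" "cball (x k) (\<kappa> k) \<noteq> {}" for k
      using Pk(1)[of k] by simp_all
    show "cball (x k) (\<kappa> k) \<subseteq> cball (x j) (\<kappa> j)" if "j \<le> k" for j k
      by (rule lift_Suc_antimono_le[of "\<lambda>k. cball (x k) (\<kappa> k)", OF Qk(2) that])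
  qed
  then obtain z where "z \<in> \<Inter>(range (\<lambda>k. cball (x k) (\<kappa> k)))" by blast
  then have z: "z \<in> cball (x k) (\<kappa> k)" for k by blast
  show ?thesis
  proof (intro bexI[of _ z] conjI allI)
    show "z \<in> cball x0 R" using z[of 0] Pk(3)[of 0] by blast
    have sm: "strict_mono n" using Qk(1) by (rule strict_monoI_Suc)
    have "range (\<lambda>k. n (Suc k)) \<subseteq> {n. n \<ge> 1 \<and> (\<exists>y\<in>int_vecs. norm (M n *v z - y) < \<psi> n)}"
    proof safe
      fix k
      show "n (Suc k) \<ge> 1" using Qk(1)[of k] by simp
      show "\<exists>y\<in>int_vecs. norm (M (n (Suc k)) *v z - y) < \<psi> (n (Suc k))" using z[of "Suc k"] Qk(3)[of k] by blast
    qed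
    moreover have "infinite (range (\<lambda>k. n (Suc k)))"
      by (rule range_inj_infinite) (use strict_mono_eq[OF sm] in \<open>auto simp: inj_on_def\<close>)
    ultimately show "infinite {n. n \<ge> 1 \<and> (\<exists>y\<in>int_vecs. norm (M n *v z - y) < \<psi> n)}"
      using finite_subset by blast
    fix i
    show "z \<notin> cball (p i) (\<rho> i)"
    proof
      assume zi: "z \<in> cball (p i) (\<rho> i)"
      have "\<rho> i < \<kappa> k" for k
      proof -
        have ne: "cball (p i) (\<rho> i) \<inter> cball (x k) (\<kappa> k) \<noteq> {}" using zi z[of k] by blast
        have "ennreal (hit_gauge s p \<rho> (cball (x k) (\<kappa> k)) i) \<le> (\<Sum>i. ennreal (hit_gauge s p \<rho> (cball (x k) (\<kappa> k)) i))"
          by (rule term_le_suminf_ennreal)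
        also have "\<dots> < ennreal (c * \<kappa> k powr s)" by (rule Pk)
        finally have "\<rho> i powr s < c * \<kappa> k powr s" using ne by (simp add: hit_gauge_def ennreal_less_iff)
        also have "\<dots> \<le> 1 * \<kappa> k powr s" using c(2) by (intro mult_right_mono) auto
        finally show ?thesis using powr_less_cancel_base[OF _ s(1) Pk(1)] by simp
      qed
      moreover obtain k where "R / 2 ^ k < \<rho> i"
      proof -
        obtain k where "(1 / 2) ^ k < \<rho> i / R" using real_arch_pow_inv[of "\<rho> i / R" "1 / 2"] \<rho>[of i] R by auto
        then show thesis using R by (intro that[of k]) (simp add: field_simps)
      qed
      ultimately show False using Pk(2)[of k] by (meson order.asym order.strict_trans2)
    qed
  qed
qed

end

section \<open>The torus and the lower bound\<close>

text \<open>A common integer translation of both lifts does not change their distance, so one lift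
  can be fixed and the other moved by lattice vectors. With a strict inequality the infimum need not
  be attained.\<close>

lemma dist_torus_less_iff:
  "dist (torus_of x) (torus_of y) < r \<longleftrightarrow> (\<exists>z\<in>int_vecs. norm (y - x - z) < r)"
proof -
  let ?D = "{dist u v | u v. torus_of u = torus_of x \<and> torus_of v = torus_of y}"
  have ne: "?D \<noteq> {}" and bdd: "bdd_below ?D" by (auto intro!: bdd_belowI[of _ 0])
  have "dist (torus_of x) (torus_of y) < r \<longleftrightarrow>
    (\<exists>u v. torus_of u = torus_of x \<and> torus_of v = torus_of y \<and> dist u v < r)"
    unfolding dist_torus_def cInf_less_iff[OF ne bdd] by blast
  also have "\<dots> \<longleftrightarrow> (\<exists>z\<in>int_vecs. norm (y - x - z) < r)"
  proof safe
    fix u v assume uv: "torus_of u = torus_of x" "torus_of v = torus_of y" "dist u v < r"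
    have "(y - x) - (v - u) \<in> int_vecs"
      unfolding int_vecs_def
    proof (intro CollectI allI)
      fix i
      have "u $ i - x $ i \<in> \<int>" "v $ i - y $ i \<in> \<int>" using uv torus_of_eq_iff by blast+
      then have "(u $ i - x $ i) - (v $ i - y $ i) \<in> \<int>" by (rule Ints_diff)
      then show "((y - x) - (v - u)) $ i \<in> \<int>" by (simp add: algebra_simps)
    qed
    then show "\<exists>z\<in>int_vecs. norm (y - x - z) < r"
      using uv(3) by (intro bexI[where x = "(y - x) - (v - u)"]) (simp_all add: dist_norm norm_minus_commute)
  next
    fix z assume z: "z \<in> int_vecs" "norm (y - x - z) < r"
    have "- z $ i \<in> \<int>" for i using z(1) by (auto simp: int_vecs_def)
    then have "torus_of (y - z) = torus_of y" by (simp add: torus_of_eq_iff)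
    moreover have "dist x (y - z) < r"
      using z(2) by (simp add: dist_norm norm_minus_commute[of x] cancel_ab_semigroup_add_class.diff_right_commute[of y z x])
    ultimately show "\<exists>u v. torus_of u = torus_of x \<and> torus_of v = torus_of y \<and> dist u v < r" by blast
  qed
  finally show ?thesis .
qed

lemma dist_torus_le: "dist (torus_of x) (torus_of y) \<le> dist x y"
proof (rule field_le_epsilon)
  fix e :: real assume "e > 0"
  have "dist (torus_of x) (torus_of y) < dist x y + e"
    unfolding dist_torus_less_iff using \<open>e > 0\<close>
    by (intro bexI[of _ 0]) (auto simp: dist_norm norm_minus_commute int_vecs_def)
  then show "dist (torus_of x) (torus_of y) \<le> dist x y + e" by simp
qed

text \<open>Lifts within 1/2 are nearest lifts: a shorter difference would come from a lattice
  vector of norm below 1, hence from 0.\<close>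

lemma dist_le_dist_torus:
  assumes "dist x y \<le> 1 / 2"
  shows "dist x y \<le> dist (torus_of x) (torus_of y)"
proof (rule ccontr)
  assume "\<not> dist x y \<le> dist (torus_of x) (torus_of y)"
  then obtain z where z: "z \<in> int_vecs" "norm (y - x - z) < dist x y"
    unfolding not_le dist_torus_less_iff by blast
  have "norm (z - 0) \<le> norm (y - x) + norm (y - x - z)"
    using norm_triangle_ineq4[of "y - x" "y - x - z"] by simp
  then have "norm (z - 0) < 1" using z(2) assms by (simp add: dist_norm norm_minus_commute)
  moreover have "0 \<in> int_vecs" by (simp add: int_vecs_def)
  ultimately have "z = 0" using int_vecs_dist z(1) by blast
  then show False using z(2) by (simp add: dist_norm norm_minus_commute)
qed

lemma torus_map_funpow:
  "(torus_map A ^^ n) (torus_of x) = torus_of (matpow (map_matrix real_of_int A) n *v x)"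
proof (induction n)
  case (Suc n)
  have "(torus_map A ^^ Suc n) (torus_of x) = torus_map A (torus_of (matpow (map_matrix real_of_int A) n *v x))"
    by (simp add: Suc)
  also have "\<dots> = torus_of (map_matrix real_of_int A *v (matpow (map_matrix real_of_int A) n *v x))"
    by (rule torus_map.abs_eq)
  finally show ?case by (simp add: matrix_vector_mul_assoc)
qed simp

lemma torus_of_mem_recurrence_set:
  "torus_of x \<in> recurrence_set (torus_map A) \<psi> \<longleftrightarrow>
    infinite {n. n \<ge> 1 \<and> (\<exists>y\<in>int_vecs. norm ((matpow (map_matrix real_of_int A) n - mat 1) *v x - y) < \<psi> n)}"
  unfolding recurrence_set_def mem_Collect_eq torus_map_funpow mem_ball dist_torus_less_iff
  by (simp add: matrix_vector_mult_diff_rdistrib)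

section \<open>Positive Hausdorff measure on the torus\<close>

lemma hausdorff_measure_zero_cover:
  fixes \<delta> :: real
  assumes "hausdorff_measure s E = 0" "\<eta> > 0" "\<delta> > 0"
  obtains U where "E \<subseteq> (\<Union>i. U i)" "\<And>i. bounded (U i)" "(\<Sum>i. hausdorff_gauge s (U i)) < \<eta>"
proof -
  have "hausdorff_premeasure s \<delta> E \<le> hausdorff_measure s E"
    unfolding hausdorff_measure_def using assms(3) by (intro SUP_upper) auto
  then have "hausdorff_premeasure s \<delta> E < \<eta>" using assms by simp
  then show thesis unfolding hausdorff_premeasure_def Inf_less_iff using that by blast
qed

text \<open>Disposes of exponent 0, which the averaging argument excludes: there every nonempty set
  has gauge 1.\<close>

lemma hausdorff_measure_0_eq_0:
  assumes "hausdorff_measure 0 E = 0"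
  shows "E = {}"
proof -
  obtain U where U: "E \<subseteq> (\<Union>i. U i)" "(\<Sum>i. hausdorff_gauge 0 (U i)) < 1"
    by (rule hausdorff_measure_zero_cover[OF assms, of 1 1]) auto
  have "U i = {}" for i
  proof (rule ccontr)
    assume "U i \<noteq> {}"
    then have "1 \<le> (\<Sum>i. hausdorff_gauge 0 (U i))"
      using term_le_suminf_ennreal[of "\<lambda>i. hausdorff_gauge 0 (U i)" i] by (simp add: hausdorff_gauge_def)
    then show False using U(2) by simp
  qed
  then show ?thesis using U(1) by auto
qed

context expanding_sequence
begin

text \<open>On the ball of radius 1/8 around 0 the projection is isometric, so a cheap cover of
  \<open>E\<close> restricts to a cheap cover by Euclidean balls of the lifted points there, which
  \<open>limsup_set_not_covered\<close> refutes.\<close>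

lemma hausdorff_measure_torus_nonzero:
  fixes E :: "'n torus set"
  assumes ratio: "\<exists>C\<ge>1. \<forall>x0 R. 0 < R \<longrightarrow> R \<le> 1 \<longrightarrow> (\<exists>\<^sub>F n in sequentially.
    evenly_spread (ball x0 R \<inter> {z. \<exists>y\<in>int_vecs. norm (M n *v z - y) < \<psi> n / 2}) C R s')"
    and s: "0 < s" "s < s'" and psi_pos: "\<And>n. n \<ge> 1 \<Longrightarrow> \<psi> n > 0"
    and E: "\<And>z. infinite {n. n \<ge> 1 \<and> (\<exists>y\<in>int_vecs. norm (M n *v z - y) < \<psi> n)} \<Longrightarrow> torus_of z \<in> E"
  shows "hausdorff_measure s E \<noteq> 0"
proof
  assume zero: "hausdorff_measure s E = 0"
  from ratio obtain C where C: "C \<ge> 1" and ratio1: "\<And>x0 R. 0 < R \<Longrightarrow> R \<le> 1 \<Longrightarrow> (\<exists>\<^sub>F n in sequentially.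
    evenly_spread (ball x0 R \<inter> {z. \<exists>y\<in>int_vecs. norm (M n *v z - y) < \<psi> n / 2}) C R s')"
    by blast
  have C0: "C > 0" using C by simp
  define c where "c = 1 / (C * 4 powr s')"
  have "1 * 1 \<le> C * 4 powr s'" using C s by (intro mult_mono ge_one_powr_ge_zero) auto
  then have c: "c \<le> 1" "c > 0" unfolding c_def using C0 by (simp_all add: divide_le_eq)
  \<comment> \<open>Half of the budget at radius 1/8: one half for the given cover, the other for
    enlarging its members.\<close>
  define \<eta> where "\<eta> = c * (1/8) powr s / 2"
  have \<eta>: "\<eta> > 0" using c by (simp add: \<eta>_def)
  obtain U where U: "E \<subseteq> (\<Union>i. U i)" "\<And>i. bounded (U i)" "(\<Sum>i. hausdorff_gauge s (U i)) < ennreal \<eta>"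
    by (rule hausdorff_measure_zero_cover[OF zero, of "ennreal \<eta>" 1]) (use \<eta> in auto)
  define D where "D i = diameter (U i)" for i
  have D0: "D i \<ge> 0" for i unfolding D_def by (rule diameter_ge_0) (rule U)
  have gauge: "hausdorff_gauge s (U i) = ennreal (D i powr s)" for i
    using s by (simp add: hausdorff_gauge_def D_def)
  \<comment> \<open>The summable increments make all radii positive, even for members of diameter 0,
    and add exactly \<open>\<eta>\<close> to the total cost.\<close>
  define \<rho> where "\<rho> i = (D i powr s + \<eta> * (1/2) ^ Suc i) powr (1 / s)" for i
  have pos: "0 < D i powr s + \<eta> * (1/2) ^ Suc i" for i using \<eta> by (intro add_nonneg_pos) auto
  have \<rho>0: "\<rho> i > 0" for i using pos[of i] by (simp add: \<rho>_def)
  have \<rho>s: "\<rho> i powr s = D i powr s + \<eta> * (1/2) ^ Suc i" for i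
    using pos[of i] s by (simp add: \<rho>_def powr_powr)
  have D\<rho>: "D i \<le> \<rho> i" for i
  proof -
    have "D i powr s < \<rho> i powr s" unfolding \<rho>s using \<eta> by simp
    then show ?thesis using powr_less_cancel_base[OF _ s(1) \<rho>0] by (simp add: less_imp_le)
  qed
  have hit: "(\<Sum>i. ennreal (\<rho> i powr s)) < ennreal (c * (1/8) powr s)"
  proof -
    have "(\<lambda>i. \<eta> * (1/2) ^ Suc i) sums (\<eta> * 1)" by (rule sums_mult[OF power_half_series])
    then have geo: "(\<Sum>i. ennreal (\<eta> * (1/2) ^ Suc i)) = ennreal \<eta>"
      using \<eta> by (subst suminf_ennreal_eq[of _ "\<eta> * 1"]) auto
    have "(\<Sum>i. ennreal (\<rho> i powr s)) = (\<Sum>i. hausdorff_gauge s (U i) + ennreal (\<eta> * (1/2) ^ Suc i))"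
      unfolding \<rho>s gauge using \<eta> by (simp add: ennreal_plus)
    also have "\<dots> = (\<Sum>i. hausdorff_gauge s (U i)) + (\<Sum>i. ennreal (\<eta> * (1/2) ^ Suc i))"
      by (rule suminf_add[symmetric]) auto
    also have "\<dots> < ennreal \<eta> + ennreal \<eta>"
    proof -
      have "ennreal \<eta> + (\<Sum>i. hausdorff_gauge s (U i)) < ennreal \<eta> + ennreal \<eta>"
        unfolding ennreal_add_left_cancel_less using U(3) by simp
      then show ?thesis unfolding geo by (simp only: add.commute)
    qed
    also have "\<dots> = ennreal (c * (1/8) powr s)"
      using \<eta> by (simp add: ennreal_plus[symmetric] \<eta>_def del: ennreal_plus)
    finally show ?thesis .
  qed
  define V where "V i = {x \<in> cball (0 :: real ^ 'n) (1/8). torus_of x \<in> U i}" for i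
  \<comment> \<open>If \<open>V i\<close> is empty, \<open>p i\<close> is arbitrary; the extra ball
    is harmless because only the total cost matters.\<close>
  define p where "p i = (SOME x. x \<in> V i)" for i
  have Vp: "x \<in> cball (p i) (\<rho> i)" if x: "x \<in> V i" for x i
  proof -
    have "p i \<in> V i" unfolding p_def using x by (rule someI)
    have "dist (p i) x \<le> 1 / 2"
      using x \<open>p i \<in> V i\<close> dist_triangle[of "p i" x 0] by (auto simp: V_def dist_commute)
    then have "dist (p i) x \<le> dist (torus_of (p i)) (torus_of x)" by (rule dist_le_dist_torus)
    also have "\<dots> \<le> D i" unfolding D_def
      by (rule diameter_bounded_bound[OF U(2)]) (use x \<open>p i \<in> V i\<close> in \<open>auto simp: V_def\<close>)
    also have "\<dots> \<le> \<rho> i" by (rule D\<rho>)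
    finally show ?thesis by simp
  qed
  have R: "(0::real) < 1/8" "(1/8::real) \<le> 1" by simp_all
  have "\<exists>z\<in>cball 0 (1/8). (\<forall>i. z \<notin> cball (p i) (\<rho> i)) \<and>
    infinite {n. n \<ge> 1 \<and> (\<exists>y\<in>int_vecs. norm (M n *v z - y) < \<psi> n)}"
    by (rule limsup_set_not_covered[OF ratio1 C0 s c_def c(1) psi_pos R \<rho>0 hit])
  then obtain z where z: "z \<in> cball 0 (1/8)" "\<And>i. z \<notin> cball (p i) (\<rho> i)" "torus_of z \<in> E"
    using E by blast
  then obtain i where "torus_of z \<in> U i" using U(1) by blast
  then have "z \<in> V i" using z(1) by (simp add: V_def)
  then show False using Vp z(2) by blast
qed

end

section \<open>The upper bound\<close>

text \<open>A Borel-Cantelli argument: for every \<open>N\<close> the families with index at least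
  \<open>N\<close> together cover \<open>E\<close>, and their costs are dominated by the tail of a
  geometric series.\<close>

lemma hausdorff_measure_limsup_zero:
  fixes E :: "'a::metric_space set" and I :: "nat \<Rightarrow> 'b set" and W :: "nat \<Rightarrow> 'b \<Rightarrow> 'a set"
    and D :: "nat \<Rightarrow> real" and C \<theta> s :: real
  assumes s: "s > 0" and \<theta>: "\<theta> > 0" and D0: "\<And>n. D n \<ge> 0" and Dlim: "D \<longlonglongrightarrow> 0" and C: "C \<ge> 0"
    and fam: "\<forall>\<^sub>F n in sequentially. finite (I n) \<and> (\<forall>j\<in>I n. bounded (W n j) \<and> diameter (W n j) \<le> D n)
      \<and> real (card (I n)) * D n powr s \<le> C * exp (- (real n * \<theta>))"
    and cover: "\<And>x N. x \<in> E \<Longrightarrow> \<exists>n\<ge>N. \<exists>j\<in>I n. x \<in> W n j"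
  shows "hausdorff_measure s E = 0"
proof -
  have eps: "hausdorff_premeasure s \<delta> E \<le> 0 + ennreal \<eta>" if \<delta>: "\<delta> > 0" and \<eta>: "\<eta> > 0" for \<delta> \<eta> :: real
  proof -
    define q where "q = exp (- \<theta>)"
    have q: "0 < q" "q < 1" using \<theta> by (simp_all add: q_def)
    have qn: "exp (- (real n * \<theta>)) = q ^ n" for n
      unfolding q_def by (subst exp_of_nat_mult[symmetric]) simp
    have "(\<lambda>n. C * q ^ n / (1 - q)) \<longlonglongrightarrow> C * 0 / (1 - q)"
      using q by (intro tendsto_divide tendsto_mult tendsto_const LIMSEQ_realpow_zero) auto
    from order_tendstoD(2)[OF this, of \<eta>] have "\<forall>\<^sub>F n in sequentially. C * q ^ n / (1 - q) < \<eta>"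
      using \<eta> by simp
    moreover have "\<forall>\<^sub>F n in sequentially. D n < \<delta>" by (rule order_tendstoD(2)[OF Dlim \<delta>])
    ultimately have "\<forall>\<^sub>F n in sequentially. C * q ^ n / (1 - q) < \<eta> \<and> D n < \<delta> \<and>
      finite (I n) \<and> (\<forall>j\<in>I n. bounded (W n j) \<and> diameter (W n j) \<le> D n)
      \<and> real (card (I n)) * D n powr s \<le> C * q ^ n"
      using fam unfolding qn by eventually_elim blast
    then obtain N where N0: "\<And>n. n \<ge> N \<Longrightarrow> C * q ^ n / (1 - q) < \<eta> \<and> D n < \<delta> \<and>
      finite (I n) \<and> (\<forall>j\<in>I n. bounded (W n j) \<and> diameter (W n j) \<le> D n)
      \<and> real (card (I n)) * D n powr s \<le> C * q ^ n"
      unfolding eventually_sequentially by blast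
    have N: "C * q ^ n / (1 - q) < \<eta>" "D n < \<delta>" "finite (I n)"
      "real (card (I n)) * D n powr s \<le> C * q ^ n" if "n \<ge> N" for n
      using N0[OF that] by simp_all
    have NW: "bounded (W n j)" "diameter (W n j) \<le> D n" if "n \<ge> N" "j \<in> I n" for n j
      using N0[OF that(1)] that(2) by simp_all
    define f where "f n = (SOME f. bij_betw f {0..<card (I (n + N))} (I (n + N)))" for n
    have f: "bij_betw (f n) {0..<card (I (n + N))} (I (n + N))" for n
      unfolding f_def by (rule someI_ex[OF ex_bij_betw_nat_finite[OF N(3)]]) simp
    \<comment> \<open>Each finite family is padded with empty sets, of gauge 0, so that pairs of
      naturals enumerate all members.\<close>
    define U' where "U' = (\<lambda>(n, i). if i < card (I (n + N)) then W (n + N) (f n i) else {})"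
    define U where "U k = U' (prod_decode k)" for k
    have fI: "f n i \<in> I (n + N)" if "i < card (I (n + N))" for n i
      using f[of n] that by (auto simp: bij_betw_def)
    have U': "bounded (U' (n, i))" "diameter (U' (n, i)) \<le> D (n + N)" for n i
      using NW[OF _ fI, of n i] D0 by (simp_all add: U'_def)
    have "E \<subseteq> (\<Union>i. U i)"
    proof
      fix x assume "x \<in> E"
      from cover[OF this, of N] obtain n j where n: "n \<ge> N" "j \<in> I n" "x \<in> W n j" by blast
      define m where "m = n - N"
      have m: "n = m + N" using n by (simp add: m_def)
      have "j \<in> f m ` {0..<card (I n)}" using f[of m] n(2) unfolding m bij_betw_def by blast
      then obtain i where "i < card (I n)" "f m i = j" by auto
      then have "x \<in> U' (m, i)" using n(3) by (simp add: U'_def m)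
      then have "x \<in> U (prod_encode (m, i))" by (simp add: U_def)
      then show "x \<in> (\<Union>i. U i)" by blast
    qed
    moreover have "\<forall>i. bounded (U i) \<and> diameter (U i) \<le> \<delta>"
    proof
      fix i
      obtain n k where "prod_decode i = (n, k)" by (cases "prod_decode i")
      then show "bounded (U i) \<and> diameter (U i) \<le> \<delta>"
        using U'[of n k] N(2)[of "n + N"] by (simp add: U_def)
    qed
    ultimately have "hausdorff_premeasure s \<delta> E \<le> (\<Sum>i. hausdorff_gauge s (U i))"
      unfolding hausdorff_premeasure_def by (intro Inf_lower CollectI exI[of _ U] conjI refl)
    also have "\<dots> = (\<Sum>i. (\<lambda>p. hausdorff_gauge s (U' p)) (prod_decode i))" by (simp add: U_def)
    also have "\<dots> = (\<Sum>n. \<Sum>i. hausdorff_gauge s (U' (n, i)))"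
      by (rule suminf_ennreal_2dimen) simp
    also have "\<dots> \<le> (\<Sum>n. ennreal (C * q ^ N * q ^ n))"
    proof (intro suminf_le)
      fix n
      have "(\<Sum>i. hausdorff_gauge s (U' (n, i))) = (\<Sum>i\<in>{0..<card (I (n + N))}. hausdorff_gauge s (U' (n, i)))"
        by (rule suminf_finite) (auto simp: U'_def hausdorff_gauge_def)
      also have "\<dots> \<le> (\<Sum>i\<in>{0..<card (I (n + N))}. ennreal (D (n + N) powr s))"
      proof (rule sum_mono)
        fix i
        have "diameter (U' (n, i)) powr s \<le> D (n + N) powr s"
          using s U'[of n i] by (intro powr_mono2) (auto simp: diameter_ge_0)
        then show "hausdorff_gauge s (U' (n, i)) \<le> ennreal (D (n + N) powr s)"
          using s by (simp add: hausdorff_gauge_def ennreal_leI)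
      qed
      also have "\<dots> = ennreal (real (card (I (n + N))) * D (n + N) powr s)"
        unfolding sum_constant card_atLeastLessThan diff_zero
        by (subst ennreal_mult''[OF powr_ge_zero]) (simp add: ennreal_of_nat_eq_real_of_nat[symmetric])
      also have "\<dots> \<le> ennreal (C * q ^ N * q ^ n)"
        using N(4)[of "n + N"] by (intro ennreal_leI) (simp add: power_add mult_ac)
      finally show "(\<Sum>i. hausdorff_gauge s (U' (n, i))) \<le> ennreal (C * q ^ N * q ^ n)" .
    qed simp_all
    also have "\<dots> = ennreal (C * q ^ N * (1 / (1 - q)))"
    proof (rule suminf_ennreal_eq)
      show "0 \<le> C * q ^ N * q ^ n" for n using C q by simp
      show "(\<lambda>n. C * q ^ N * q ^ n) sums (C * q ^ N * (1 / (1 - q)))"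
        by (rule sums_mult[OF geometric_sums]) (use q in simp)
    qed
    also have "\<dots> \<le> ennreal \<eta>" using N(1)[of N] by (intro ennreal_leI) simp
    finally show ?thesis by simp
  qed
  have "hausdorff_premeasure s \<delta> E \<le> 0" if "\<delta> \<in> {0<..}" for \<delta>
  proof (rule ennreal_le_epsilon)
    fix e :: real assume "0 < e"
    with that show "hausdorff_premeasure s \<delta> E \<le> 0 + ennreal e" by (intro eps) simp_all
  qed
  then have "hausdorff_measure s E \<le> 0"
    unfolding hausdorff_measure_def by (rule SUP_least)
  then show ?thesis unfolding le_zero_eq .
qed

lemma torus_point_near_0: "\<exists>x\<in>cball (0 :: real ^ 'n) CARD('n). torus_of x = p"
proof -
  obtain w where w: "torus_of w = p" using torus_of_surj by blast
  obtain y where y: "y \<in> int_vecs" "norm (w - y) \<le> CARD('n)" using int_vecs_near by blast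
  have "- y $ i \<in> \<int>" for i using y(1) by (auto simp: int_vecs_def)
  then have "torus_of (w - y) = torus_of w" by (simp add: torus_of_eq_iff)
  then show ?thesis using w y(2) by (intro bexI[of _ "w - y"]) auto
qed

context expanding_sequence
begin

text \<open>A grid of mesh \<open>r * a k\<close> in the \<open>G\<close>-coordinates around the
  centre \<open>M' *v y\<close>: direction \<open>i\<close> needs about \<open>a i / a k\<close>
  cells, or boundedly many if that ratio is below 1. Pieces are labelled by the integer parts of the
  scaled coordinates.\<close>

lemma ellipsoid_grid_cover:
  fixes r :: real and a :: "'n \<Rightarrow> real"
  assumes M: "det (M n) \<noteq> 0" and con: "\<And>x i. \<bar>(G *v x) $ i\<bar> \<le> a i * norm (M n *v x)"
    and a: "\<And>i. a i > 0" and r: "r > 0"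
    and K: "\<And>x c. (\<And>i. \<bar>(G *v x) $ i\<bar> \<le> c) \<Longrightarrow> norm x \<le> K * c"
  obtains J :: "('n \<Rightarrow> int) set" and V :: "('n \<Rightarrow> int) \<Rightarrow> (real ^ 'n) set"
  where "finite J" "real (card J) \<le> (\<Prod>i\<in>UNIV. 5 * max 1 (a i / a k))"
    "{x. norm (M n *v x - y) < r} \<subseteq> (\<Union>m\<in>J. V m)"
    "\<And>m x x'. x \<in> V m \<Longrightarrow> x' \<in> V m \<Longrightarrow> dist x x' \<le> K * (r * a k)"
proof -
  define \<tau> where "\<tau> = r * a k"
  have \<tau>: "\<tau> > 0" using r a by (simp add: \<tau>_def)
  have "invertible (M n)" using M by (simp add: invertible_det_nz)
  then obtain M' where "M n ** M' = mat 1" by (auto simp: invertible_def)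
  then have w: "M n *v (M' *v y) = y" by (simp add: matrix_vector_mul_assoc)
  define b where "b i = \<lceil>a i / a k\<rceil>" for i
  define J where "J = PiE (UNIV :: 'n set) (\<lambda>i. {- b i .. b i})"
  define g where "g x = (\<lambda>i. \<lfloor>(G *v (x - M' *v y)) $ i / \<tau>\<rfloor>)" for x
  define V where "V m = {x. g x = m}" for m
  have b0: "b i \<ge> 0" for i 
  proof -
    have "0 < a i / a k" using a by simp
    then show ?thesis unfolding b_def by linarith
  qed
  show thesis
  proof (rule that[of J V])
    show "finite J" unfolding J_def by (rule finite_PiE) auto
    have "real (card J) = (\<Prod>i\<in>UNIV. real (card {- b i .. b i}))"
      unfolding J_def by (subst card_PiE) simp_all
    also have "\<dots> \<le> (\<Prod>i\<in>UNIV. 5 * max 1 (a i / a k))"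
    proof (intro prod_mono conjI)
      fix i
      have "real (card {- b i .. b i}) = 2 * of_int (b i) + 1" using b0[of i] by simp
      also have "\<dots> \<le> 2 * (a i / a k + 1) + 1"
        unfolding b_def by (rule add_right_mono[OF mult_left_mono[OF of_int_ceiling_le_add_one]]) simp
      also have "\<dots> \<le> 5 * max 1 (a i / a k)" by (simp add: max_def)
      finally show "real (card {- b i .. b i}) \<le> 5 * max 1 (a i / a k)" .
    qed auto
    finally show "real (card J) \<le> (\<Prod>i\<in>UNIV. 5 * max 1 (a i / a k))" .
    show "{x. norm (M n *v x - y) < r} \<subseteq> (\<Union>m\<in>J. V m)"
    proof safe
      fix x assume x: "norm (M n *v x - y) < r"
      have "g x i \<in> {- b i .. b i}" for i
      proof -
        have "a i * norm (M n *v (x - M' *v y)) \<le> a i * r"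
          using x a[of i] by (intro mult_left_mono) (simp_all add: matrix_vector_mult_diff_distrib w)
        then have "\<bar>(G *v (x - M' *v y)) $ i\<bar> \<le> a i * r" using con[of "x - M' *v y" i] by linarith
        then have "\<bar>(G *v (x - M' *v y)) $ i\<bar> / \<tau> \<le> a i * r / \<tau>" using \<tau> by (intro divide_right_mono) auto
        then have "\<bar>(G *v (x - M' *v y)) $ i / \<tau>\<bar> \<le> a i / a k" using r \<tau> by (simp add: \<tau>_def)
        then have "\<bar>(G *v (x - M' *v y)) $ i / \<tau>\<bar> \<le> of_int (b i)"
          unfolding b_def using le_of_int_ceiling order_trans by blast
        then show ?thesis unfolding g_def atLeastAtMost_iff
          unfolding abs_le_iff le_floor_iff floor_le_iff of_int_minus by linarith
      qed
      then show "x \<in> (\<Union>m\<in>J. V m)" unfolding V_def J_def by (intro UN_I[of "g x"]) auto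
    qed
    show "dist x x' \<le> K * (r * a k)" if x: "x \<in> V m" "x' \<in> V m" for m x x'
    proof -
      have "\<bar>(G *v (x - x')) $ i\<bar> \<le> \<tau>" for i
      proof -
        let ?u = "(G *v (x - M' *v y)) $ i / \<tau>" and ?u' = "(G *v (x' - M' *v y)) $ i / \<tau>"
        have "g x i = g x' i" using x by (simp add: V_def)
        then have "\<lfloor>?u\<rfloor> = \<lfloor>?u'\<rfloor>" by (simp add: g_def)
        then have "\<bar>?u - ?u'\<bar> \<le> 1" by linarith
        moreover have "?u - ?u' = (G *v (x - x')) $ i / \<tau>"
          by (simp add: matrix_vector_mult_diff_distrib diff_divide_distrib)
        ultimately show ?thesis using \<tau> by (simp add: abs_divide)
      qed
      then show ?thesis using K[of "x - x'" \<tau>] by (simp add: dist_norm \<tau>_def)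
    qed
  qed
qed

text \<open>About \<open>exp (n * sum l)\<close> ellipsoids, each cut into
  \<open>exp (n * sum (max 0 (l k - l i)))\<close> pieces, give a count with exponent the sum of
  \<open>max (l i) (l k)\<close>; the pieces have size about
  \<open>exp (- n * (\<alpha> + l k))\<close>. Thus \<open>sk\<close> says that the total
  \<open>s\<close>-cost decays exponentially.\<close>

lemma hausdorff_measure_torus_zero:
  fixes E :: "'n torus set"
  assumes s: "s > 0" and sk: "(\<Sum>i\<in>UNIV. max (l i) (l k)) < s * (\<alpha> + l k)"
    and psi_pos: "\<And>n. n \<ge> 1 \<Longrightarrow> \<psi> n > 0" and psi0: "\<psi> \<longlonglongrightarrow> 0"
    and psi_le: "\<forall>\<^sub>F n in sequentially. \<psi> n \<le> exp (- (real n * \<alpha>))"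
    and E: "\<And>z. torus_of z \<in> E \<Longrightarrow> infinite {n. n \<ge> 1 \<and> (\<exists>y\<in>int_vecs. norm (M n *v z - y) < \<psi> n)}"
  shows "hausdorff_measure s E = 0"
proof -
  let ?d = "real CARD('n)" and ?\<omega> = "unit_ball_vol (real CARD('n))"
  obtain K where K: "K \<ge> 1" "\<And>x i. \<bar>(G *v x) $ i\<bar> \<le> K * norm x" by (rule G_bound) blast
  obtain K' where K': "K' > 0" "\<And>x c. (\<And>i. \<bar>(G *v x) $ i\<bar> \<le> c) \<Longrightarrow> norm x \<le> K' * c"
    by (rule G_inverse_bound) blast
  obtain k0 where k0: "\<And>i. l k0 \<le> l i"
    using ex_min_if_finite[of "range l"] by (auto simp: not_less)
  \<comment> \<open>Half of the gap in \<open>sk\<close>; the other half pays for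
    \<open>s * e\<close>.\<close>
  define \<theta> where "\<theta> = (s * (\<alpha> + l k) - (\<Sum>i\<in>UNIV. max (l i) (l k))) / 2"
  have \<theta>: "\<theta> > 0" using sk by (simp add: \<theta>_def)
  define e where "e = min (l k0) (\<theta> / s)"
  have e: "e > 0" "s * e \<le> \<theta>"
    using \<theta> s l_pos[of k0] by (auto simp: e_def min_def field_simps)
  have el: "e \<le> l i" for i using k0[of i] by (simp add: e_def)
  define a where "a n i = exp (real n * (e - l i))" for n :: nat and i
  have a0: "a n i > 0" for n i by (simp add: a_def)
  have a1: "a n i \<le> 1" for n i using el[of i] by (simp add: a_def mult_nonneg_nonpos)
  \<comment> \<open>Every torus point has a lift in this ball, and eventually
    \<open>\<psi> n < 1/2\<close>, so these finitely many integer vectors account for all ellipsoids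
    needed.\<close>
  define Y where "Y n = {y \<in> int_vecs. \<exists>x\<in>cball (0 :: real ^ 'n) ?d. norm (M n *v x - y) \<le> 1/2}" for n
  define B where "B = (2 * (K * ?d + 1)) ^ CARD('n) / \<bar>det G\<bar> / (?\<omega> * (1/2) ^ CARD('n)) * 2 ^ CARD('n)"
  have B0: "B \<ge> 0" unfolding B_def using K by simp
  have con_ev: "\<forall>\<^sub>F n in sequentially. n \<ge> 1 \<and> (\<forall>x i. \<bar>(G *v x) $ i\<bar> \<le> a n i * norm (M n *v x))"
    unfolding a_def using eventually_contraction[OF e(1)] eventually_ge_at_top[of 1] by eventually_elim auto
  have Ycard: "finite (Y n)" "real (card (Y n)) \<le> B * exp (real n * (\<Sum>i\<in>UNIV. l i))"
    if n: "n \<ge> 1" and con: "\<And>x i. \<bar>(G *v x) $ i\<bar> \<le> a n i * norm (M n *v x)" for n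
  proof -
    have dM: "det (M n) \<noteq> 0" by (rule det_M_nonzero[OF n])
    have "a n i \<ge> 0" "K \<ge> 0" "?d \<ge> 0" "(1/2::real) \<ge> 0" for i using a0[of n i] K by simp_all
    note cnt = int_vecs_count[OF dM det_G con this(1) K(2) this(2-4), of 0, folded Y_def]
    show "finite (Y n)" by (rule cnt(1))
    have pos: "?\<omega> * (1/2) ^ CARD('n) / \<bar>det (M n)\<bar> > 0" using dM by simp
    have "(\<Prod>i\<in>UNIV. 2 * (K * ?d + a n i * (1/2 + 1/2))) \<le> (\<Prod>i\<in>(UNIV :: 'n set). 2 * (K * ?d + 1))"
      using a1[of n] a0[of n] K by (intro prod_mono) (auto simp: less_imp_le)
    then have "(\<Prod>i\<in>UNIV. 2 * (K * ?d + a n i * (1/2 + 1/2))) \<le> (2 * (K * ?d + 1)) ^ CARD('n)" by simp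
    then have "(\<Prod>i\<in>UNIV. 2 * (K * ?d + a n i * (1/2 + 1/2))) / \<bar>det G\<bar> \<le> (2 * (K * ?d + 1)) ^ CARD('n) / \<bar>det G\<bar>"
      by (rule divide_right_mono) simp
    then have "real (card (Y n)) * (?\<omega> * (1/2) ^ CARD('n) / \<bar>det (M n)\<bar>) \<le> (2 * (K * ?d + 1)) ^ CARD('n) / \<bar>det G\<bar>"
      using cnt(2) by (rule order_trans[rotated])
    then have "real (card (Y n)) \<le> (2 * (K * ?d + 1)) ^ CARD('n) / \<bar>det G\<bar> / (?\<omega> * (1/2) ^ CARD('n) / \<bar>det (M n)\<bar>)"
      using pos by (simp only: pos_le_divide_eq)
    also have "\<dots> = (2 * (K * ?d + 1)) ^ CARD('n) / \<bar>det G\<bar> / (?\<omega> * (1/2) ^ CARD('n)) * \<bar>det (M n)\<bar>"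
      by simp
    also have "\<dots> \<le> (2 * (K * ?d + 1)) ^ CARD('n) / \<bar>det G\<bar> / (?\<omega> * (1/2) ^ CARD('n)) *
        (2 ^ CARD('n) * exp (real n * (\<Sum>i\<in>UNIV. l i)))"
      using K by (intro mult_left_mono det_M_le) simp
    also have "\<dots> = B * exp (real n * (\<Sum>i\<in>UNIV. l i))" by (simp add: B_def)
    finally show "real (card (Y n)) \<le> B * exp (real n * (\<Sum>i\<in>UNIV. l i))" .
  qed
  define good where "good n \<longleftrightarrow> n \<ge> 1 \<and> (\<forall>x i. \<bar>(G *v x) $ i\<bar> \<le> a n i * norm (M n *v x))" for n
  have "\<exists>(J :: ('n \<Rightarrow> int) set) (V :: ('n \<Rightarrow> int) \<Rightarrow> (real ^ 'n) set). finite J \<and> real (card J) \<le> (\<Prod>i\<in>UNIV. 5 * max 1 (a n i / a n k)) \<and>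
      {x. norm (M n *v x - y) < \<psi> n} \<subseteq> (\<Union>m\<in>J. V m) \<and>
      (\<forall>m. \<forall>x\<in>V m. \<forall>x'\<in>V m. dist x x' \<le> K' * (\<psi> n * a n k))"
    if "good n" for n y
  proof -
    have n: "n \<ge> 1" "\<And>x i. \<bar>(G *v x) $ i\<bar> \<le> a n i * norm (M n *v x)" using that by (auto simp: good_def)
    show ?thesis
      by (rule ellipsoid_grid_cover[where y = y and k = k, OF det_M_nonzero[OF n(1)] n(2) a0 psi_pos[OF n(1)] K'(2)]) blast+
  qed
  then obtain J :: "nat \<Rightarrow> real ^ 'n \<Rightarrow> ('n \<Rightarrow> int) set"
    and V :: "nat \<Rightarrow> real ^ 'n \<Rightarrow> ('n \<Rightarrow> int) \<Rightarrow> (real ^ 'n) set" where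
    JV: "\<And>n y. good n \<Longrightarrow> finite (J n y) \<and> real (card (J n y)) \<le> (\<Prod>i\<in>UNIV. 5 * max 1 (a n i / a n k)) \<and>
      {x. norm (M n *v x - y) < \<psi> n} \<subseteq> (\<Union>m\<in>J n y. V n y m) \<and>
      (\<forall>m. \<forall>x\<in>V n y m. \<forall>x'\<in>V n y m. dist x x' \<le> K' * (\<psi> n * a n k))"
    by metis
  define W where "W n = (\<lambda>(y, m). torus_of ` V n y m)" for n
  define I where "I n = Sigma (Y n) (J n)" for n
  \<comment> \<open>The absolute value makes \<open>D\<close> nonnegative also at
    \<open>n = 0\<close>, where the sign of \<open>\<psi>\<close> is unknown.\<close>
  define D where "D n = K' * (\<bar>\<psi> n\<bar> * a n k)" for n
  have goodev: "\<forall>\<^sub>F n in sequentially. good n" using con_ev unfolding good_def .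
  show ?thesis
  proof (rule hausdorff_measure_limsup_zero[OF s \<theta>, of D "B * 5 ^ CARD('n) * K' powr s" I W E])
    show "0 \<le> D n" for n using K' a0[of n k] by (simp add: D_def)
    show "0 \<le> B * 5 ^ CARD('n) * K' powr s" using B0 by simp
    show "D \<longlonglongrightarrow> 0"
    proof (rule tendsto_sandwich[OF _ _ tendsto_const])
      show "\<forall>\<^sub>F n in sequentially. 0 \<le> D n" using K' a0 by (simp add: D_def less_imp_le)
      show "\<forall>\<^sub>F n in sequentially. D n \<le> K' * \<bar>\<psi> n\<bar>"
        using K' a1 by (intro always_eventually allI) (simp add: D_def mult_left_le)
      have "(\<lambda>n. K' * \<bar>\<psi> n\<bar>) \<longlonglongrightarrow> K' * \<bar>0\<bar>" by (intro tendsto_intros psi0)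
      then show "(\<lambda>n. K' * \<bar>\<psi> n\<bar>) \<longlonglongrightarrow> 0" by simp
    qed
    show "\<forall>\<^sub>F n in sequentially. finite (I n) \<and> (\<forall>j\<in>I n. bounded (W n j) \<and> diameter (W n j) \<le> D n)
      \<and> real (card (I n)) * D n powr s \<le> B * 5 ^ CARD('n) * K' powr s * exp (- (real n * \<theta>))"
      using goodev psi_le
    proof eventually_elim
      case (elim n)
      have n: "n \<ge> 1" and con: "\<And>x i. \<bar>(G *v x) $ i\<bar> \<le> a n i * norm (M n *v x)"
        using elim(1) by (auto simp: good_def)
      have \<psi>n: "\<psi> n > 0" by (rule psi_pos[OF n])
      note Yn = Ycard[OF n con]
      let ?P = "\<Prod>i\<in>UNIV. 5 * max 1 (a n i / a n k)"
      have P0: "?P \<ge> 0" by (intro prod_nonneg) simp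
      have fin: "finite (I n)" unfolding I_def using Yn(1) JV[OF elim(1)] by blast
      have dd: "bounded (W n j) \<and> diameter (W n j) \<le> D n" if "j \<in> I n" for j
      proof -
        obtain y m where j: "j = (y, m)" by (cases j)
        have le: "dist p p' \<le> D n" if pp: "p \<in> W n j" "p' \<in> W n j" for p p'
        proof -
          obtain x x' where x: "x \<in> V n y m" "x' \<in> V n y m" "p = torus_of x" "p' = torus_of x'"
            using pp by (auto simp: W_def j)
          have "dist p p' \<le> dist x x'" unfolding x(3,4) by (rule dist_torus_le)
          also have "\<dots> \<le> K' * (\<psi> n * a n k)" using JV[OF elim(1)] x(1,2) by blast
          finally show ?thesis using \<psi>n by (simp add: D_def)
        qed
        have "D n \<ge> 0" using K' a0[of n k] by (simp add: D_def)
        have "bounded (W n j)"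
        proof (cases "W n j = {}")
          case False
          then obtain p where "p \<in> W n j" by blast
          then show ?thesis using le unfolding bounded_def by blast
        qed simp
        moreover have "diameter (W n j) \<le> D n"
          using le \<open>D n \<ge> 0\<close> unfolding diameter_def by (auto intro!: cSUP_least)
        ultimately show ?thesis ..
      qed
      have "real (card (I n)) = (\<Sum>y\<in>Y n. real (card (J n y)))"
        unfolding I_def using Yn(1) JV[OF elim(1)] by (subst card_SigmaI) auto
      also have "\<dots> \<le> (\<Sum>y\<in>Y n. ?P)" by (intro sum_mono) (use JV[OF elim(1)] in blast)
      also have "\<dots> = real (card (Y n)) * ?P" by simp
      also have "\<dots> \<le> (B * exp (real n * (\<Sum>i\<in>UNIV. l i))) * ?P"
        by (rule mult_right_mono[OF Yn(2) P0])
      also have "?P = 5 ^ CARD('n) * exp (real n * (\<Sum>i\<in>UNIV. max 0 (l k - l i)))"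
      proof -
        have "max 1 (a n i / a n k) = exp (real n * max 0 (l k - l i))" for i
        proof -
          have "a n i / a n k = exp (real n * (l k - l i))"
            unfolding a_def by (subst exp_diff[symmetric]) (simp add: algebra_simps)
          then show ?thesis using n by (auto simp: max_def mult_le_0_iff zero_le_mult_iff)
        qed
        then show ?thesis by (simp add: prod.distrib exp_sum sum_distrib_left)
      qed
      finally have cardI: "real (card (I n)) \<le> B * exp (real n * (\<Sum>i\<in>UNIV. l i)) *
        (5 ^ CARD('n) * exp (real n * (\<Sum>i\<in>UNIV. max 0 (l k - l i))))" .
      have Dn: "D n powr s \<le> K' powr s * exp (- (real n * (s * (\<alpha> + l k) - \<theta>)))"
      proof -
        have "D n \<le> K' * (exp (- (real n * \<alpha>)) * a n k)"
          unfolding D_def using elim(2) \<psi>n K' a0[of n k] by (intro mult_left_mono mult_right_mono) auto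
        also have "\<dots> = K' * exp (- (real n * (\<alpha> + l k - e)))"
          unfolding a_def by (subst exp_add[symmetric]) (simp add: algebra_simps)
        finally have "D n powr s \<le> (K' * exp (- (real n * (\<alpha> + l k - e)))) powr s"
          using s K' a0[of n k] by (intro powr_mono2) (auto simp: D_def)
        also have "\<dots> = K' powr s * exp (- (real n * (s * (\<alpha> + l k) - s * e)))"
          using K' by (subst powr_mult) (auto simp: powr_def algebra_simps)
        also have "\<dots> \<le> K' powr s * exp (- (real n * (s * (\<alpha> + l k) - \<theta>)))"
          using e(2) by (intro mult_left_mono) (auto intro!: mult_left_mono)
        finally show ?thesis .
      qed
      have "real (card (I n)) * D n powr s \<le> (B * exp (real n * (\<Sum>i\<in>UNIV. l i)) *
        (5 ^ CARD('n) * exp (real n * (\<Sum>i\<in>UNIV. max 0 (l k - l i))))) *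
        (K' powr s * exp (- (real n * (s * (\<alpha> + l k) - \<theta>))))"
        using cardI Dn B0 by (intro mult_mono) auto
      also have "\<dots> = B * 5 ^ CARD('n) * K' powr s * (exp (real n * (\<Sum>i\<in>UNIV. l i)) *
        exp (real n * (\<Sum>i\<in>UNIV. max 0 (l k - l i))) * exp (- (real n * (s * (\<alpha> + l k) - \<theta>))))"
        by simp
      also have "exp (real n * (\<Sum>i\<in>UNIV. l i)) *
        exp (real n * (\<Sum>i\<in>UNIV. max 0 (l k - l i))) * exp (- (real n * (s * (\<alpha> + l k) - \<theta>)))
        = exp (- (real n * \<theta>))"
      proof -
        have "(\<Sum>i\<in>UNIV. l i) + (\<Sum>i\<in>UNIV. max 0 (l k - l i)) = (\<Sum>i\<in>UNIV. max (l i) (l k))"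
          by (subst sum.distrib[symmetric]) (intro sum.cong refl, simp add: max_def)
        then have *: "(\<Sum>i\<in>UNIV. l i) + (\<Sum>i\<in>UNIV. max 0 (l k - l i)) = s * (\<alpha> + l k) - 2 * \<theta>"
          unfolding \<theta>_def by (simp add: field_simps)
        have "exp (real n * (\<Sum>i\<in>UNIV. l i)) *
        exp (real n * (\<Sum>i\<in>UNIV. max 0 (l k - l i))) * exp (- (real n * (s * (\<alpha> + l k) - \<theta>)))
          = exp (real n * (((\<Sum>i\<in>UNIV. l i) + (\<Sum>i\<in>UNIV. max 0 (l k - l i))) - (s * (\<alpha> + l k) - \<theta>)))"
          by (simp only: exp_add[symmetric]) (simp add: algebra_simps)
        also have "\<dots> = exp (- (real n * \<theta>))" unfolding * by (simp add: algebra_simps)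
        finally show ?thesis .
      qed
      finally show ?case using fin dd by blast
    qed
    fix p N assume p: "p \<in> E"
    obtain x where x: "x \<in> cball (0 :: real ^ 'n) ?d" "torus_of x = p" using torus_point_near_0[of p] by blast
    have inf: "infinite {n. n \<ge> 1 \<and> (\<exists>y\<in>int_vecs. norm (M n *v x - y) < \<psi> n)}" using E p x(2) by blast
    have "\<forall>\<^sub>F n in sequentially. good n \<and> \<psi> n < 1/2"
      using goodev order_tendstoD(2)[OF psi0, of "1/2"] by (simp add: eventually_conj)
    then obtain N' where N': "\<And>n. n \<ge> N' \<Longrightarrow> good n \<and> \<psi> n < 1/2" unfolding eventually_sequentially by blast
    obtain n y where n: "n \<ge> max N N'" "y \<in> int_vecs" "norm (M n *v x - y) < \<psi> n"
      using inf unfolding infinite_nat_iff_unbounded_le by blast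
    have g: "good n" "\<psi> n < 1/2" using N'[of n] n(1) by auto
    have yY: "y \<in> Y n" unfolding Y_def using n(2,3) g(2) x(1) by (intro CollectI conjI bexI[of _ x]) auto
    obtain m where m: "m \<in> J n y" "x \<in> V n y m" using JV[OF g(1), of y] n(3) by blast
    show "\<exists>n\<ge>N. \<exists>j\<in>I n. p \<in> W n j"
    proof (intro exI[of _ n] conjI bexI[of _ "(y, m)"])
      show "N \<le> n" using n(1) by simp
      show "p \<in> W n (y, m)" using m(2) x(2) by (auto simp: W_def)
      show "(y, m) \<in> I n" using yY m(1) by (simp add: I_def)
    qed
  qed
qed

end

section \<open>The dimension formula\<close>

text \<open>Rewrites the numerator of the \<open>j\<close>-th quotient symmetrically in the rates,
  so that it can be transported to an unordered index type.\<close>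

lemma sum_max_sorted:
  fixes L :: "nat \<Rightarrow> real"
  assumes "mono_on {1..d} L" "j \<in> {1..d}"
  shows "(\<Sum>i=1..d. max (L i) (L j)) = real j * L j + (\<Sum>i=j+1..d. L i)"
proof -
  have "{1..d} = {1..j} \<union> {j+1..d}" using assms(2) by auto
  then have "(\<Sum>i=1..d. max (L i) (L j)) = (\<Sum>i=1..j. max (L i) (L j)) + (\<Sum>i=j+1..d. max (L i) (L j))"
    by (simp add: sum.union_disjoint)
  moreover have "(\<Sum>i=1..j. max (L i) (L j)) = (\<Sum>i=1..j. L j)"
    using assms by (intro sum.cong refl max_absorb2 mono_onD[OF assms(1)]) auto
  moreover have "(\<Sum>i=j+1..d. max (L i) (L j)) = (\<Sum>i=j+1..d. L i)"
    using assms by (intro sum.cong refl max_absorb1 mono_onD[OF assms(1)]) auto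
  ultimately show ?thesis by simp
qed

text \<open>Serves the upper bound, where the covers must be cheap for all large
  \<open>n\<close>.\<close>

lemma eventually_le_exp_of_liminf:
  fixes \<psi> :: "nat \<Rightarrow> real"
  assumes pos: "\<And>n. n \<ge> 1 \<Longrightarrow> \<psi> n > 0"
    and less: "ereal b < liminf (\<lambda>n. ereal (- ln (\<psi> n) / real n))"
  shows "\<forall>\<^sub>F n in sequentially. \<psi> n \<le> exp (- (real n * b))"
  using less_LiminfD[OF less] eventually_ge_at_top[of 1]
proof eventually_elim
  case (elim n)
  then have "real n * b < - ln (\<psi> n)" by (simp add: field_simps)
  then have "ln (\<psi> n) \<le> - (real n * b)" by simp
  then have "exp (ln (\<psi> n)) \<le> exp (- (real n * b))" by simp
  then show ?case using pos[of n] elim by simp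
qed

text \<open>Serves the lower bound, where infinitely many good times are enough to choose the nested
  balls.\<close>

lemma frequently_ge_exp_of_liminf:
  fixes \<psi> :: "nat \<Rightarrow> real"
  assumes pos: "\<And>n. n \<ge> 1 \<Longrightarrow> \<psi> n > 0"
    and less: "liminf (\<lambda>n. ereal (- ln (\<psi> n) / real n)) < ereal b"
  shows "\<exists>\<^sub>F n in sequentially. \<psi> n \<ge> exp (- (real n * b))"
proof (rule ccontr)
  assume "\<not> (\<exists>\<^sub>F n in sequentially. \<psi> n \<ge> exp (- (real n * b)))"
  then have "\<forall>\<^sub>F n in sequentially. \<psi> n < exp (- (real n * b))"
    by (simp add: not_frequently not_le)
  then have "\<forall>\<^sub>F n in sequentially. ereal b \<le> ereal (- ln (\<psi> n) / real n)"
    using eventually_ge_at_top[of 1]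
  proof eventually_elim
    case (elim n)
    then have "ln (\<psi> n) < ln (exp (- (real n * b)))" using pos[of n] by (subst ln_less_cancel_iff) auto
    then show ?case using elim by (simp add: field_simps)
  qed
  then have "ereal b \<le> liminf (\<lambda>n. ereal (- ln (\<psi> n) / real n))" by (rule Liminf_bounded)
  then show False using less by simp
qed

lemma hausdorff_dim_nonneg: "hausdorff_dim E \<ge> 0"
  unfolding hausdorff_dim_def by (rule Inf_greatest) auto

theorem theorem1p2:
  fixes A :: "int ^ 'n ^ 'n"
    and d :: nat
    and ev :: "nat \<Rightarrow> complex"
    and \<psi> :: "nat \<Rightarrow> real"
    and \<alpha> :: ereal
  assumes d: "d = CARD('n)"
    and eigenvalues: "charpoly (map_matrix of_int A) = (\<Prod>i=1..d. [:- ev i, 1:])"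
    and expanding: "1 < cmod (ev 1)"
    and ordered: "mono_on {1..d} (\<lambda>i. cmod (ev i))"
    and psi_pos: "\<And>n. n \<ge> 1 \<Longrightarrow> \<psi> n > 0"
    and psi_decreasing: "antimono_on {1..} \<psi>"
    and psi_tendsto: "\<psi> \<longlonglongrightarrow> 0"
    and alpha: "\<alpha> = liminf (\<lambda>n. ereal (- ln (\<psi> n) / real n))"
    and alpha_ge: "\<alpha> \<ge> ereal (ln (cmod (ev d / ev 1)))"
  shows "hausdorff_dim (recurrence_set (torus_map A) \<psi>) =
    (MIN j\<in>{1..d}.
       ereal (real j * ln (cmod (ev j)) + (\<Sum>i=j+1..d. ln (cmod (ev i))))
         / (\<alpha> + ereal (ln (cmod (ev j)))))"
proof -
  let ?A = "map_matrix real_of_int A"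
  let ?E = "recurrence_set (torus_map A) \<psi>"
  define M where "M n = matpow ?A n - mat 1" for n
  define L where "L j = ln (cmod (ev j))" for j
  define N where "N j = real j * L j + (\<Sum>i=j+1..d. L i)" for j
  have d1: "1 \<in> {1..d}" "d \<in> {1..d}" unfolding d using zero_less_card_finite[where 'a = 'n] by (simp_all add: Suc_le_eq)
  have ev1: "1 < cmod (ev j)" if "j \<in> {1..d}" for j
    using mono_onD[OF ordered d1(1) that] that expanding by simp
  have Lpos: "L j > 0" if "j \<in> {1..d}" for j
    unfolding L_def using ev1[OF that] by (rule ln_gt_zero)
  have Lmono: "mono_on {1..d} L"
  proof (rule mono_onI)
    fix i j assume ij: "i \<in> {1..d}" "j \<in> {1..d}" "i \<le> j"
    have "0 < cmod (ev i)" using ev1[OF ij(1)] by linarith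
    then show "L i \<le> L j"
      unfolding L_def using mono_onD[OF ordered ij] by (subst ln_le_cancel_iff) linarith+
  qed
  have "ln (cmod (ev d / ev 1)) = L d - L 1"
  proof -
    have "0 < cmod (ev d)" "0 < cmod (ev 1)" using ev1[OF d1(1)] ev1[OF d1(2)] by linarith+
    then show ?thesis unfolding L_def norm_divide by (subst ln_div) simp_all
  qed
  then have alpha_spread: "\<alpha> \<ge> ereal (L d - L 1)" using alpha_ge by simp
  have "L 1 \<le> L d" using d1 by (intro mono_onD[OF Lmono]) auto
  then have alpha0: "\<alpha> \<ge> 0" using alpha_spread order_trans[of 0 "ereal (L d - L 1)" \<alpha>] by simp
  have "map_matrix complex_of_real ?A = map_matrix of_int A"
    by (simp add: map_matrix_def)
  then have cp: "charpoly (map_matrix complex_of_real ?A) = (\<Prod>i=1..CARD('n). [:- ev i, 1:])"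
    using eigenvalues d by simp
  obtain G :: "real ^ 'n ^ 'n" and h :: "'n \<Rightarrow> nat" where h: "bij_betw h UNIV {1..CARD('n)}"
    and G: "det G \<noteq> 0"
    "\<And>e. e > 0 \<Longrightarrow> \<exists>C>0. \<forall>n\<ge>1. \<forall>x i. \<bar>(G *v x) $ i\<bar> \<le>
       C * exp (real n * (e - ln (cmod (ev (h i))))) * norm ((matpow ?A n - mat 1) *v x)"
    "\<And>n. \<bar>det (matpow ?A n - mat 1)\<bar> \<le> 2 ^ CARD('n) * exp (real n * (\<Sum>i\<in>UNIV. ln (cmod (ev (h i)))))"
    by (rule expanding_matrix_estimates[OF cp expanding ordered[unfolded d]]) blast
  have hd: "h i \<in> {1..d}" for i using h d by (auto simp: bij_betw_def)
  define l where "l i = L (h i)" for i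
  interpret expanding_sequence M G l
  proof
    show "det G \<noteq> 0" by (rule G)
    show "0 < l i" for i unfolding l_def by (rule Lpos[OF hd])
    show "\<exists>C>0. \<forall>n\<ge>1. \<forall>x i. \<bar>(G *v x) $ i\<bar> \<le> C * exp (real n * (e - l i)) * norm (M n *v x)" if "0 < e" for e
      unfolding l_def L_def M_def by (rule G(2)[OF that])
    show "\<bar>det (M n)\<bar> \<le> 2 ^ CARD('n) * exp (real n * sum l UNIV)" for n
      unfolding l_def L_def M_def by (rule G(3))
  qed
  have sum_l: "(\<Sum>i\<in>UNIV. max (l i) (L j)) = N j" if "j \<in> {1..d}" for j
  proof -
    have "(\<Sum>i\<in>UNIV. max (l i) (L j)) = (\<Sum>i=1..d. max (L i) (L j))"
      unfolding l_def d by (rule sum.reindex_bij_betw[OF h])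
    then show ?thesis unfolding N_def by (simp only: sum_max_sorted[OF Lmono that])
  qed
  have N0: "N j > 0" if "j \<in> {1..d}" for j
  proof -
    have "(\<Sum>i\<in>UNIV. max (l i) (L j)) > 0"
      using Lpos[OF that] by (intro sum_pos) (auto simp: less_max_iff_disj)
    then show ?thesis by (simp add: sum_l[OF that])
  qed
  have mem: "torus_of x \<in> ?E \<longleftrightarrow> infinite {n. n \<ge> 1 \<and> (\<exists>y\<in>int_vecs. norm (M n *v x - y) < \<psi> n)}" for x
    unfolding M_def by (rule torus_of_mem_recurrence_set)
  let ?v = "\<lambda>j. ereal (N j) / (\<alpha> + ereal (L j))"
  have upper: "hausdorff_dim ?E \<le> ?v j" if j: "j \<in> {1..d}" for j
  proof (rule dense_ge)
    fix x assume "?v j < x"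
    then obtain s where s: "?v j < ereal s" "ereal s < x" using ereal_dense2 by blast
    obtain k where k: "l k = L j" using h j unfolding l_def d bij_betw_def by (metis imageE)
    have "?v j \<ge> 0" using alpha0 N0[OF j] Lpos[OF j] by (cases \<alpha>) auto
    then have s0: "s > 0" using s(1) by (cases "?v j") auto
    \<comment> \<open>The cover estimate needs a real rate that \<open>\<psi>\<close> eventually
      beats, so \<open>\<alpha>\<close> is replaced by some \<open>b\<close> below it. For finite
      \<open>\<alpha>\<close> half of the gap is given up; for \<open>\<alpha> = \<infinity>\<close>
      the value \<open>N j / s\<close> is already large enough.\<close>
    have "\<exists>b. ereal b < \<alpha> \<and> N j < s * (b + L j)"
    proof (cases \<alpha>)
      case (real r)
      have r: "r + L j > 0" using alpha0 Lpos[OF j] real by simp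
      have "?v j = ereal (N j / (r + L j))" using r by (simp add: real)
      then have "N j < s * (r + L j)" using s(1) r by (simp add: pos_divide_less_eq)
      then have g: "s * (r + L j) - N j > 0" by simp
      define b where "b = r - (s * (r + L j) - N j) / (2 * s)"
      have "b < r" using g s0 by (simp add: b_def)
      moreover have "s * (b + L j) = s * (r + L j) - (s * (r + L j) - N j) / 2"
        using s0 by (simp add: b_def field_simps)
      then have "N j < s * (b + L j)" using g by argo
      ultimately show ?thesis by (intro exI[of _ b]) (simp add: real)
    next
      case PInf
      have "s * (N j / s + L j) = N j + s * L j" using s0 by (simp add: field_simps)
      then show ?thesis using PInf s0 Lpos[OF j] by (intro exI[of _ "N j / s"]) simp
    qed (use alpha0 in simp)
    then obtain b where b: "ereal b < \<alpha>" "N j < s * (b + L j)" by blast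
    have "hausdorff_measure s ?E = 0"
    proof (rule hausdorff_measure_torus_zero[OF s0 _ psi_pos psi_tendsto])
      show "(\<Sum>i\<in>UNIV. max (l i) (l k)) < s * (b + l k)" unfolding k sum_l[OF j] by (rule b)
      show "\<forall>\<^sub>F n in sequentially. \<psi> n \<le> exp (- (real n * b))"
        by (rule eventually_le_exp_of_liminf[OF psi_pos b(1)[unfolded alpha]])
    qed (simp_all add: mem)
    then have "hausdorff_dim ?E \<le> ereal s"
      unfolding hausdorff_dim_def using s0 by (intro Inf_lower) auto
    then show "hausdorff_dim ?E \<le> x" using s(2) by simp
  qed
  have lower: "Min (?v ` {1..d}) \<le> hausdorff_dim ?E"
  proof (cases \<alpha>)
    case PInf
    \<comment> \<open>With infinite \<open>\<alpha>\<close> the quotient is 0 in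
      \<open>ereal\<close>, so nonnegativity of the dimension suffices.\<close>
    have "Min (?v ` {1..d}) \<le> ?v 1" using d1 by (intro Min_le) auto
    then show ?thesis using hausdorff_dim_nonneg[of ?E] by (simp add: PInf)
  next
    case MInf
    then show ?thesis using alpha0 by simp
  next
    case (real r)
    have r0: "r \<ge> 0" and spread: "L d - L 1 \<le> r" using alpha0 alpha_spread by (simp_all add: real)
    have rL: "r + L j > 0" if "j \<in> {1..d}" for j using r0 Lpos[OF that] by simp
    have v: "?v j = ereal (N j / (r + L j))" if "j \<in> {1..d}" for j using rL[OF that] by (simp add: real)
    show ?thesis
      unfolding hausdorff_dim_def
    proof (rule Inf_greatest)
      fix y assume "y \<in> {ereal s |s. 0 \<le> s \<and> hausdorff_measure s ?E = 0}"
      then obtain s where s: "y = ereal s" "s \<ge> 0" "hausdorff_measure s ?E = 0" by blast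
      show "Min (?v ` {1..d}) \<le> y"
      proof (rule ccontr)
        assume "\<not> Min (?v ` {1..d}) \<le> y"
        then have less: "ereal s < Min (?v ` {1..d})" by (simp add: s(1))
        have s_less: "s < N j / (r + L j)" if j: "j \<in> {1..d}" for j
        proof -
          have "Min (?v ` {1..d}) \<le> ?v j" using j by (intro Min_le) auto
          then have "ereal s < ?v j" using less by (rule order.strict_trans2[rotated])
          then show ?thesis by (simp add: v[OF j])
        qed
        define H where "H = Min ((\<lambda>j. N j / (r + L j)) ` {1..d})"
        have H: "H \<le> N j / (r + L j)" if "j \<in> {1..d}" for j unfolding H_def using that by (intro Min_le) auto
        have sH: "s < H" unfolding H_def using s_less d1 by (subst Min_gr_iff) auto
        \<comment> \<open>The quotient at \<open>j = d\<close> is at most \<open>d\<close>; this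
          supplies the bound on the exponent required by
          \<open>near_int_measure_ratio\<close>.\<close>
        have Hd: "H \<le> real d"
        proof -
          have "N d = real d * L d" by (simp add: N_def)
          also have "\<dots> \<le> real d * (r + L d)" using r0 by (intro mult_left_mono) auto
          finally have "N d / (r + L d) \<le> real d" using rL[OF d1(2)] by (simp add: pos_divide_le_eq)
          then show ?thesis using H[OF d1(2)] by linarith
        qed
        \<comment> \<open>The fixed point 0 is recurrent, so the set is nonempty and exponent 0 is
          excluded.\<close>
        have "torus_of (0 :: real ^ 'n) \<in> ?E"
        proof -
          have "n \<ge> 1 \<and> (\<exists>y\<in>int_vecs. norm (M n *v 0 - y) < \<psi> n)" if "n \<ge> 1" for n
            using that psi_pos[OF that] by (intro conjI bexI[of _ 0]) (simp_all add: int_vecs_def)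
          then have "{n. n \<ge> 1 \<and> (\<exists>y\<in>int_vecs. norm (M n *v (0 :: real ^ 'n) - y) < \<psi> n)} = {1..}" by auto
          then show ?thesis unfolding mem by (simp add: infinite_Ici)
        qed
        then have "s \<noteq> 0" using s(3) hausdorff_measure_0_eq_0 by blast
        then have s0: "s > 0" using s(2) by simp
        \<comment> \<open>Two gaps are needed: from \<open>s'\<close> up to \<open>H\<close> for the
          mass estimate, and from \<open>s\<close> up to \<open>s'\<close> for the
          averaging.\<close>
        define s' where "s' = (s + H) / 2"
        have s': "s < s'" "s' < H" "0 < s'" "s' \<le> real CARD('n)" using sH s0 Hd by (simp_all add: s'_def d[symmetric])
        have "hausdorff_measure s ?E \<noteq> 0"
        proof (rule hausdorff_measure_torus_nonzero[OF _ s0 s'(1) psi_pos])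
          show "\<exists>C\<ge>1. \<forall>x0 R. 0 < R \<longrightarrow> R \<le> 1 \<longrightarrow> (\<exists>\<^sub>F n in sequentially.
              evenly_spread (ball x0 R \<inter> {z. \<exists>y\<in>int_vecs. norm (M n *v z - y) < \<psi> n / 2}) C R s')"
          proof (rule near_int_measure_ratio[OF r0 _ _ s'(3,2,4) psi_pos psi_tendsto])
            fix i j
            have "l i \<le> L d" "L 1 \<le> l j"
              unfolding l_def using hd d1 by (auto intro!: mono_onD[OF Lmono])
            then show "l i - l j \<le> r" using spread by linarith
          next
            fix k
            have "H * (r + l k) \<le> N (h k)"
              using H[OF hd[of k]] rL[OF hd[of k]] by (simp add: l_def pos_le_divide_eq)
            then show "H * (r + l k) \<le> (\<Sum>i\<in>UNIV. max (l i) (l k))"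
              using sum_l[OF hd[of k]] by (simp add: l_def)
          next
            fix e :: real assume "e > 0"
            then have less: "liminf (\<lambda>n. ereal (- ln (\<psi> n) / real n)) < ereal (r + e)"
              unfolding alpha[symmetric] real by simp
            show "\<exists>\<^sub>F n in sequentially. \<psi> n \<ge> exp (- (real n * (r + e)))"
              by (rule frequently_ge_exp_of_liminf[OF psi_pos less])
          qed
        qed (simp_all add: mem)
        then show False using s(3) by blast
      qed
    qed
  qed
  have "Min (?v ` {1..d}) \<in> ?v ` {1..d}" using d1 by (intro Min_in) auto
  then obtain j where "j \<in> {1..d}" "Min (?v ` {1..d}) = ?v j" by auto
  then have "hausdorff_dim ?E = Min (?v ` {1..d})" using upper lower by (metis antisym)
  then show ?thesis unfolding N_def L_def .
qed

end
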